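(* Let $(M,\omega)$ be a symplectic manifold, $\nabla$ a symplectic connection on $M$ and $R$ its curvature. Let $\alpha^\hbar\in\hbar Z^2_{DR}(M)[[\hbar]]$ be a formal series of closed $2$-forms and put $\Omega=\omega+\alpha^\hbar$. Let $*$ be the Fedosov star product (built with $\nabla$) of trivial Weyl curvature $\omega$, written $f*g=fg-\frac{i\hbar}2\bar\omega(f,g)+\sum_{n\ge2}\hbar^nC_n(f,g)$, and let $\tilde*$ be the Fedosov star product (built with the same $\nabla$) of Weyl curvature $\Omega$. Let $\bar\Omega$ be the formal Poisson bivector defined by $\Omega_{ij}\bar\Omega^{jk}=\delta_i^k$. Then $\Omega$ appears explicitly, in the formal Poisson form $\bar\Omega$, as a part of the formula for $\tilde*$, and $\bar\Omega$ can be seen as all the $1$-differentiable terms of $\tilde*$ not containing $R$ or derivatives of $\alpha^\hbar$. For all $f,g\in C^\infty(M)$ one has $$f\,\tilde*\,g=f*g+\frac{i\hbar}2\sum_{p\ge1}(\bar\alpha^\hbar)^{\diamond p}(f,g)+\rho(f,g)$$ $$=fg-\frac{i\hbar}2\Big(\bar\omega(f,g)-\sum_{p\ge1}(\bar\alpha^\hbar)^{\diamond p}(f,g)\Big)+\sum_{n\ge2}\hbar^nC_n(f,g)+\rho(f,g)$$ $$=fg-\frac{i\hbar}2\bar\Omega(f,g)+\sum_{n\ge2}\hbar^nC_n(f,g)+\rho(f,g),$$ where the terms occurring in the remainder $\rho$ either depend explicitly on the curvature $R$ or on derivatives of $\alpha^\hbar$, or are not $1$-differentiable.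
   Context: Summation over repeated indices is understood. $Z^2_{DR}(M)$ is the space of closed $2$-forms. Write $2$-forms as $\alpha=\alpha_{ij}dx^i\otimes dx^j=\frac12\alpha_{ij}dx^i\wedge dx^j$, and similarly for bivectors; a bivector $A$ acts on functions by $A(f,g)=A^{ij}\partial_if\,\partial_jg$. The bivector $\bar\omega=\bar\omega^{ij}\partial_i\otimes\partial_j$ is defined by $\omega_{ij}\bar\omega^{jk}=\delta_i^k$. For a covariant $2$-tensor $\alpha$, $\bar\alpha=-\bar\omega^{ir}\bar\omega^{js}\alpha_{rs}\,\partial_i\otimes\partial_j$; $\bar\alpha^\hbar$ is obtained by applying this coefficientwise to $\alpha^\hbar$. Diamond contraction: $A\diamond B=\omega_{rs}A^{ri}B^{sj}\,\partial_i\otimes\partial_j$ for contravariant $2$-tensors, extended bilinearly to formal series in $\hbar$; $A^{\diamond1}=A$, $A^{\diamond n}=A\diamond A^{\diamond(n-1)}$. A $1$-differentiable term is a term of the star product that is a $(1,1)$-bidifferential operator in $(f,g)$, i.e. of first order in each argument. Fedosov star product. $R=\frac14R_{ijkl}y^iy^jdx^k\wedge dx^l$ is the curvature of $\nabla$ viewed as a form with values in the bundle $W$ of formal Weyl algebras, whose sections are formal series $a(x,y,\hbar)$ in $\hbar$ (degree $2$) and in the fibre coordinates $y^i$ of $TM$ (degree $1$). The product is $$a\circ b=\sum_{n\ge0}\Big(-\frac{i\hbar}{2}\Big)^n\frac1{n!}\bar\omega^{i_1j_1}\cdots\bar\omega^{i_nj_n}\frac{\partial^na}{\partial y^{i_1}\cdots\partial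 y^{i_n}}\frac{\partial^nb}{\partial y^{j_1}\cdots\partial y^{j_n}},$$ extended to $W$-valued forms by the exterior product of the $dx^i$, with graded commutator $[\cdot,\cdot]$. $\partial$ is the covariant exterior derivative of $\nabla$; on a $q$-form homogeneous of degree $p$ in $y$, $\delta^{-1}a=\frac1{p+q}y^k\,i(\partial/\partial x^k)a$ if $p+q>0$, and $\delta^{-1}a=0$ if $p+q=0$; $\sigma(a)=a|_{y=0}$. For Weyl curvature $\Omega\in\omega+\hbar Z^2_{DR}(M)[[\hbar]]$, $r$ is the unique $W$-valued $1$-form of degree $\ge3$ with $r=\delta^{-1}(R+\Omega-\omega)+\delta^{-1}(\partial r+\frac i\hbar r\circ r)$; each function $f$ has a unique lift $a_f=f+\delta^{-1}(\partial a_f+\frac i\hbar[r,a_f])$; and the star product of $f$ and $g$ is $\sigma(a_f\circ a_g)$. The formula (explicit expression) for the star product is the one obtained by solving these recursions iteratively. *)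

theory Defs
  imports "HOL-Analysis.Analysis" "HOL-Library.Poly_Mapping"
begin

section \<open>Symplectic manifolds and symplectic connections in charts\<close>

definition pd :: "'n::finite \<Rightarrow> (real^'n \<Rightarrow> 'b::real_normed_vector) \<Rightarrow> real^'n \<Rightarrow> 'b" where
  "pd i u x = frechet_derivative u (at x) (axis i 1)"

text \<open>Smoothness on an open set: all iterated partial derivatives are (Frechet) differentiable.\<close>

definition smooth_on :: "(real^'n::finite) set \<Rightarrow> (real^'n \<Rightarrow> 'b::real_normed_vector) \<Rightarrow> bool" where
  "smooth_on S u \<longleftrightarrow> (\<forall>I. foldr pd I u differentiable_on S)"

type_synonym ('m, 'n) chart = "'m set \<times> ('m \<Rightarrow> real^'n)"

definition cimg :: "('m, 'n::finite) chart \<Rightarrow> (real^'n) set" where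
  "cimg c = snd c ` fst c"

definition cinv :: "('m, 'n::finite) chart \<Rightarrow> real^'n \<Rightarrow> 'm" where
  "cinv c = inv_into (fst c) (snd c)"

definition overlap :: "('m, 'n::finite) chart \<Rightarrow> ('m, 'n) chart \<Rightarrow> (real^'n) set" where
  "overlap c c' = snd c ` (fst c \<inter> fst c')"

definition transition :: "('m, 'n::finite) chart \<Rightarrow> ('m, 'n) chart \<Rightarrow> real^'n \<Rightarrow> real^'n" where
  "transition c c' = snd c' \<circ> cinv c"

definition jac :: "('m, 'n::finite) chart \<Rightarrow> ('m, 'n) chart \<Rightarrow> real^'n \<Rightarrow> 'n \<Rightarrow> 'n \<Rightarrow> real" where
  "jac c c' x a i = pd i (\<lambda>x. vec_nth (transition c c' x) a) x"

definition smooth_manifold :: "'m topology \<Rightarrow> ('m, 'n::finite) chart set \<Rightarrow> bool" where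
  "smooth_manifold X \<A> \<longleftrightarrow>
     Hausdorff_space X \<and> second_countable X \<and> (\<Union>c\<in>\<A>. fst c) = topspace X \<and>
     (\<forall>c\<in>\<A>. openin X (fst c) \<and> open (cimg c) \<and>
        homeomorphic_map (subtopology X (fst c)) (top_of_set (cimg c)) (snd c)) \<and>
     (\<forall>c\<in>\<A>. \<forall>c'\<in>\<A>. smooth_on (overlap c c') (transition c c'))"

definition smooth_function :: "('m, 'n::finite) chart set \<Rightarrow> ('m \<Rightarrow> complex) \<Rightarrow> bool" where
  "smooth_function \<A> f \<longleftrightarrow> (\<forall>c\<in>\<A>. smooth_on (cimg c) (f \<circ> cinv c))"

text \<open>Tensor fields are families of component functions, one for each chart \<open>c\<close>, defined on the
  coordinate domain \<open>cimg c\<close> and related by the tensorial transformation law. Their values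
  outside \<open>cimg c\<close> are irrelevant.\<close>

definition two_form ::
  "('m, 'n::finite) chart set \<Rightarrow>
   (('m, 'n) chart \<Rightarrow> real^'n \<Rightarrow> 'n \<Rightarrow> 'n \<Rightarrow> 'b::real_normed_field) \<Rightarrow> bool" where
  "two_form \<A> \<alpha> \<longleftrightarrow>
     (\<forall>c\<in>\<A>. \<forall>i j. smooth_on (cimg c) (\<lambda>x. \<alpha> c x i j) \<and>
        (\<forall>x\<in>cimg c. \<alpha> c x i j = - \<alpha> c x j i)) \<and>
     (\<forall>c\<in>\<A>. \<forall>c'\<in>\<A>. \<forall>x\<in>overlap c c'. \<forall>i j.
        \<alpha> c x i j = (\<Sum>a\<in>UNIV. \<Sum>b\<in>UNIV.
          of_real (jac c c' x a i * jac c c' x b j) * \<alpha> c' (transition c c' x) a b))"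

definition closed_two_form ::
  "('m, 'n::finite) chart set \<Rightarrow>
   (('m, 'n) chart \<Rightarrow> real^'n \<Rightarrow> 'n \<Rightarrow> 'n \<Rightarrow> 'b::real_normed_field) \<Rightarrow> bool" where
  "closed_two_form \<A> \<alpha> \<longleftrightarrow> two_form \<A> \<alpha> \<and>
     (\<forall>c\<in>\<A>. \<forall>x\<in>cimg c. \<forall>i j k.
        pd i (\<lambda>x. \<alpha> c x j k) x + pd j (\<lambda>x. \<alpha> c x k i) x + pd k (\<lambda>x. \<alpha> c x i j) x = 0)"

definition symplectic_manifold ::
  "'m topology \<Rightarrow> ('m, 'n::finite) chart set \<Rightarrow>
   (('m, 'n) chart \<Rightarrow> real^'n \<Rightarrow> 'n \<Rightarrow> 'n \<Rightarrow> real) \<Rightarrow> bool" where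
  "symplectic_manifold X \<A> \<omega> \<longleftrightarrow> smooth_manifold X \<A> \<and> closed_two_form \<A> \<omega> \<and>
     (\<forall>c\<in>\<A>. \<forall>x\<in>cimg c. invertible (\<chi> i j. \<omega> c x i j))"

text \<open>\<open>\<Gamma> c x k i j\<close> is the Christoffel symbol \<open>\<Gamma>\<^sup>k\<^sub>i\<^sub>j\<close>, that is,
  \<open>\<nabla>\<^sub>i \<partial>\<^sub>j = \<Gamma>\<^sup>k\<^sub>i\<^sub>j \<partial>\<^sub>k\<close>. A symplectic connection is a torsion-free connection with
  \<open>\<nabla> \<omega> = 0\<close>.\<close>

definition connection ::
  "('m, 'n::finite) chart set \<Rightarrow>
   (('m, 'n) chart \<Rightarrow> real^'n \<Rightarrow> 'n \<Rightarrow> 'n \<Rightarrow> 'n \<Rightarrow> real) \<Rightarrow> bool" where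
  "connection \<A> \<Gamma> \<longleftrightarrow>
     (\<forall>c\<in>\<A>. \<forall>k i j. smooth_on (cimg c) (\<lambda>x. \<Gamma> c x k i j)) \<and>
     (\<forall>c\<in>\<A>. \<forall>c'\<in>\<A>. \<forall>x\<in>overlap c c'. \<forall>a i j.
        (\<Sum>k\<in>UNIV. jac c c' x a k * \<Gamma> c x k i j) =
        (\<Sum>b\<in>UNIV. \<Sum>d\<in>UNIV. \<Gamma> c' (transition c c' x) a b d * jac c c' x b i * jac c c' x d j)
        + pd i (\<lambda>x. jac c c' x a j) x)"

definition symplectic_connection ::
  "('m, 'n::finite) chart set \<Rightarrow>
   (('m, 'n) chart \<Rightarrow> real^'n \<Rightarrow> 'n \<Rightarrow> 'n \<Rightarrow> real) \<Rightarrow>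
   (('m, 'n) chart \<Rightarrow> real^'n \<Rightarrow> 'n \<Rightarrow> 'n \<Rightarrow> 'n \<Rightarrow> real) \<Rightarrow> bool" where
  "symplectic_connection \<A> \<omega> \<Gamma> \<longleftrightarrow> connection \<A> \<Gamma> \<and>
     (\<forall>c\<in>\<A>. \<forall>x\<in>cimg c. \<forall>i j k.
        \<Gamma> c x k i j = \<Gamma> c x k j i \<and>
        pd k (\<lambda>x. \<omega> c x i j) x - (\<Sum>l\<in>UNIV. \<Gamma> c x l k i * \<omega> c x l j)
          - (\<Sum>l\<in>UNIV. \<Gamma> c x l k j * \<omega> c x i l) = 0)"

text \<open>\<open>curvature \<Gamma> x m j k l\<close> is \<open>R\<^sup>m\<^sub>j\<^sub>k\<^sub>l\<close>, where \<open>R(\<partial>\<^sub>k, \<partial>\<^sub>l) \<partial>\<^sub>j = R\<^sup>m\<^sub>j\<^sub>k\<^sub>l \<partial>\<^sub>m\<close>; the index is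
  lowered by \<open>R\<^sub>i\<^sub>j\<^sub>k\<^sub>l = \<omega>\<^sub>i\<^sub>m R\<^sup>m\<^sub>j\<^sub>k\<^sub>l\<close>. With this sign the square of the covariant exterior
  derivative is \<open>(i/\<hbar>)[R, \<sqdot>]\<close>.\<close>

definition curvature ::
  "(real^'n \<Rightarrow> 'n \<Rightarrow> 'n \<Rightarrow> 'n \<Rightarrow> real) \<Rightarrow> real^'n::finite \<Rightarrow> 'n \<Rightarrow> 'n \<Rightarrow> 'n \<Rightarrow> 'n \<Rightarrow> real" where
  "curvature \<Gamma> x m j k l =
     pd k (\<lambda>x. \<Gamma> x m l j) x - pd l (\<lambda>x. \<Gamma> x m k j) x
     + (\<Sum>p\<in>UNIV. \<Gamma> x m k p * \<Gamma> x p l j - \<Gamma> x m l p * \<Gamma> x p k j)"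

definition lowered_curvature ::
  "(real^'n \<Rightarrow> 'n \<Rightarrow> 'n \<Rightarrow> real) \<Rightarrow> (real^'n \<Rightarrow> 'n \<Rightarrow> 'n \<Rightarrow> 'n \<Rightarrow> real) \<Rightarrow>
   real^'n::finite \<Rightarrow> 'n \<Rightarrow> 'n \<Rightarrow> 'n \<Rightarrow> 'n \<Rightarrow> real" where
  "lowered_curvature \<omega> \<Gamma> x i j k l = (\<Sum>m\<in>UNIV. \<omega> x i m * curvature \<Gamma> x m j k l)"


section \<open>Contravariant 2-tensors\<close>

definition tensor_inverse :: "('n::finite \<Rightarrow> 'n \<Rightarrow> 'a::comm_ring_1) \<Rightarrow> 'n \<Rightarrow> 'n \<Rightarrow> 'a" where
  "tensor_inverse A =
     (THE B. \<forall>i k. (\<Sum>j\<in>UNIV. A i j * B j k) = (if i = k then 1 else 0))"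

definition diamond ::
  "('n::finite \<Rightarrow> 'n \<Rightarrow> 'a::comm_ring_1) \<Rightarrow> ('n \<Rightarrow> 'n \<Rightarrow> 'a) \<Rightarrow> ('n \<Rightarrow> 'n \<Rightarrow> 'a) \<Rightarrow> 'n \<Rightarrow> 'n \<Rightarrow> 'a" where
  "diamond \<omega> A B i j = (\<Sum>r\<in>UNIV. \<Sum>s\<in>UNIV. \<omega> r s * A r i * B s j)"

text \<open>Only the exponents \<open>p \<ge> 1\<close> are meaningful.\<close>

definition diamond_power ::
  "('n::finite \<Rightarrow> 'n \<Rightarrow> 'a::comm_ring_1) \<Rightarrow> ('n \<Rightarrow> 'n \<Rightarrow> 'a) \<Rightarrow> nat \<Rightarrow> 'n \<Rightarrow> 'n \<Rightarrow> 'a" where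
  "diamond_power \<omega> A p = (diamond \<omega> A ^^ (p - 1)) A"

definition raise ::
  "('n::finite \<Rightarrow> 'n \<Rightarrow> 'a::comm_ring_1) \<Rightarrow> ('n \<Rightarrow> 'n \<Rightarrow> 'a) \<Rightarrow> 'n \<Rightarrow> 'n \<Rightarrow> 'a" where
  "raise wbar \<alpha> i j = - (\<Sum>r\<in>UNIV. \<Sum>s\<in>UNIV. wbar i r * wbar j s * \<alpha> r s)"

text \<open>\<open>A(f, g) = A\<^sup>i\<^sup>j \<partial>\<^sub>i f \<partial>\<^sub>j g\<close>, with \<open>u = \<partial>f\<close> and \<open>v = \<partial>g\<close>.\<close>

definition bivector_apply ::
  "('n::finite \<Rightarrow> 'n \<Rightarrow> 'a::comm_ring_1) \<Rightarrow> ('n \<Rightarrow> 'a) \<Rightarrow> ('n \<Rightarrow> 'a) \<Rightarrow> 'a" where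
  "bivector_apply A u v = (\<Sum>i\<in>UNIV. \<Sum>j\<in>UNIV. A i j * u i * v j)"

definition const_matrix :: "(complex \<Rightarrow> 'a::comm_ring_1) \<Rightarrow> ('n \<Rightarrow> 'n \<Rightarrow> real) \<Rightarrow> 'n \<Rightarrow> 'n \<Rightarrow> 'a fps" where
  "const_matrix \<iota> w i j = fps_const (\<iota> (complex_of_real (w i j)))"


section \<open>The formal Weyl algebra and the operations in Fedosov's recursions\<close>

text \<open>An element of the formal Weyl algebra with coefficients in a commutative ring \<open>'a\<close> maps a
  monomial \<open>y\<^sup>m\<close>, given by the multiset \<open>m\<close> of its indices, to its coefficient in \<open>'a[[\<hbar>]]\<close>
  (\<open>\<hbar>\<close> is \<open>fps_X\<close>). The operations are used for \<open>'a = complex\<close> (the fibre at a point) and for the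
  polynomial ring of jet symbols below; \<open>\<iota>\<close> is the embedding of the complex numbers into \<open>'a\<close>.
  A 1-form is given by its components, and a 2-form \<open>\<beta>\<close> by the antisymmetric array with
  \<open>\<beta> = 1/2 \<beta>\<^sub>k\<^sub>l dx\<^sup>k \<and> dx\<^sup>l\<close>.\<close>

type_synonym ('n, 'a) weyl = "'n multiset \<Rightarrow> 'a fps"

definition dy :: "'n \<Rightarrow> ('n, 'a::comm_ring_1) weyl \<Rightarrow> ('n, 'a) weyl" where
  "dy i a m = of_nat (Suc (count m i)) * a (add_mset i m)"

definition weyl_mult :: "('n, 'a::comm_ring_1) weyl \<Rightarrow> ('n, 'a) weyl \<Rightarrow> ('n, 'a) weyl" where
  "weyl_mult a b m = (\<Sum>m'\<in>{m'. m' \<subseteq># m}. a m' * b (m - m'))"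

text \<open>The series over \<open>n\<close> converges in the \<open>\<hbar>\<close>-adic topology of \<open>'a fps\<close>.\<close>

definition circ ::
  "(complex \<Rightarrow> 'a::comm_ring_1) \<Rightarrow> ('n \<Rightarrow> 'n \<Rightarrow> 'a fps) \<Rightarrow> ('n::finite, 'a) weyl \<Rightarrow> ('n, 'a) weyl \<Rightarrow> ('n, 'a) weyl" where
  "circ \<iota> wbar a b m =
     suminf (\<lambda>n. (fps_const (\<iota> (- \<i> / 2)) * fps_X) ^ n * fps_const (\<iota> (1 / fact n)) *
       (\<Sum>(I, J)\<in>{(I, J). length I = n \<and> length J = n}.
          (\<Prod>l<n. wbar (I ! l) (J ! l)) * weyl_mult (foldr dy I a) (foldr dy J b) m))"

text \<open>Components of \<open>b\<^sub>k\<^sub>l dx\<^sup>k \<and> dx\<^sup>l\<close>.\<close>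

definition wedge2 :: "('n \<Rightarrow> 'n \<Rightarrow> 'b \<Rightarrow> 'a::comm_ring_1) \<Rightarrow> 'n \<Rightarrow> 'n \<Rightarrow> 'b \<Rightarrow> 'a" where
  "wedge2 b k l m = b k l m - b l k m"

text \<open>The operator \<open>\<delta>\<^sup>-\<^sup>1\<close> on 1-forms and on 2-forms. For the coefficient at \<open>y\<^sup>m\<close> of the result,
  \<open>p + q\<close> equals \<open>size m\<close> and \<open>size m + 1\<close>, respectively.\<close>

definition delta_inv1 :: "(complex \<Rightarrow> 'a::comm_ring_1) \<Rightarrow> ('n \<Rightarrow> ('n, 'a) weyl) \<Rightarrow> ('n, 'a) weyl" where
  "delta_inv1 \<iota> a m =
     fps_const (\<iota> (1 / of_nat (size m))) * (\<Sum>k\<in>set_mset m. a k (m - {#k#}))"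

definition delta_inv2 ::
  "(complex \<Rightarrow> 'a::comm_ring_1) \<Rightarrow> ('n \<Rightarrow> 'n \<Rightarrow> ('n, 'a) weyl) \<Rightarrow> 'n \<Rightarrow> ('n, 'a) weyl" where
  "delta_inv2 \<iota> a j m =
     fps_const (\<iota> (1 / of_nat (size m + 1))) * (\<Sum>k\<in>set_mset m. a k j (m - {#k#}))"

text \<open>Multiplication by \<open>i/\<hbar>\<close>. It is only applied to graded commutators, whose coefficient at
  \<open>\<hbar>\<^sup>0\<close> vanishes; note that \<open>r \<circ> r\<close> is half the graded commutator of \<open>r\<close> with itself.\<close>

definition i_over_hbar :: "(complex \<Rightarrow> 'a::comm_ring_1) \<Rightarrow> 'a fps \<Rightarrow> 'a fps" where
  "i_over_hbar \<iota> s = fps_const (\<iota> \<i>) * fps_shift 1 s"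

text \<open>The 2-form \<open>R + \<Omega> - \<omega>\<close> with \<open>R = 1/4 R\<^sub>i\<^sub>j\<^sub>k\<^sub>l y\<^sup>i y\<^sup>j dx\<^sup>k \<and> dx\<^sup>l\<close> and
  \<open>\<Omega> - \<omega> = 1/2 \<alpha>\<^sub>k\<^sub>l dx\<^sup>k \<and> dx\<^sup>l\<close>.\<close>

definition source_form ::
  "(complex \<Rightarrow> 'a::comm_ring_1) \<Rightarrow> ('n::finite \<Rightarrow> 'n \<Rightarrow> 'n \<Rightarrow> 'n \<Rightarrow> 'a) \<Rightarrow> ('n \<Rightarrow> 'n \<Rightarrow> 'a fps) \<Rightarrow>
   'n \<Rightarrow> 'n \<Rightarrow> ('n, 'a) weyl" where
  "source_form \<iota> R \<alpha> = wedge2 (\<lambda>k l m.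
     (\<Sum>i\<in>UNIV. \<Sum>j\<in>UNIV. if m = {#i, j#} then fps_const (\<iota> (1 / 4) * R i j k l) else 0)
     + (if m = {#} then fps_const (\<iota> (1 / 2)) * \<alpha> k l else 0))"

text \<open>The right-hand sides of the recursions
  \<open>r = \<delta>\<^sup>-\<^sup>1 F + \<delta>\<^sup>-\<^sup>1(\<partial>r + (i/\<hbar>) r \<circ> r)\<close> and \<open>a = f + \<delta>\<^sup>-\<^sup>1(\<partial>a + (i/\<hbar>)[r, a])\<close>. The argument
  \<open>nr k l\<close> is the covariant derivative of the component \<open>r\<^sub>l\<close> (as a section of the Weyl bundle) in
  direction \<open>k\<close>, so that \<open>\<partial>r = nr\<^sub>k\<^sub>l dx\<^sup>k \<and> dx\<^sup>l\<close>; likewise \<open>na k\<close> for \<open>a\<close>.\<close>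

definition r_rhs ::
  "(complex \<Rightarrow> 'a::comm_ring_1) \<Rightarrow> ('n::finite \<Rightarrow> 'n \<Rightarrow> 'a fps) \<Rightarrow> ('n \<Rightarrow> 'n \<Rightarrow> ('n, 'a) weyl) \<Rightarrow>
   ('n \<Rightarrow> 'n \<Rightarrow> ('n, 'a) weyl) \<Rightarrow> ('n \<Rightarrow> ('n, 'a) weyl) \<Rightarrow> 'n \<Rightarrow> ('n, 'a) weyl" where
  "r_rhs \<iota> wbar F nr r j m =
     delta_inv2 \<iota> F j m +
     delta_inv2 \<iota> (\<lambda>k l m. wedge2 nr k l m
        + i_over_hbar \<iota> (wedge2 (\<lambda>k l. circ \<iota> wbar (r k) (r l)) k l m)) j m"

definition lift_rhs ::
  "(complex \<Rightarrow> 'a::comm_ring_1) \<Rightarrow> ('n::finite \<Rightarrow> 'n \<Rightarrow> 'a fps) \<Rightarrow> ('n \<Rightarrow> ('n, 'a) weyl) \<Rightarrow> 'a \<Rightarrow>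
   ('n \<Rightarrow> ('n, 'a) weyl) \<Rightarrow> ('n, 'a) weyl \<Rightarrow> ('n, 'a) weyl" where
  "lift_rhs \<iota> wbar r f na a m =
     (if m = {#} then fps_const f else 0) +
     delta_inv1 \<iota> (\<lambda>k m. na k m
        + i_over_hbar \<iota> (circ \<iota> wbar (r k) a m - circ \<iota> wbar a (r k) m)) m"


section \<open>Fedosov star products\<close>

text \<open>\<open>\<nabla>\<^sub>k a = \<partial>\<^sub>k a - \<Gamma>\<^sup>l\<^sub>k\<^sub>i y\<^sup>i \<partial>a/\<partial>y\<^sup>l\<close> for a section \<open>a\<close> of the Weyl bundle over a coordinate domain.\<close>

definition weyl_cov ::
  "(real^'n \<Rightarrow> 'n \<Rightarrow> 'n \<Rightarrow> 'n \<Rightarrow> real) \<Rightarrow> 'n \<Rightarrow> (real^'n::finite \<Rightarrow> ('n, complex) weyl) \<Rightarrow>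
   real^'n \<Rightarrow> ('n, complex) weyl" where
  "weyl_cov \<Gamma> k a x m =
     Abs_fps (\<lambda>h. pd k (\<lambda>x. fps_nth (a x m) h) x)
     - (\<Sum>l\<in>UNIV. \<Sum>i\<in>set_mset m.
          fps_const (complex_of_real (\<Gamma> x l k i)) * dy l (a x) (m - {#i#}))"

text \<open>The part of an element of the Weyl algebra of degree \<open>h\<close> in \<open>\<hbar>\<close> and \<open>p\<close> in \<open>y\<close>, as a
  polynomial function on the tangent space; in this form the transformation law under a change of
  charts is the substitution \<open>y' = J y\<close>.\<close>

definition weyl_poly :: "('n::finite, complex) weyl \<Rightarrow> nat \<Rightarrow> nat \<Rightarrow> real^'n \<Rightarrow> complex" where
  "weyl_poly a h p y =
     (\<Sum>m\<in>{m. size m = p}. fps_nth (a m) h * (\<Prod>i\<in>#m. complex_of_real (vec_nth y i)))"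

definition push :: "('m, 'n::finite) chart \<Rightarrow> ('m, 'n) chart \<Rightarrow> real^'n \<Rightarrow> real^'n \<Rightarrow> real^'n" where
  "push c c' x y = (\<chi> a. \<Sum>i\<in>UNIV. jac c c' x a i * vec_nth y i)"

definition weyl_section ::
  "('m, 'n::finite) chart set \<Rightarrow> (('m, 'n) chart \<Rightarrow> real^'n \<Rightarrow> ('n, complex) weyl) \<Rightarrow> bool" where
  "weyl_section \<A> a \<longleftrightarrow>
     (\<forall>c\<in>\<A>. \<forall>m h. smooth_on (cimg c) (\<lambda>x. fps_nth (a c x m) h)) \<and>
     (\<forall>c\<in>\<A>. \<forall>c'\<in>\<A>. \<forall>x\<in>overlap c c'. \<forall>h p y.
        weyl_poly (a c x) h p y = weyl_poly (a c' (transition c c' x)) h p (push c c' x y))"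

definition weyl_one_form ::
  "('m, 'n::finite) chart set \<Rightarrow> (('m, 'n) chart \<Rightarrow> real^'n \<Rightarrow> 'n \<Rightarrow> ('n, complex) weyl) \<Rightarrow> bool" where
  "weyl_one_form \<A> r \<longleftrightarrow>
     (\<forall>c\<in>\<A>. \<forall>j m h. smooth_on (cimg c) (\<lambda>x. fps_nth (r c x j m) h)) \<and>
     (\<forall>c\<in>\<A>. \<forall>c'\<in>\<A>. \<forall>x\<in>overlap c c'. \<forall>j h p y.
        weyl_poly (r c x j) h p y =
        (\<Sum>b\<in>UNIV. complex_of_real (jac c c' x b j) *
           weyl_poly (r c' (transition c c' x) b) h p (push c c' x y)))"

definition fedosov_form ::
  "('m, 'n::finite) chart set \<Rightarrow>
   (('m, 'n) chart \<Rightarrow> real^'n \<Rightarrow> 'n \<Rightarrow> 'n \<Rightarrow> real) \<Rightarrow>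
   (('m, 'n) chart \<Rightarrow> real^'n \<Rightarrow> 'n \<Rightarrow> 'n \<Rightarrow> 'n \<Rightarrow> real) \<Rightarrow>
   (('m, 'n) chart \<Rightarrow> real^'n \<Rightarrow> 'n \<Rightarrow> 'n \<Rightarrow> complex fps) \<Rightarrow>
   (('m, 'n) chart \<Rightarrow> real^'n \<Rightarrow> 'n \<Rightarrow> ('n, complex) weyl) \<Rightarrow> bool" where
  "fedosov_form \<A> \<omega> \<Gamma> \<Omega> r \<longleftrightarrow> weyl_one_form \<A> r \<and>
     (\<forall>c\<in>\<A>. \<forall>x\<in>cimg c.
        (\<forall>j m h. 2 * h + size m < 3 \<longrightarrow> fps_nth (r c x j m) h = 0) \<and>
        r c x = r_rhs (\<lambda>z. z) (const_matrix (\<lambda>z. z) (tensor_inverse (\<omega> c x)))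
          (source_form (\<lambda>z. z)
             (\<lambda>i j k l. complex_of_real (lowered_curvature (\<omega> c) (\<Gamma> c) x i j k l))
             (\<lambda>i j. \<Omega> c x i j - const_matrix (\<lambda>z. z) (\<omega> c x) i j))
          (\<lambda>k l. weyl_cov (\<Gamma> c) k (\<lambda>x. r c x l) x) (r c x))"

definition fedosov_lift ::
  "('m, 'n::finite) chart set \<Rightarrow>
   (('m, 'n) chart \<Rightarrow> real^'n \<Rightarrow> 'n \<Rightarrow> 'n \<Rightarrow> real) \<Rightarrow>
   (('m, 'n) chart \<Rightarrow> real^'n \<Rightarrow> 'n \<Rightarrow> 'n \<Rightarrow> 'n \<Rightarrow> real) \<Rightarrow>
   (('m, 'n) chart \<Rightarrow> real^'n \<Rightarrow> 'n \<Rightarrow> ('n, complex) weyl) \<Rightarrow>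
   ('m \<Rightarrow> complex) \<Rightarrow> (('m, 'n) chart \<Rightarrow> real^'n \<Rightarrow> ('n, complex) weyl) \<Rightarrow> bool" where
  "fedosov_lift \<A> \<omega> \<Gamma> r f a \<longleftrightarrow> weyl_section \<A> a \<and>
     (\<forall>c\<in>\<A>. \<forall>x\<in>cimg c.
        a c x = lift_rhs (\<lambda>z. z) (const_matrix (\<lambda>z. z) (tensor_inverse (\<omega> c x)))
          (r c x) (f (cinv c x)) (\<lambda>k. weyl_cov (\<Gamma> c) k (a c) x) (a c x))"

text \<open>The form \<open>r\<close> and the lifts are uniquely determined by their recursions on all coordinate
  domains, so this predicate determines the star product of smooth functions.\<close>

definition fedosov_star ::
  "('m, 'n::finite) chart set \<Rightarrow>
   (('m, 'n) chart \<Rightarrow> real^'n \<Rightarrow> 'n \<Rightarrow> 'n \<Rightarrow> real) \<Rightarrow>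
   (('m, 'n) chart \<Rightarrow> real^'n \<Rightarrow> 'n \<Rightarrow> 'n \<Rightarrow> 'n \<Rightarrow> real) \<Rightarrow>
   (('m, 'n) chart \<Rightarrow> real^'n \<Rightarrow> 'n \<Rightarrow> 'n \<Rightarrow> complex fps) \<Rightarrow>
   (('m \<Rightarrow> complex) \<Rightarrow> ('m \<Rightarrow> complex) \<Rightarrow> 'm \<Rightarrow> complex fps) \<Rightarrow> bool" where
  "fedosov_star \<A> \<omega> \<Gamma> \<Omega> star \<longleftrightarrow>
     (\<exists>r. fedosov_form \<A> \<omega> \<Gamma> \<Omega> r \<and>
       (\<forall>f g. smooth_function \<A> f \<longrightarrow> smooth_function \<A> g \<longrightarrow>
         (\<exists>a b. fedosov_lift \<A> \<omega> \<Gamma> r f a \<and> fedosov_lift \<A> \<omega> \<Gamma> r g b \<and>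
           (\<forall>c\<in>\<A>. \<forall>p\<in>fst c. star f g p =
              circ (\<lambda>z. z) (const_matrix (\<lambda>z. z) (tensor_inverse (\<omega> c (snd c p))))
                (a c (snd c p)) (b c (snd c p)) {#}))))"


section \<open>The formula for the star product\<close>

text \<open>The formula obtained by solving the recursions iteratively is a formal expression in the
  components of the iterated covariant derivatives of \<open>f\<close>, \<open>g\<close>, \<open>R\<close> and of the coefficients \<open>\<alpha>\<^sub>k\<close>
  of \<open>\<hbar>\<^sup>k\<close> in \<open>\<Omega> - \<omega>\<close>. These components are represented by independent symbols: in a symbol, the
  list \<open>I\<close> contains the indices of covariant differentiation, the outermost derivative first.
  An expression is a polynomial in the symbols, its terms are the monomials (multisets of symbols)
  that occur in it, and its coefficients depend on the matrix of \<open>\<omega>\<close> at the point considered.\<close>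

datatype 'n symbol =
    FSym "'n list"
  | GSym "'n list"
  | ASym nat "'n list" 'n 'n
  | RSym "'n list" 'n 'n 'n 'n

type_synonym 'n expr = "'n symbol multiset \<Rightarrow>\<^sub>0 complex"

definition econst :: "complex \<Rightarrow> 'n expr" where
  "econst z = Poly_Mapping.single {#} z"

definition sym :: "'n symbol \<Rightarrow> 'n expr" where
  "sym s = Poly_Mapping.single {#s#} 1"

primrec symbol_deriv :: "'n \<Rightarrow> 'n symbol \<Rightarrow> 'n symbol" where
  "symbol_deriv k (FSym I) = FSym (k # I)"
| "symbol_deriv k (GSym I) = GSym (k # I)"
| "symbol_deriv k (ASym n I i j) = ASym n (k # I) i j"
| "symbol_deriv k (RSym I i j p q) = RSym (k # I) i j p q"

text \<open>Covariant differentiation of expressions is the derivation extending \<open>symbol_deriv\<close>; the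
  coefficients are constants for it because \<open>\<nabla>\<omega> = 0\<close>.\<close>

definition expr_deriv :: "'n \<Rightarrow> 'n expr \<Rightarrow> 'n expr" where
  "expr_deriv k P = (\<Sum>m\<in>Poly_Mapping.keys P. econst (Poly_Mapping.lookup P m) *
     (\<Sum>s\<in>#m. Poly_Mapping.single (add_mset (symbol_deriv k s) (m - {#s#})) 1))"

definition weyl_expr_deriv :: "'n \<Rightarrow> ('n, 'n expr) weyl \<Rightarrow> ('n, 'n expr) weyl" where
  "weyl_expr_deriv k a m = Abs_fps (\<lambda>h. expr_deriv k (fps_nth (a m) h))"

text \<open>\<open>\<omega>\<close> is the matrix of the symplectic form at a point and \<open>A\<close> the formal expression for
  \<open>\<Omega> - \<omega>\<close>. One more application of a right-hand side fixes one more degree of the solution, where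
  \<open>\<hbar>\<close> has degree 2 and \<open>y\<close> has degree 1: the \<open>N\<close>-th iterate is final in degrees below \<open>N + 3\<close> for
  \<open>r\<close>, and in degrees below \<open>N\<close> for the lifts.\<close>

definition r_formula :: "('n::finite \<Rightarrow> 'n \<Rightarrow> real) \<Rightarrow> ('n \<Rightarrow> 'n \<Rightarrow> 'n expr fps) \<Rightarrow> 'n \<Rightarrow> ('n, 'n expr) weyl" where
  "r_formula \<omega> A j m = Abs_fps (\<lambda>h. fps_nth
     (((\<lambda>r. r_rhs econst (const_matrix econst (tensor_inverse \<omega>))
          (source_form econst (\<lambda>i j k l. sym (RSym [] i j k l)) A)
          (\<lambda>k l. weyl_expr_deriv k (r l)) r)
       ^^ (2 * h + size m)) (\<lambda>_ _. 0) j m) h)"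

definition lift_formula ::
  "('n::finite \<Rightarrow> 'n \<Rightarrow> real) \<Rightarrow> ('n \<Rightarrow> 'n \<Rightarrow> 'n expr fps) \<Rightarrow> 'n expr \<Rightarrow> ('n, 'n expr) weyl" where
  "lift_formula \<omega> A f m = Abs_fps (\<lambda>h. fps_nth
     (((\<lambda>a. lift_rhs econst (const_matrix econst (tensor_inverse \<omega>)) (r_formula \<omega> A) f
          (\<lambda>k. weyl_expr_deriv k a) a)
       ^^ (2 * h + size m + 1)) (\<lambda>_. 0) m) h)"

definition star_formula :: "('n::finite \<Rightarrow> 'n \<Rightarrow> real) \<Rightarrow> ('n \<Rightarrow> 'n \<Rightarrow> 'n expr fps) \<Rightarrow> 'n expr fps" where
  "star_formula \<omega> A = circ econst (const_matrix econst (tensor_inverse \<omega>))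
     (lift_formula \<omega> A (sym (FSym []))) (lift_formula \<omega> A (sym (GSym []))) {#}"

text \<open>The formal expression for \<open>\<alpha>\<^sup>\<hbar> \<in> \<hbar> Z\<^sup>2[[\<hbar>]]\<close>. The symbols are independent, so the antisymmetry
  of the components is imposed here.\<close>

definition alpha_expr :: "'n \<Rightarrow> 'n \<Rightarrow> 'n expr fps" where
  "alpha_expr i j = Abs_fps (\<lambda>k. if k = 0 then 0 else
     econst (1 / 2) * (sym (ASym k [] i j) - sym (ASym k [] j i)))"

definition dF_expr :: "'n \<Rightarrow> 'n expr fps" where
  "dF_expr i = fps_const (sym (FSym [i]))"

definition dG_expr :: "'n \<Rightarrow> 'n expr fps" where
  "dG_expr i = fps_const (sym (GSym [i]))"

definition contains_R :: "'n symbol multiset \<Rightarrow> bool" where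
  "contains_R m \<longleftrightarrow> (\<exists>I i j k l. RSym I i j k l \<in># m)"

definition contains_deriv_alpha :: "'n symbol multiset \<Rightarrow> bool" where
  "contains_deriv_alpha m \<longleftrightarrow> (\<exists>n I i j. I \<noteq> [] \<and> ASym n I i j \<in># m)"

definition function_symbol :: "'n symbol \<Rightarrow> bool" where
  "function_symbol s \<longleftrightarrow> (\<exists>I. s = FSym I \<or> s = GSym I)"

definition one_differentiable :: "'n symbol multiset \<Rightarrow> bool" where
  "one_differentiable m \<longleftrightarrow> (\<exists>i j. filter_mset function_symbol m = {#FSym [i], GSym [j]#})"

definition select_terms :: "('n symbol multiset \<Rightarrow> bool) \<Rightarrow> 'n expr fps \<Rightarrow> 'n expr fps" where
  "select_terms Q S = Abs_fps (\<lambda>n.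
     \<Sum>m\<in>{m \<in> Poly_Mapping.keys (fps_nth S n). Q m}.
       Poly_Mapping.single m (Poly_Mapping.lookup (fps_nth S n) m))"


section \<open>Evaluation of formulas on a manifold\<close>

text \<open>The covariant derivative of a covariant tensor field with components \<open>T x J\<close>; the index of
  differentiation comes first.\<close>

fun covd ::
  "(real^'n \<Rightarrow> 'n \<Rightarrow> 'n \<Rightarrow> 'n \<Rightarrow> real) \<Rightarrow> (real^'n::finite \<Rightarrow> 'n list \<Rightarrow> complex) \<Rightarrow>
   real^'n \<Rightarrow> 'n list \<Rightarrow> complex" where
  "covd \<Gamma> T x [] = 0"
| "covd \<Gamma> T x (k # J) = pd k (\<lambda>x. T x J) x
     - (\<Sum>s<length J. \<Sum>l\<in>UNIV. complex_of_real (\<Gamma> x l k (J ! s)) * T x (J[s := l]))"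

primrec symbol_value ::
  "(real^'n \<Rightarrow> 'n \<Rightarrow> 'n \<Rightarrow> real) \<Rightarrow> (real^'n \<Rightarrow> 'n \<Rightarrow> 'n \<Rightarrow> 'n \<Rightarrow> real) \<Rightarrow>
   (real^'n \<Rightarrow> 'n \<Rightarrow> 'n \<Rightarrow> complex fps) \<Rightarrow> (real^'n \<Rightarrow> complex) \<Rightarrow> (real^'n \<Rightarrow> complex) \<Rightarrow>
   real^'n::finite \<Rightarrow> 'n symbol \<Rightarrow> complex" where
  "symbol_value \<omega> \<Gamma> \<alpha> f g x (FSym I) = (covd \<Gamma> ^^ length I) (\<lambda>x J. f x) x I"
| "symbol_value \<omega> \<Gamma> \<alpha> f g x (GSym I) = (covd \<Gamma> ^^ length I) (\<lambda>x J. g x) x I"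
| "symbol_value \<omega> \<Gamma> \<alpha> f g x (ASym n I i j) =
     (covd \<Gamma> ^^ length I) (\<lambda>x J. fps_nth (\<alpha> x (J ! 0) (J ! 1)) n) x (I @ [i, j])"
| "symbol_value \<omega> \<Gamma> \<alpha> f g x (RSym I i j k l) =
     (covd \<Gamma> ^^ length I)
       (\<lambda>x J. complex_of_real (lowered_curvature \<omega> \<Gamma> x (J ! 0) (J ! 1) (J ! 2) (J ! 3))) x
       (I @ [i, j, k, l])"

definition expr_value :: "('n symbol \<Rightarrow> complex) \<Rightarrow> 'n expr \<Rightarrow> complex" where
  "expr_value v P = (\<Sum>m\<in>Poly_Mapping.keys P. Poly_Mapping.lookup P m * (\<Prod>s\<in>#m. v s))"

definition formula_value ::
  "(('m, 'n::finite) chart \<Rightarrow> real^'n \<Rightarrow> 'n \<Rightarrow> 'n \<Rightarrow> real) \<Rightarrow>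
   (('m, 'n) chart \<Rightarrow> real^'n \<Rightarrow> 'n \<Rightarrow> 'n \<Rightarrow> 'n \<Rightarrow> real) \<Rightarrow>
   (('m, 'n) chart \<Rightarrow> real^'n \<Rightarrow> 'n \<Rightarrow> 'n \<Rightarrow> complex fps) \<Rightarrow>
   ('m \<Rightarrow> complex) \<Rightarrow> ('m \<Rightarrow> complex) \<Rightarrow> ('m, 'n) chart \<Rightarrow> 'm \<Rightarrow> 'n expr fps \<Rightarrow> complex fps" where
  "formula_value \<omega> \<Gamma> \<alpha> f g c p S = Abs_fps (\<lambda>n. expr_value
     (symbol_value (\<omega> c) (\<Gamma> c) (\<alpha> c) (f \<circ> cinv c) (g \<circ> cinv c) (snd c p)) (fps_nth S n))"

definition differential :: "('m, 'n::finite) chart \<Rightarrow> ('m \<Rightarrow> complex) \<Rightarrow> 'm \<Rightarrow> 'n \<Rightarrow> complex fps" where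
  "differential c f p i = fps_const (pd i (f \<circ> cinv c) (snd c p))"

end

theory Submission
  imports Defs
begin

text \<open>
  Everything is a statement about the formula, a power series in \<open>\<hbar>\<close> of polynomials in the symbols for
  the covariant derivatives of \<open>f\<close>, \<open>g\<close>, \<open>R\<close> and \<open>\<alpha>\<close>. Two things have to be shown: that the values
  of the formula are the star product, and what its \<open>1\<close>-differentiable terms are.

  The terms. The polynomials all of whose monomials contain a symbol of \<open>R\<close>, a differentiated symbol
  of \<open>\<alpha>\<close> or a derivative of \<open>f\<close> or \<open>g\<close> of order at least two form an ideal that is stable under
  covariant differentiation. In the quotient the recursions are those of a flat connection with
  constant \<open>\<alpha>\<close>, and they have exact solutions of degree one in \<open>y\<close>: \<open>r\<^sub>j = y\<^sup>i C\<^sub>i\<^sub>j\<close> with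
  \<open>2 C = \<alpha> + C\<^sup>T \<omega>\<^sup>- C\<close>, and \<open>f + y\<^sup>i a\<^sub>i\<close> with \<open>a = M df\<close>, \<open>M = (\<omega> + C) \<Omega>\<^sup>-\<close>, where \<open>\<omega>\<^sup>-\<close> and
  \<open>\<Omega>\<^sup>-\<close> are the inverse matrices. The matrix \<open>C\<close> is antisymmetric, so that the quadratic equation
  reads \<open>(\<omega> + C) \<omega>\<^sup>- (\<omega> + C) = \<Omega>\<close> (lemma \<open>square_root\<close>); it follows that \<open>M\<^sup>T \<omega>\<^sup>- M = \<Omega>\<^sup>-\<close>, and the
  product of the lifts at \<open>y = 0\<close> is exactly \<open>fg - (i\<hbar>/2) \<Omega>\<^sup>-(df, dg)\<close> (lemma \<open>flat_star\<close>). Passing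
  to the quotient does not change the coefficients of the selected monomials, and the bivector term
  contains nothing else (lemma \<open>select_star_formula\<close>). Expanding \<open>\<Omega>\<^sup>- = (\<omega> + \<alpha>)\<^sup>-\<close> in a geometric
  series gives the sum of diamond powers (lemma \<open>suminf_diamonds\<close>). The remainder is then the
  difference of the two sides, and these computations show that none of its terms is selected.

  The values. With \<open>\<hbar>\<close> of degree 2 and \<open>y\<close> of degree 1 the right-hand sides of both recursions are
  contractions, so their solutions are determined degree by degree, and it suffices that evaluation
  turns a step of the symbolic recursions into a step of the actual ones. The only operation for which
  this is not formal is differentiation: the partial derivative of the value of an expression is the
  value of its symbolic covariant derivative plus terms with Christoffel symbols, which are the right
  ones exactly when the expression is a tensor. This is expressed algebraically. When the components
  of \<open>\<omega>\<^sup>-\<close> are adjoined as further symbols, an infinitesimal change of frame acts as a derivation of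
  the polynomial ring, and being a tensor means to be transformed by this derivation in the manner
  prescribed by the free indices; the operations in the recursions preserve this property
  (lemmas \<open>tensor1_r_solution\<close>, \<open>tensor0_lift_iter\<close>, \<open>weyl_cov_evw\<close>).
\<close>

section \<open>Formal power series\<close>

text \<open>Convergence of formal power series is coefficientwise, so it suffices that the coefficient of
  \<open>\<hbar>\<^sup>h\<close> in the partial sums is stationary from \<open>h + 1\<close> on.\<close>

lemma fps_sums_of_partial_sums:
  fixes t :: "nat \<Rightarrow> 'a::comm_ring_1 fps"
  assumes "\<And>N h. h < N \<Longrightarrow> fps_nth (\<Sum>q<N. t q) h = fps_nth s h"
  shows "t sums s"
  unfolding sums_def
proof (rule tendsto_fpsI)
  fix h
  show "\<forall>\<^sub>F N in sequentially. fps_nth (\<Sum>q<N. t q) h = fps_nth s h"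
    using eventually_gt_at_top[of h] by eventually_elim (rule assms)
qed

lemma suminf_fps_eqI:
  fixes t :: "nat \<Rightarrow> 'a::comm_ring_1 fps"
  assumes "\<And>N h. h < N \<Longrightarrow> fps_nth (\<Sum>q<N. t q) h = fps_nth s h"
  shows "suminf t = s"
  using fps_sums_of_partial_sums[OF assms] by (rule sums_unique[symmetric])

lemma fps_mult_nth_cong:
  assumes "\<And>k. k \<le> h \<Longrightarrow> fps_nth s k = fps_nth s' k"
  shows "fps_nth (s * t) h = fps_nth (s' * t) h"
  unfolding fps_mult_nth by (intro sum.cong refl) (simp add: assms)

locale ring_map =
  fixes \<phi> :: "'a::comm_ring_1 \<Rightarrow> 'b::comm_ring_1"
  assumes map_add: "\<phi> (x + y) = \<phi> x + \<phi> y"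
    and map_mult: "\<phi> (x * y) = \<phi> x * \<phi> y"
    and map_1: "\<phi> 1 = 1"
begin

sublocale Modules.additive \<phi> by standard (rule map_add)

lemma map_power: "\<phi> (x ^ n) = \<phi> x ^ n"
  by (induction n) (simp_all add: map_1 map_mult)

end

locale derivation = Modules.additive D for D :: "'a::comm_ring_1 \<Rightarrow> 'a" +
  assumes leibniz: "D (x * y) = D x * y + x * D y"

definition fps_map :: "('a::comm_ring_1 \<Rightarrow> 'b::comm_ring_1) \<Rightarrow> 'a fps \<Rightarrow> 'b fps" where
  "fps_map f s = Abs_fps (\<lambda>n. f (fps_nth s n))"

lemma fps_map_nth [simp]: "fps_nth (fps_map f s) n = f (fps_nth s n)"
  by (simp add: fps_map_def)

lemma additive_fps_map: "Modules.additive f \<Longrightarrow> Modules.additive (fps_map f)"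
  by (simp add: Modules.additive_def fps_eq_iff)

lemma fps_map_const: "Modules.additive f \<Longrightarrow> fps_map f (fps_const c) = fps_const (f c)"
  by (simp add: fps_eq_iff Modules.additive.zero)

lemma fps_map_X:
  assumes "ring_map f"
  shows "fps_map f fps_X = fps_X"
proof -
  interpret ring_map f by (rule assms)
  show ?thesis by (simp add: fps_eq_iff fps_X_def map_1 zero)
qed

lemma ring_map_fps_map: "ring_map f \<Longrightarrow> ring_map (fps_map f)"
proof -
  assume "ring_map f"
  then interpret ring_map f .
  show ?thesis
    by unfold_locales (simp_all add: fps_eq_iff add map_1 map_mult zero sum fps_mult_nth)
qed

lemma derivation_fps_map: "derivation D \<Longrightarrow> derivation (fps_map D)"
proof -
  assume "derivation D"
  then interpret derivation D .
  show ?thesis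
    by unfold_locales (simp_all add: fps_eq_iff add leibniz sum fps_mult_nth sum.distrib)
qed

section \<open>Polynomials with complex coefficients\<close>

type_synonym 'v polynomial = "'v multiset \<Rightarrow>\<^sub>0 complex"

definition poly_const :: "complex \<Rightarrow> 'v polynomial" where
  "poly_const z = Poly_Mapping.single {#} z"

definition poly_var :: "'v \<Rightarrow> 'v polynomial" where
  "poly_var v = Poly_Mapping.single {#v#} 1"

lemma ring_map_poly_const: "ring_map poly_const"
  by unfold_locales (simp_all add: poly_const_def single_add mult_single flip: zero_multiset_def)

lemma polynomial_sum_monomials:
  "(\<Sum>m\<in>Poly_Mapping.keys P. Poly_Mapping.single m (Poly_Mapping.lookup P m)) = P"
proof (rule poly_mapping_eqI)
  fix k
  have "Poly_Mapping.lookup (\<Sum>m\<in>Poly_Mapping.keys P. Poly_Mapping.single m (Poly_Mapping.lookup P m)) k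
      = (\<Sum>m\<in>Poly_Mapping.keys P. if m = k then Poly_Mapping.lookup P k else 0)"
    unfolding lookup_sum by (intro sum.cong refl) (auto simp: lookup_single)
  also have "\<dots> = Poly_Mapping.lookup P k"
    by (simp add: in_keys_iff)
  finally show "Poly_Mapping.lookup (\<Sum>m\<in>Poly_Mapping.keys P.
    Poly_Mapping.single m (Poly_Mapping.lookup P m)) k = Poly_Mapping.lookup P k" .
qed

text \<open>A polynomial is the sum of its monomials. Maps that are defined as sums over the monomials are shown
  with this rule to be multiplicative or derivations; once this is known, two such maps are compared on
  constants and variables only, by the rule \<open>polynomial_induct\<close>.\<close>

lemma polynomial_monomial_induct [case_names monomial add]:
  assumes "\<And>m z. Q (Poly_Mapping.single m z)" and "\<And>P P'. Q P \<Longrightarrow> Q P' \<Longrightarrow> Q (P + P')"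
  shows "Q (P :: 'v polynomial)"
proof -
  have "Q (\<Sum>m\<in>A. Poly_Mapping.single m (Poly_Mapping.lookup P m))" if "finite A" for A
    using that
  proof (induction A)
    case empty
    show ?case using assms(1)[of "{#}" 0] by simp
  qed (simp add: assms)
  from this[OF finite_keys[of P]] show ?thesis by (simp add: polynomial_sum_monomials)
qed

lemma monomial_add_mset:
  "Poly_Mapping.single (add_mset v m) z = poly_var v * Poly_Mapping.single m z"
  by (simp add: poly_var_def mult_single)

lemma polynomial_induct [case_names const var add mult]:
  assumes c: "\<And>z. Q (poly_const z)" and v: "\<And>v. Q (poly_var v)"
    and a: "\<And>P P'. Q P \<Longrightarrow> Q P' \<Longrightarrow> Q (P + P')" and m: "\<And>P P'. Q P \<Longrightarrow> Q P' \<Longrightarrow> Q (P * P')"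
  shows "Q (P :: 'v polynomial)"
proof (induction P rule: polynomial_monomial_induct)
  case (monomial k z)
  show ?case
  proof (induction k)
    case empty
    show ?case using c[of z] by (simp add: poly_const_def)
  next
    case (add x k)
    then show ?case by (simp add: monomial_add_mset m v)
  qed
qed (rule a)

lemma sum_keys_superset:
  assumes "finite A" "Poly_Mapping.keys P \<subseteq> A" "\<And>m. F m 0 = 0"
  shows "(\<Sum>m\<in>Poly_Mapping.keys P. F m (Poly_Mapping.lookup P m))
    = (\<Sum>m\<in>A. F m (Poly_Mapping.lookup P m))"
  using assms by (intro sum.mono_neutral_left) (auto simp: in_keys_iff)

lemma sum_keys_additive:
  fixes F :: "'v multiset \<Rightarrow> complex \<Rightarrow> 'b::ab_group_add"
  assumes F: "\<And>m. Modules.additive (F m)"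
  shows "Modules.additive (\<lambda>P. \<Sum>m\<in>Poly_Mapping.keys P. F m (Poly_Mapping.lookup P m))"
proof
  fix P Q :: "'v polynomial"
  have F0: "F m 0 = 0" for m using F by (rule Modules.additive.zero)
  let ?A = "Poly_Mapping.keys P \<union> Poly_Mapping.keys Q"
  have "(\<Sum>m\<in>Poly_Mapping.keys (P + Q). F m (Poly_Mapping.lookup (P + Q) m))
      = (\<Sum>m\<in>?A. F m (Poly_Mapping.lookup (P + Q) m))"
    using keys_add[of P Q] by (intro sum_keys_superset F0) auto
  also have "\<dots> = (\<Sum>m\<in>?A. F m (Poly_Mapping.lookup P m)) + (\<Sum>m\<in>?A. F m (Poly_Mapping.lookup Q m))"
    by (simp add: lookup_add Modules.additive.add[OF F] sum.distrib)
  also have "(\<Sum>m\<in>?A. F m (Poly_Mapping.lookup P m)) = (\<Sum>m\<in>Poly_Mapping.keys P. F m (Poly_Mapping.lookup P m))"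
    by (intro sum_keys_superset[symmetric] F0) auto
  also have "(\<Sum>m\<in>?A. F m (Poly_Mapping.lookup Q m)) = (\<Sum>m\<in>Poly_Mapping.keys Q. F m (Poly_Mapping.lookup Q m))"
    by (intro sum_keys_superset[symmetric] F0) auto
  finally show "(\<Sum>m\<in>Poly_Mapping.keys (P + Q). F m (Poly_Mapping.lookup (P + Q) m))
    = (\<Sum>m\<in>Poly_Mapping.keys P. F m (Poly_Mapping.lookup P m))
    + (\<Sum>m\<in>Poly_Mapping.keys Q. F m (Poly_Mapping.lookup Q m))" .
qed

lemma sum_keys_single:
  assumes "F m 0 = 0"
  shows "(\<Sum>k\<in>Poly_Mapping.keys (Poly_Mapping.single m z). F k (Poly_Mapping.lookup (Poly_Mapping.single m z) k)) = F m z"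
  using assms by (cases "z = 0") auto

text \<open>The homomorphism to a commutative ring that maps coefficients by \<open>\<iota>\<close> and variables by \<open>v\<close>. All
  specialisations below are of this form: evaluation at a point, the choice of a symplectic matrix, and
  the suppression of symbols.\<close>

definition poly_subst :: "(complex \<Rightarrow> 'b::comm_ring_1) \<Rightarrow> ('v \<Rightarrow> 'b) \<Rightarrow> 'v polynomial \<Rightarrow> 'b" where
  "poly_subst \<iota> v P = (\<Sum>m\<in>Poly_Mapping.keys P. \<iota> (Poly_Mapping.lookup P m) * (\<Prod>s\<in>#m. v s))"

context
  fixes \<iota> :: "complex \<Rightarrow> 'b::comm_ring_1" and v :: "'v \<Rightarrow> 'b"
  assumes \<iota>: "ring_map \<iota>"
begin

interpretation ring_map \<iota> by (rule \<iota>)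

lemma poly_subst_single: "poly_subst \<iota> v (Poly_Mapping.single m z) = \<iota> z * (\<Prod>s\<in>#m. v s)"
  unfolding poly_subst_def
  by (rule sum_keys_single[of "\<lambda>m z. \<iota> z * (\<Prod>s\<in>#m. v s)"]) (simp add: zero)

lemma poly_subst_const: "poly_subst \<iota> v (poly_const z) = \<iota> z"
  by (simp add: poly_const_def poly_subst_single)

lemma poly_subst_var: "poly_subst \<iota> v (poly_var x) = v x"
  by (simp add: poly_var_def poly_subst_single map_1)

lemma additive_poly_subst: "Modules.additive (poly_subst \<iota> v)"
  unfolding poly_subst_def
  by (rule sum_keys_additive) (simp add: Modules.additive_def map_add distrib_right)

lemma ring_map_poly_subst: "ring_map (poly_subst \<iota> v)"
proof
  interpret s: Modules.additive "poly_subst \<iota> v" by (rule additive_poly_subst)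
  show "poly_subst \<iota> v (P + Q) = poly_subst \<iota> v P + poly_subst \<iota> v Q" for P Q by (rule s.add)
  show "poly_subst \<iota> v 1 = 1"
    using poly_subst_const[of 1] by (simp add: ring_map.map_1[OF ring_map_poly_const] map_1)
  have *: "poly_subst \<iota> v (Poly_Mapping.single m z * Q) = poly_subst \<iota> v (Poly_Mapping.single m z) * poly_subst \<iota> v Q"
    for m z Q
    by (induction Q rule: polynomial_monomial_induct)
      (simp_all add: mult_single poly_subst_single map_mult s.add distrib_left)
  show "poly_subst \<iota> v (P * Q) = poly_subst \<iota> v P * poly_subst \<iota> v Q" for P Q
    by (induction P rule: polynomial_monomial_induct) (simp_all add: * s.add distrib_right)
qed

end

lemma ring_map_eqI:
  assumes "ring_map \<phi>" "ring_map \<psi>" "\<And>z. \<phi> (poly_const z) = \<psi> (poly_const z)"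
    "\<And>x. \<phi> (poly_var x) = \<psi> (poly_var x)"
  shows "\<phi> (P :: 'v polynomial) = \<psi> P"
  by (induction P rule: polynomial_induct)
    (simp_all add: assms ring_map.map_add[OF assms(1)] ring_map.map_add[OF assms(2)]
      ring_map.map_mult[OF assms(1)] ring_map.map_mult[OF assms(2)])

text \<open>The derivation with values \<open>\<delta>\<close> on the variables. The symbolic covariant derivative is the case of a
  variable \<open>\<delta> s\<close>; infinitesimal changes of frame need linear combinations of variables.\<close>

definition poly_deriv :: "('v \<Rightarrow> 'v polynomial) \<Rightarrow> 'v polynomial \<Rightarrow> 'v polynomial" where
  "poly_deriv \<delta> P = (\<Sum>m\<in>Poly_Mapping.keys P. poly_const (Poly_Mapping.lookup P m) *
     (\<Sum>s\<in>#m. \<delta> s * Poly_Mapping.single (m - {#s#}) 1))"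

lemma additive_poly_deriv: "Modules.additive (poly_deriv \<delta>)"
  unfolding poly_deriv_def
  by (rule sum_keys_additive)
    (simp add: Modules.additive_def ring_map.map_add[OF ring_map_poly_const] distrib_right)

lemma poly_deriv_single:
  "poly_deriv \<delta> (Poly_Mapping.single m z) =
     poly_const z * (\<Sum>s\<in>#m. \<delta> s * Poly_Mapping.single (m - {#s#}) 1)"
  unfolding poly_deriv_def
  by (rule sum_keys_single[of "\<lambda>m z. poly_const z * (\<Sum>s\<in>#m. \<delta> s * Poly_Mapping.single (m - {#s#}) 1)"])
    (simp add: poly_const_def)

lemma poly_deriv_const: "poly_deriv \<delta> (poly_const z) = 0"
  using poly_deriv_single[of \<delta> "{#}" z] by (simp add: poly_const_def)

lemma poly_deriv_var: "poly_deriv \<delta> (poly_var x) = \<delta> x"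
  using poly_deriv_single[of \<delta> "{#x#}" 1]
  by (simp add: poly_const_def poly_var_def flip: zero_multiset_def)

lemma derivation_poly_deriv: "derivation (poly_deriv \<delta>)"
proof -
  interpret d: Modules.additive "poly_deriv \<delta>" by (rule additive_poly_deriv)
  define d where "d m = (\<Sum>s\<in>#m. \<delta> s * Poly_Mapping.single (m - {#s#}) (1::complex))" for m
  have d_add_mset: "d (add_mset x m) = \<delta> x * Poly_Mapping.single m 1 + poly_var x * d m" for x m
  proof -
    have "(\<Sum>s\<in>#m. \<delta> s * Poly_Mapping.single (add_mset x m - {#s#}) (1::complex))
      = (\<Sum>s\<in>#m. poly_var x * (\<delta> s * Poly_Mapping.single (m - {#s#}) (1::complex)))"
    proof (intro arg_cong[where f = sum_mset] image_mset_cong)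
      fix s assume "s \<in># m"
      then have "add_mset x m - {#s#} = add_mset x (m - {#s#})" by (auto simp: multiset_eq_iff)
      then show "\<delta> s * Poly_Mapping.single (add_mset x m - {#s#}) (1::complex)
        = poly_var x * (\<delta> s * Poly_Mapping.single (m - {#s#}) (1::complex))"
        by (simp add: monomial_add_mset ac_simps)
    qed
    then show ?thesis by (simp add: d_def sum_mset_distrib_left)
  qed
  have d_union: "d (m + k) = d m * Poly_Mapping.single k 1 + Poly_Mapping.single m 1 * d k" for m k
  proof (induction m)
    case empty
    have "d {#} = 0" by (simp add: d_def)
    then show ?case by (simp add: flip: zero_multiset_def)
  next
    case (add x m)
    have s: "Poly_Mapping.single (m + k) (1::complex) = Poly_Mapping.single m 1 * Poly_Mapping.single k 1"
      by (simp add: mult_single)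
    have "d (add_mset x m + k) = \<delta> x * Poly_Mapping.single (m + k) 1 + poly_var x * d (m + k)"
      using d_add_mset[of x "m + k"] by simp
    then show ?case
      unfolding d_add_mset[of x m] add.IH s monomial_add_mset[of x m] by (simp add: algebra_simps)
  qed
  have single: "Poly_Mapping.single m z = poly_const z * Poly_Mapping.single m 1" for m :: "'a multiset" and z
    by (simp add: poly_const_def mult_single)
  have ds: "poly_deriv \<delta> (Poly_Mapping.single m z) = poly_const z * d m" for m z
    by (simp add: d_def poly_deriv_single)
  have *: "poly_deriv \<delta> (Poly_Mapping.single m z * Q)
      = poly_deriv \<delta> (Poly_Mapping.single m z) * Q + Poly_Mapping.single m z * poly_deriv \<delta> Q" for m z Q
  proof (induction Q rule: polynomial_monomial_induct)
    case (monomial k y)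
    have "poly_deriv \<delta> (Poly_Mapping.single m z * Poly_Mapping.single k y)
      = poly_const (z * y) * (d m * Poly_Mapping.single k 1 + Poly_Mapping.single m 1 * d k)"
      by (simp add: mult_single ds d_union)
    then show ?case
      unfolding ds ring_map.map_mult[OF ring_map_poly_const]
      by (simp add: single[of m z] single[of k y] algebra_simps)
  qed (simp add: d.add distrib_left)
  show ?thesis
  proof
    show "poly_deriv \<delta> (P * Q) = poly_deriv \<delta> P * Q + P * poly_deriv \<delta> Q" for P Q
    by (induction P rule: polynomial_monomial_induct)
      (simp_all add: * d.add distrib_right)
  qed
qed

section \<open>The formal Weyl algebra\<close>

lemma finite_submultisets: "finite {m'. m' \<subseteq># m}"
proof (induction m)
  case (add x m)
  have "{m'. m' \<subseteq># add_mset x m} \<subseteq> {m'. m' \<subseteq># m} \<union> add_mset x ` {m'. m' \<subseteq># m}"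
  proof
    fix m' assume "m' \<in> {m'. m' \<subseteq># add_mset x m}"
    then have m': "m' \<subseteq># add_mset x m" by simp
    show "m' \<in> {m'. m' \<subseteq># m} \<union> add_mset x ` {m'. m' \<subseteq># m}"
    proof (cases "x \<in># m'")
      case True
      then obtain k where "m' = add_mset x k" by (meson mset_add)
      then show ?thesis using m' by auto
    next
      case False
      have "m' \<subseteq># m"
        unfolding subseteq_mset_def
      proof
        fix y
        show "count m' y \<le> count m y"
          using mset_subset_eq_count[OF m', of y] False by (cases "y = x") (auto simp: not_in_iff)
      qed
      then show ?thesis by simp
    qed
  qed
  then show ?case using add.IH by (meson finite_Un finite_imageI finite_subset)
qed simp

text \<open>Multiplication by the coordinate \<open>y\<^sup>i\<close>.\<close>

definition ymul :: "'n \<Rightarrow> ('n, 'a::comm_ring_1) weyl \<Rightarrow> ('n, 'a) weyl" where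
  "ymul i a m = (if i \<in># m then a (m - {#i#}) else 0)"

lemma dy_add: "dy i (\<lambda>m. a m + b m) = (\<lambda>m. dy i a m + dy i b m)"
  by (rule ext) (simp add: dy_def distrib_left)

lemma dy_smult: "dy i (\<lambda>m. s * a m) = (\<lambda>m. s * dy i a m)"
  by (rule ext) (simp add: dy_def ac_simps)

lemma dy_commute: "dy i (dy j a) = dy j (dy i a)"
  by (rule ext) (simp add: dy_def add_mset_commute ac_simps)

lemma dy_ymul: "dy p (ymul i a) m = (if p = i then a m else 0) + ymul i (dy p a) m"
proof (cases "p = i")
  case True
  have "of_nat (Suc (count m i)) * a m = a m + of_nat (count m i) * a m"
    by (simp add: algebra_simps)
  moreover have "ymul i (dy i a) m = of_nat (count m i) * a m"
  proof (cases "i \<in># m")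
    case True
    then have "Suc (count m i - Suc 0) = count m i"
      by (simp flip: count_greater_zero_iff)
    then show ?thesis using True by (simp add: ymul_def dy_def del: of_nat_Suc)
  next
    case False
    then have "count m i = 0" by (simp add: not_in_iff)
    then show ?thesis using False by (simp add: ymul_def)
  qed
  ultimately show ?thesis using True by (simp add: dy_def ymul_def del: of_nat_Suc)
next
  case False
  then show ?thesis by (auto simp: dy_def ymul_def)
qed

lemma weyl_mult_commute: "weyl_mult a b m = weyl_mult b a m"
  unfolding weyl_mult_def
  by (rule sum.reindex_bij_witness[of _ "\<lambda>k. m - k" "\<lambda>k. m - k"])
    (auto simp: subset_mset.diff_diff_right mult.commute)

lemma weyl_mult_add_left: "weyl_mult (\<lambda>m. a m + a' m) b m = weyl_mult a b m + weyl_mult a' b m"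
  by (simp add: weyl_mult_def distrib_right sum.distrib)

lemma weyl_mult_smult_left: "weyl_mult (\<lambda>m. s * a m) b m = s * weyl_mult a b m"
  by (simp add: weyl_mult_def sum_distrib_left ac_simps)

lemma weyl_mult_ymul_left: "weyl_mult (ymul i a) b m = ymul i (weyl_mult a b) m"
proof (cases "i \<in># m")
  case True
  have "weyl_mult (ymul i a) b m = (\<Sum>m'\<in>{m'. m' \<subseteq># m \<and> i \<in># m'}. a (m' - {#i#}) * b (m - m'))"
    unfolding weyl_mult_def ymul_def
    by (rule sum.mono_neutral_cong_right) (auto simp: finite_submultisets)
  also have "\<dots> = (\<Sum>k\<in>{k. k \<subseteq># m - {#i#}}. a k * b (m - {#i#} - k))"
  proof (rule sum.reindex_bij_witness[of _ "add_mset i" "\<lambda>k. k - {#i#}"])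
    fix k assume "k \<in> {k. k \<subseteq># m - {#i#}}"
    then have "add_mset i k \<subseteq># add_mset i (m - {#i#})" by simp
    then show "add_mset i k \<in> {m'. m' \<subseteq># m \<and> i \<in># m'}" using True by simp
  next
    fix m' assume m': "m' \<in> {m'. m' \<subseteq># m \<and> i \<in># m'}"
    then have e: "m' = add_mset i (m' - {#i#})" by simp
    have "add_mset i (m' - {#i#}) \<subseteq># add_mset i (m - {#i#})" using m' True by simp
    then show "m' - {#i#} \<in> {k. k \<subseteq># m - {#i#}}" by simp
    have "m - {#i#} - (m' - {#i#}) = m - add_mset i (m' - {#i#})" by (simp add: diff_union_swap2)
    then show "a (m' - {#i#}) * b (m - {#i#} - (m' - {#i#})) = a (m' - {#i#}) * b (m - m')"
      using e by simp
  qed auto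
  finally show ?thesis using True by (simp add: ymul_def weyl_mult_def)
next
  case False
  then have "i \<notin># m'" if "m' \<subseteq># m" for m' using that by (meson mset_subset_eqD)
  then show ?thesis using False by (simp add: ymul_def weyl_mult_def)
qed

text \<open>In the convolution over submultisets \<open>m'\<close> of \<open>m + {i}\<close>, the multiplicity of \<open>i\<close> is the sum of its
  multiplicities in \<open>m'\<close> and in the complement; the two summands give the two terms of the Leibniz
  rule.\<close>

lemma dy_weyl_mult: "dy i (weyl_mult a b) m = weyl_mult (dy i a) b m + weyl_mult a (dy i b) m"
proof -
  \<comment> \<open>The summand \<open>m' = m'' + {i}\<close> carries the factor by which the derivative of \<open>a\<close> differs from \<open>a\<close>.\<close>
  have half: "(\<Sum>m'\<in>{m'. m' \<subseteq># add_mset i m}. of_nat (count m' i) * (a m' * b (add_mset i m - m')))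
      = weyl_mult (dy i a) b m" for a b :: "('b, 'a) weyl"
  proof -
    have "(\<Sum>m'\<in>{m'. m' \<subseteq># add_mset i m}. of_nat (count m' i) * (a m' * b (add_mset i m - m')))
      = (\<Sum>m'\<in>{m'. m' \<subseteq># add_mset i m \<and> i \<in># m'}. of_nat (count m' i) * (a m' * b (add_mset i m - m')))"
      by (rule sum.mono_neutral_right) (auto simp: finite_submultisets not_in_iff)
    also have "\<dots> = (\<Sum>k\<in>{k. k \<subseteq># m}. dy i a k * b (m - k))"
    proof (rule sum.reindex_bij_witness[of _ "add_mset i" "\<lambda>k. k - {#i#}"])
      fix m' assume "m' \<in> {m'. m' \<subseteq># add_mset i m \<and> i \<in># m'}"
      then obtain k where m': "m' = add_mset i k" and "k \<subseteq># m" by (auto dest!: multi_member_split)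
      then show "m' - {#i#} \<in> {k. k \<subseteq># m}"
        and "dy i a (m' - {#i#}) * b (m - (m' - {#i#}))
          = of_nat (count m' i) * (a m' * b (add_mset i m - m'))"
        by (simp_all add: dy_def ac_simps del: of_nat_Suc)
    qed auto
    finally show ?thesis by (simp add: weyl_mult_def)
  qed
  have "of_nat (Suc (count m i)) * (a m' * b (add_mset i m - m'))
      = of_nat (count m' i) * (a m' * b (add_mset i m - m'))
      + of_nat (count (add_mset i m - m') i) * (b (add_mset i m - m') * a m')"
    if "m' \<subseteq># add_mset i m" for m'
  proof -
    have "count m' i \<le> Suc (count m i)" using mset_subset_eq_count[OF that, of i] by simp
    then have "of_nat (Suc (count m i)) = (of_nat (count m' i) + of_nat (count (add_mset i m - m') i) :: 'a fps)"
      by (simp flip: of_nat_add)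
    then show ?thesis by (simp add: algebra_simps del: of_nat_Suc)
  qed
  then have "dy i (weyl_mult a b) m
      = (\<Sum>m'\<in>{m'. m' \<subseteq># add_mset i m}. of_nat (count m' i) * (a m' * b (add_mset i m - m')))
      + (\<Sum>m'\<in>{m'. m' \<subseteq># add_mset i m}.
           of_nat (count (add_mset i m - m') i) * (b (add_mset i m - m') * a m'))"
    by (simp add: dy_def weyl_mult_def sum_distrib_left sum.distrib[symmetric] del: of_nat_Suc)
  also have "(\<Sum>m'\<in>{m'. m' \<subseteq># add_mset i m}.
           of_nat (count (add_mset i m - m') i) * (b (add_mset i m - m') * a m'))
      = (\<Sum>m'\<in>{m'. m' \<subseteq># add_mset i m}. of_nat (count m' i) * (b m' * a (add_mset i m - m')))"
    by (rule sum.reindex_bij_witness[of _ "\<lambda>k. add_mset i m - k" "\<lambda>k. add_mset i m - k"])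
      (auto simp: subset_mset.diff_diff_right)
  finally show ?thesis by (simp add: half weyl_mult_commute[of "dy i b" a])
qed

subsection \<open>The Moyal product\<close>

text \<open>The \<open>n\<close>-th bidifferential operator of the fibrewise Moyal product without its scalar factor. The
  recursion peels off one contraction at a time and replaces the sum over pairs of index lists, so that
  properties of the product follow by induction on \<open>n\<close>.\<close>

fun bidiff :: "('n \<Rightarrow> 'n \<Rightarrow> 'a::comm_ring_1 fps) \<Rightarrow> nat \<Rightarrow> ('n::finite, 'a) weyl \<Rightarrow> ('n, 'a) weyl \<Rightarrow> ('n, 'a) weyl"
  where
  "bidiff wbar 0 a b = weyl_mult a b"
| "bidiff wbar (Suc n) a b = (\<lambda>m. \<Sum>i\<in>UNIV. \<Sum>j\<in>UNIV. wbar i j * bidiff wbar n (dy i a) (dy j b) m)"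

lemma sum_lists_snoc:
  fixes F :: "'n::finite list \<Rightarrow> 'a::comm_monoid_add"
  shows "(\<Sum>I\<in>{I. length I = Suc n}. F I) = (\<Sum>I\<in>{I. length I = n}. \<Sum>i\<in>UNIV. F (I @ [i]))"
proof -
  have "(\<Sum>I\<in>{I. length I = Suc n}. F I) = (\<Sum>(I, i)\<in>{I. length I = n} \<times> UNIV. F (I @ [i]))"
    by (rule sum.reindex_bij_witness[of _ "\<lambda>(I, i). I @ [i]" "\<lambda>I. (butlast I, last I)"])
      (auto simp: length_Suc_conv_rev)
  then show ?thesis by (simp add: sum.cartesian_product)
qed

lemma sum_swap4:
  "(\<Sum>I\<in>A. \<Sum>i\<in>B. \<Sum>J\<in>C. \<Sum>j\<in>D. F I i J j) = (\<Sum>i\<in>B. \<Sum>j\<in>D. \<Sum>I\<in>A. \<Sum>J\<in>C. F I i J j)"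
proof -
  have "(\<Sum>I\<in>A. \<Sum>i\<in>B. \<Sum>J\<in>C. \<Sum>j\<in>D. F I i J j) = (\<Sum>i\<in>B. \<Sum>I\<in>A. \<Sum>J\<in>C. \<Sum>j\<in>D. F I i J j)"
    by (rule sum.swap)
  also have "\<dots> = (\<Sum>i\<in>B. \<Sum>I\<in>A. \<Sum>j\<in>D. \<Sum>J\<in>C. F I i J j)"
    by (rule sum.cong[OF refl], rule sum.cong[OF refl], rule sum.swap)
  also have "\<dots> = (\<Sum>i\<in>B. \<Sum>j\<in>D. \<Sum>I\<in>A. \<Sum>J\<in>C. F I i J j)"
    by (rule sum.cong[OF refl], rule sum.swap)
  finally show ?thesis .
qed

text \<open>In \<open>foldr dy I a\<close> the last index of \<open>I\<close> acts first; the recursion therefore corresponds to splitting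
  off the last entries of the lists.\<close>

lemma bidiff_eq_sum_lists:
  fixes wbar :: "'n::finite \<Rightarrow> 'n \<Rightarrow> 'a::comm_ring_1 fps"
  shows "(\<Sum>(I, J)\<in>{(I, J). length I = n \<and> length J = n}.
      (\<Prod>l<n. wbar (I ! l) (J ! l)) * weyl_mult (foldr dy I a) (foldr dy J b) m)
    = bidiff wbar n a b m"
proof -
  have prod: "{(I, J). length I = n \<and> length J = n} = {I. length I = n} \<times> {J. length J = n}" for n :: nat
    by auto
  have "(\<Sum>I\<in>{I. length I = n}. \<Sum>J\<in>{J. length J = n}.
      (\<Prod>l<n. wbar (I ! l) (J ! l)) * weyl_mult (foldr dy I a) (foldr dy J b) m) = bidiff wbar n a b m"
  proof (induction n arbitrary: a b)
    case (Suc n)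
    have "(\<Sum>I\<in>{I. length I = Suc n}. \<Sum>J\<in>{J. length J = Suc n}.
        (\<Prod>l<Suc n. wbar (I ! l) (J ! l)) * weyl_mult (foldr dy I a) (foldr dy J b) m)
      = (\<Sum>I\<in>{I. length I = n}. \<Sum>i\<in>UNIV. \<Sum>J\<in>{J. length J = n}. \<Sum>j\<in>UNIV.
          wbar i j * ((\<Prod>l<n. wbar (I ! l) (J ! l)) * weyl_mult (foldr dy I (dy i a)) (foldr dy J (dy j b)) m))"
      unfolding sum_lists_snoc
    proof (intro sum.cong refl)
      fix I J :: "'n list" and i j :: 'n assume "I \<in> {I. length I = n}" "J \<in> {J. length J = n}"
      moreover from this have "(\<Prod>l<n. wbar ((I @ [i]) ! l) ((J @ [j]) ! l)) = (\<Prod>l<n. wbar (I ! l) (J ! l))"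
        by (intro prod.cong refl) (auto simp: nth_append)
      ultimately show "(\<Prod>l<Suc n. wbar ((I @ [i]) ! l) ((J @ [j]) ! l)) *
            weyl_mult (foldr dy (I @ [i]) a) (foldr dy (J @ [j]) b) m =
          wbar i j * ((\<Prod>l<n. wbar (I ! l) (J ! l)) * weyl_mult (foldr dy I (dy i a)) (foldr dy J (dy j b)) m)"
        by (auto simp: nth_append ac_simps)
    qed
    also have "\<dots> = (\<Sum>i\<in>UNIV. \<Sum>j\<in>UNIV. \<Sum>I\<in>{I. length I = n}. \<Sum>J\<in>{J. length J = n}.
          wbar i j * ((\<Prod>l<n. wbar (I ! l) (J ! l)) * weyl_mult (foldr dy I (dy i a)) (foldr dy J (dy j b)) m))"
      by (rule sum_swap4)
    also have "\<dots> = bidiff wbar (Suc n) a b m"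
      unfolding sum_distrib_left[symmetric] Suc.IH by simp
    finally show ?case .
  qed simp
  then show ?thesis
    unfolding prod sum.cartesian_product[symmetric] .
qed

lemma circ_nth:
  "fps_nth (circ \<iota> wbar a b m) h =
     (\<Sum>n\<le>h. \<iota> (- \<i> / 2) ^ n * \<iota> (1 / fact n) * fps_nth (bidiff wbar n a b m) (h - n))"
proof -
  define t where "t n = (fps_const (\<iota> (- \<i> / 2)) * fps_X) ^ n * fps_const (\<iota> (1 / fact n)) *
    bidiff wbar n a b m" for n
  have t_nth: "fps_nth (t n) h = (if h < n then 0 else
    \<iota> (- \<i> / 2) ^ n * \<iota> (1 / fact n) * fps_nth (bidiff wbar n a b m) (h - n))" for n h
  proof -
    have "t n = fps_X ^ n * (fps_const (\<iota> (- \<i> / 2) ^ n * \<iota> (1 / fact n)) * bidiff wbar n a b m)"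
      by (simp add: t_def power_mult_distrib ac_simps fps_const_power flip: fps_const_mult)
    then show ?thesis by (simp add: fps_X_power_mult_nth)
  qed
  have "suminf t = Abs_fps (\<lambda>h. \<Sum>n\<le>h. fps_nth (t n) h)"
  proof (rule suminf_fps_eqI)
    fix N h :: nat assume "h < N"
    then show "fps_nth (\<Sum>q<N. t q) h = fps_nth (Abs_fps (\<lambda>h. \<Sum>n\<le>h. fps_nth (t n) h)) h"
      by (auto simp: fps_sum_nth t_nth split: if_splits intro!: sum.mono_neutral_cong_right)
  qed
  moreover have "circ \<iota> wbar a b m = suminf t"
    unfolding circ_def bidiff_eq_sum_lists t_def ..
  ultimately show ?thesis by (simp add: t_nth)
qed

lemma bidiff_add_left: "bidiff wbar n (\<lambda>m. a m + a' m) b m = bidiff wbar n a b m + bidiff wbar n a' b m"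
  by (induction n arbitrary: a a' b m) (simp_all add: weyl_mult_add_left dy_add distrib_left sum.distrib)

lemma bidiff_smult_left: "bidiff wbar n (\<lambda>m. s * a m) b m = s * bidiff wbar n a b m"
  by (induction n arbitrary: a b m)
    (simp_all add: weyl_mult_smult_left dy_smult sum_distrib_left ac_simps)

text \<open>Transposing the tensor exchanges the arguments. This transfers statements about the first argument
  to the second one.\<close>

lemma bidiff_flip: "bidiff wbar n a b m = bidiff (\<lambda>i j. wbar j i) n b a m"
proof (induction n arbitrary: a b m)
  case (Suc n)
  show ?case by (simp add: Suc.IH[of "dy i a" for i]) (rule sum.swap)
qed (simp add: weyl_mult_commute)

lemma bidiff_add_right: "bidiff wbar n a (\<lambda>m. b m + b' m) m = bidiff wbar n a b m + bidiff wbar n a b' m"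
  using bidiff_add_left[of "\<lambda>i j. wbar j i"] by (simp add: bidiff_flip[of wbar])

lemma bidiff_smult_right: "bidiff wbar n a (\<lambda>m. s * b m) m = s * bidiff wbar n a b m"
  using bidiff_smult_left[of "\<lambda>i j. wbar j i"] by (simp add: bidiff_flip[of wbar])

lemma circ_add_left: "circ \<iota> wbar (\<lambda>m. a m + a' m) b m = circ \<iota> wbar a b m + circ \<iota> wbar a' b m"
  by (simp add: fps_eq_iff circ_nth bidiff_add_left distrib_left sum.distrib)

lemma circ_add_right: "circ \<iota> wbar a (\<lambda>m. b m + b' m) m = circ \<iota> wbar a b m + circ \<iota> wbar a b' m"
  by (simp add: fps_eq_iff circ_nth bidiff_add_right distrib_left sum.distrib)

lemma circ_diff_left: "circ \<iota> wbar (\<lambda>m. a m - a' m) b m = circ \<iota> wbar a b m - circ \<iota> wbar a' b m"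
  using circ_add_left[of \<iota> wbar "\<lambda>m. a m - a' m" a' b m] by simp

lemma circ_diff_right: "circ \<iota> wbar a (\<lambda>m. b m - b' m) m = circ \<iota> wbar a b m - circ \<iota> wbar a b' m"
  using circ_add_right[of \<iota> wbar a "\<lambda>m. b m - b' m" b' m] by simp

lemma circ_smult_const_left:
  "circ \<iota> wbar (\<lambda>m. fps_const s * a m) b m = fps_const s * circ \<iota> wbar a b m"
  by (simp add: fps_eq_iff circ_nth bidiff_smult_left sum_distrib_left ac_simps)

lemma circ_smult_const_right:
  "circ \<iota> wbar a (\<lambda>m. fps_const s * b m) m = fps_const s * circ \<iota> wbar a b m"
  by (simp add: fps_eq_iff circ_nth bidiff_smult_right sum_distrib_left ac_simps)

lemma circ_zero_left: "circ \<iota> wbar (\<lambda>m. 0) b m = 0"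
  using circ_diff_left[of \<iota> wbar b b b m] by simp

lemma circ_zero_right: "circ \<iota> wbar a (\<lambda>m. 0) m = 0"
  using circ_diff_right[of \<iota> wbar a a a m] by simp

lemma circ_sum_left: "finite A \<Longrightarrow> circ \<iota> wbar (\<lambda>m. \<Sum>l\<in>A. a l m) b m = (\<Sum>l\<in>A. circ \<iota> wbar (a l) b m)"
  by (induction A rule: finite_induct) (simp_all add: circ_zero_left circ_add_left)

lemma circ_sum_right: "finite A \<Longrightarrow> circ \<iota> wbar a (\<lambda>m. \<Sum>l\<in>A. b l m) m = (\<Sum>l\<in>A. circ \<iota> wbar a (b l) m)"
  by (induction A rule: finite_induct) (simp_all add: circ_zero_right circ_add_right)

text \<open>Rewriting \<open>\<delta>\<^sup>-\<^sup>1\<close> through multiplication by coordinates separates it into a contraction, which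
  interacts with derivations, and a factor that depends on the degree in \<open>y\<close> alone.\<close>

lemma delta_inv1_ymul:
  "delta_inv1 \<iota> a m = fps_const (\<iota> (1 / of_nat (size m))) * (\<Sum>k\<in>UNIV. ymul k (a k) m)"
  for a :: "'n::finite \<Rightarrow> ('n, 'a::comm_ring_1) weyl"
proof -
  have "(\<Sum>k\<in>set_mset m. a k (m - {#k#})) = (\<Sum>k\<in>UNIV. ymul k (a k) m)"
    by (rule sum.mono_neutral_cong_left) (auto simp: ymul_def)
  then show ?thesis by (simp add: delta_inv1_def)
qed

lemma delta_inv2_ymul:
  "delta_inv2 \<iota> a j m = fps_const (\<iota> (1 / of_nat (size m + 1))) * (\<Sum>k\<in>UNIV. ymul k (a k j) m)"
  for a :: "'n::finite \<Rightarrow> 'n \<Rightarrow> ('n, 'a::comm_ring_1) weyl"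
proof -
  have "(\<Sum>k\<in>set_mset m. a k j (m - {#k#})) = (\<Sum>k\<in>UNIV. ymul k (a k j) m)"
    by (rule sum.mono_neutral_cong_left) (auto simp: ymul_def)
  then show ?thesis by (simp add: delta_inv2_def)
qed

section \<open>Change of the coefficient ring\<close>

lemma fps_map_of_nat_mult:
  assumes "Modules.additive f"
  shows "fps_map f (of_nat n * s) = of_nat n * fps_map f s"
proof -
  interpret Modules.additive "fps_map f" by (rule additive_fps_map) (rule assms)
  show ?thesis by (induction n) (simp_all add: zero add distrib_right)
qed

lemma dy_fps_map: "Modules.additive f \<Longrightarrow> dy i (\<lambda>m. fps_map f (a m)) = (\<lambda>m. fps_map f (dy i a m))"
  by (rule ext) (simp only: dy_def fps_map_of_nat_mult)

lemma ymul_fps_map: "Modules.additive f \<Longrightarrow> ymul i (\<lambda>m. fps_map f (a m)) m = fps_map f (ymul i a m)"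
  by (simp add: ymul_def fps_eq_iff Modules.additive.zero)

text \<open>A change of scalars commutes with every operation that occurs in the recursions. Iterates over one
  coefficient ring can therefore be compared with iterates over another one.\<close>

locale coefficient_map = ring_map \<phi> for \<phi> :: "'a::comm_ring_1 \<Rightarrow> 'b::comm_ring_1" +
  fixes \<iota> :: "complex \<Rightarrow> 'a" and \<iota>' :: "complex \<Rightarrow> 'b"
  assumes map_scalar: "\<phi> (\<iota> z) = \<iota>' z"
begin

sublocale fps: ring_map "fps_map \<phi>" by (rule ring_map_fps_map) unfold_locales

lemma bidiff_map:
  "fps_map \<phi> (bidiff wbar n a b m) =
     bidiff (\<lambda>i j. fps_map \<phi> (wbar i j)) n (\<lambda>m. fps_map \<phi> (a m)) (\<lambda>m. fps_map \<phi> (b m)) m"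
  by (induction n arbitrary: a b m)
    (simp_all add: weyl_mult_def fps.sum fps.map_mult dy_fps_map[OF additive_axioms])

lemma circ_map:
  "fps_map \<phi> (circ \<iota> wbar a b m) =
     circ \<iota>' (\<lambda>i j. fps_map \<phi> (wbar i j)) (\<lambda>m. fps_map \<phi> (a m)) (\<lambda>m. fps_map \<phi> (b m)) m"
  unfolding fps_eq_iff
  by (simp add: circ_nth sum map_mult map_power map_scalar flip: bidiff_map)

lemma i_over_hbar_map: "fps_map \<phi> (i_over_hbar \<iota> s) = i_over_hbar \<iota>' (fps_map \<phi> s)"
  by (simp add: fps_eq_iff i_over_hbar_def map_mult map_scalar)

lemma delta_inv1_map: "fps_map \<phi> (delta_inv1 \<iota> a m) = delta_inv1 \<iota>' (\<lambda>k m. fps_map \<phi> (a k m)) m"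
  by (simp add: delta_inv1_def fps.map_mult fps.sum fps_map_const[OF additive_axioms] map_scalar)

lemma delta_inv2_map:
  "fps_map \<phi> (delta_inv2 \<iota> a j m) = delta_inv2 \<iota>' (\<lambda>k l m. fps_map \<phi> (a k l m)) j m"
  by (simp add: delta_inv2_def fps.map_mult fps.sum fps_map_const[OF additive_axioms] map_scalar)

lemma r_rhs_map:
  "fps_map \<phi> (r_rhs \<iota> wbar F nr r j m) =
     r_rhs \<iota>' (\<lambda>i j. fps_map \<phi> (wbar i j)) (\<lambda>k l m. fps_map \<phi> (F k l m))
       (\<lambda>k l m. fps_map \<phi> (nr k l m)) (\<lambda>k m. fps_map \<phi> (r k m)) j m"
  by (simp add: r_rhs_def fps.map_add delta_inv2_map wedge2_def fps.diff i_over_hbar_map circ_map)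

lemma lift_rhs_map:
  "fps_map \<phi> (lift_rhs \<iota> wbar r f na a m) =
     lift_rhs \<iota>' (\<lambda>i j. fps_map \<phi> (wbar i j)) (\<lambda>k m. fps_map \<phi> (r k m)) (\<phi> f)
       (\<lambda>k m. fps_map \<phi> (na k m)) (\<lambda>m. fps_map \<phi> (a m)) m"
  by (simp add: lift_rhs_def fps.map_add delta_inv1_map fps.diff i_over_hbar_map circ_map fps.zero
    fps_map_const[OF additive_axioms])

lemma source_form_map:
  "fps_map \<phi> (source_form \<iota> R A k l m) =
     source_form \<iota>' (\<lambda>i j k l. \<phi> (R i j k l)) (\<lambda>k l. fps_map \<phi> (A k l)) k l m"
  by (simp add: source_form_def wedge2_def fps.diff fps.map_add fps.sum if_distrib fps.zero fps.map_mult
    fps_map_const[OF additive_axioms] map_mult map_scalar cong: if_cong)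

end

section \<open>The degree filtration and the iterative solution of Fedosov's recursions\<close>

text \<open>The total degree counts \<open>y\<close> once and \<open>\<hbar>\<close> twice. Degrees are integers because differentiation and
  division by \<open>\<hbar>\<close> lower the bound, possibly below zero.\<close>

definition deg_ge :: "int \<Rightarrow> ('n, 'a::comm_ring_1) weyl \<Rightarrow> bool" where
  "deg_ge p a \<longleftrightarrow> (\<forall>m h. int (2 * h + size m) < p \<longrightarrow> fps_nth (a m) h = 0)"

lemma deg_geI: "(\<And>m h. int (2 * h + size m) < p \<Longrightarrow> fps_nth (a m) h = 0) \<Longrightarrow> deg_ge p a"
  by (simp add: deg_ge_def)

lemma deg_geD: "deg_ge p a \<Longrightarrow> int (2 * h + size m) < p \<Longrightarrow> fps_nth (a m) h = 0"
  by (simp add: deg_ge_def)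

lemma deg_ge_mono: "deg_ge p a \<Longrightarrow> q \<le> p \<Longrightarrow> deg_ge q a"
  by (simp add: deg_ge_def)

lemma deg_ge_zero [simp]: "deg_ge p (\<lambda>m. 0)"
  by (simp add: deg_ge_def)

lemma deg_ge_add: "deg_ge p a \<Longrightarrow> deg_ge p b \<Longrightarrow> deg_ge p (\<lambda>m. a m + b m)"
  by (simp add: deg_ge_def)

lemma deg_ge_diff: "deg_ge p a \<Longrightarrow> deg_ge p b \<Longrightarrow> deg_ge p (\<lambda>m. a m - b m)"
  by (simp add: deg_ge_def)

lemma deg_ge_sum: "(\<And>l. l \<in> A \<Longrightarrow> deg_ge p (a l)) \<Longrightarrow> deg_ge p (\<lambda>m. \<Sum>l\<in>A. a l m)"
  by (simp add: deg_ge_def fps_sum_nth)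

lemma deg_ge_smult: "deg_ge p a \<Longrightarrow> deg_ge p (\<lambda>m. s * a m)"
  by (auto simp: deg_ge_def fps_mult_nth intro!: sum.neutral)

lemma deg_ge_fps_map: "Modules.additive f \<Longrightarrow> deg_ge p a \<Longrightarrow> deg_ge p (\<lambda>m. fps_map f (a m))"
  by (simp add: deg_ge_def Modules.additive.zero)

lemma deg_ge_dy: "deg_ge p a \<Longrightarrow> deg_ge (p - 1) (dy i a)"
  unfolding dy_def
  by (rule deg_geI) (simp add: deg_ge_def flip: fps_of_nat del: of_nat_Suc)

lemma deg_ge_weyl_mult:
  assumes a: "deg_ge p a" and b: "deg_ge q b"
  shows "deg_ge (p + q) (weyl_mult a b)"
proof (rule deg_geI)
  fix m :: "'a multiset" and h assume deg: "int (2 * h + size m) < p + q"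
  show "fps_nth (weyl_mult a b m) h = 0"
    unfolding weyl_mult_def fps_sum_nth fps_mult_nth
  proof (intro sum.neutral ballI)
    fix m' i assume "m' \<in> {m'. m' \<subseteq># m}" "i \<in> {0..h}"
    then have "size m' + size (m - m') = size m" "i + (h - i) = h"
      by (auto simp: size_Diff_submset size_mset_mono)
    then have "int (2 * i + size m') < p \<or> int (2 * (h - i) + size (m - m')) < q"
      using deg by linarith
    then show "fps_nth (a m') i * fps_nth (b (m - m')) (h - i) = 0"
      using deg_geD[OF a] deg_geD[OF b] by auto
  qed
qed

lemma deg_ge_bidiff: "deg_ge p a \<Longrightarrow> deg_ge q b \<Longrightarrow> deg_ge (p + q - 2 * int n) (bidiff wbar n a b)"
proof (induction n arbitrary: a b p q)
  case (Suc n)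
  have "deg_ge (p - 1 + (q - 1) - 2 * int n) (bidiff wbar n (dy i a) (dy j b))" for i j
    by (rule Suc.IH[OF deg_ge_dy[OF Suc.prems(1)] deg_ge_dy[OF Suc.prems(2)]])
  moreover have "p - 1 + (q - 1) - 2 * int n = p + q - 2 * int (Suc n)" by simp
  ultimately have "deg_ge (p + q - 2 * int (Suc n)) (bidiff wbar n (dy i a) (dy j b))" for i j
    by metis
  then show ?case unfolding bidiff.simps by (intro deg_ge_sum deg_ge_smult)
qed (simp add: deg_ge_weyl_mult)

text \<open>A contraction lowers the degree in \<open>y\<close> by two and comes with a factor \<open>\<hbar>\<close>, so that the total
  degree does not drop.\<close>

lemma deg_ge_circ:
  assumes "deg_ge p a" "deg_ge q b"
  shows "deg_ge (p + q) (circ \<iota> wbar a b)"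
proof (rule deg_geI)
  fix m :: "'a multiset" and h assume deg: "int (2 * h + size m) < p + q"
  show "fps_nth (circ \<iota> wbar a b m) h = 0"
    unfolding circ_nth
  proof (intro sum.neutral ballI)
    fix n assume "n \<in> {..h}"
    then have "int (2 * (h - n) + size m) < p + q - 2 * int n" using deg by simp
    from deg_geD[OF deg_ge_bidiff[OF assms] this]
    show "\<iota> (- \<i> / 2) ^ n * \<iota> (1 / fact n) * fps_nth (bidiff wbar n a b m) (h - n) = 0" by simp
  qed
qed

lemma deg_ge_i_over_hbar: "deg_ge p a \<Longrightarrow> deg_ge (p - 2) (\<lambda>m. i_over_hbar \<iota> (a m))"
  by (simp add: deg_ge_def i_over_hbar_def)

lemma deg_ge_remove1:
  assumes "deg_ge p a" "int (2 * h + size m) < p + 1" "k \<in># m"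
  shows "fps_nth (a (m - {#k#})) h = 0"
proof -
  obtain m' where m: "m = add_mset k m'" using assms(3) by (meson mset_add)
  then show ?thesis using deg_geD[OF assms(1), of h m'] assms(2) by simp
qed

lemma deg_ge_delta_inv1:
  fixes a :: "'n::finite \<Rightarrow> ('n, 'a::comm_ring_1) weyl"
  assumes "\<And>k. deg_ge p (a k)"
  shows "deg_ge (p + 1) (delta_inv1 \<iota> a)"
proof (rule deg_geI)
  fix m :: "'n multiset" and h assume "int (2 * h + size m) < p + 1"
  from deg_ge_remove1[OF assms this] show "fps_nth (delta_inv1 \<iota> a m) h = 0"
    by (simp add: delta_inv1_def fps_sum_nth)
qed

lemma deg_ge_delta_inv2:
  fixes a :: "'n::finite \<Rightarrow> 'n \<Rightarrow> ('n, 'a::comm_ring_1) weyl"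
  assumes "\<And>k. deg_ge p (a k j)"
  shows "deg_ge (p + 1) (delta_inv2 \<iota> a j)"
proof (rule deg_geI)
  fix m :: "'n multiset" and h assume "int (2 * h + size m) < p + 1"
  from deg_ge_remove1[OF assms this] show "fps_nth (delta_inv2 \<iota> a j m) h = 0"
    by (simp add: delta_inv2_def fps_sum_nth)
qed

lemma delta_inv1_diff: "delta_inv1 \<iota> (\<lambda>k m. a k m - b k m) m = delta_inv1 \<iota> a m - delta_inv1 \<iota> b m"
  by (simp add: delta_inv1_def sum_subtractf right_diff_distrib)

lemma delta_inv2_diff: "delta_inv2 \<iota> (\<lambda>k l m. a k l m - b k l m) j m = delta_inv2 \<iota> a j m - delta_inv2 \<iota> b j m"
  by (simp add: delta_inv2_def sum_subtractf right_diff_distrib)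

lemma i_over_hbar_diff: "i_over_hbar \<iota> (s - t) = i_over_hbar \<iota> s - i_over_hbar \<iota> t"
  by (simp add: fps_eq_iff i_over_hbar_def right_diff_distrib)

lemma deg_ge_circ_diff:
  assumes "deg_ge p a" "deg_ge D (\<lambda>m. b m - b' m)" "deg_ge D' (\<lambda>m. a m - a' m)" "deg_ge q b'"
    "E \<le> p + D" "E \<le> D' + q"
  shows "deg_ge E (\<lambda>m. circ \<iota> wbar a b m - circ \<iota> wbar a' b' m)"
proof -
  have "circ \<iota> wbar a b m - circ \<iota> wbar a' b' m
      = circ \<iota> wbar a (\<lambda>m. b m - b' m) m + circ \<iota> wbar (\<lambda>m. a m - a' m) b' m" for m
    by (simp add: circ_diff_left circ_diff_right)
  then show ?thesis
    using deg_ge_circ[OF assms(1,2), of \<iota> wbar] deg_ge_circ[OF assms(3,4), of \<iota> wbar] assms(5,6)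
    by (auto intro!: deg_ge_add elim!: deg_ge_mono)
qed

lemma deg_ge_r_rhs:
  assumes F: "\<And>k l. deg_ge 2 (F k l)" and nr: "\<And>k l. deg_ge 3 (nr k l)" and r: "\<And>k. deg_ge 3 (r k)"
  shows "deg_ge 3 (r_rhs \<iota> wbar F nr r j)"
proof -
  have c: "deg_ge 4 (\<lambda>m. i_over_hbar \<iota> (wedge2 (\<lambda>k l. circ \<iota> wbar (r k) (r l)) k l m))" for k l
    using deg_ge_i_over_hbar[of 6 "\<lambda>m. wedge2 (\<lambda>k l. circ \<iota> wbar (r k) (r l)) k l m" \<iota>]
      deg_ge_circ[OF r r] by (simp add: wedge2_def deg_ge_diff)
  have "deg_ge (2 + 1) (delta_inv2 \<iota> (\<lambda>k l m. wedge2 nr k l m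
        + i_over_hbar \<iota> (wedge2 (\<lambda>k l. circ \<iota> wbar (r k) (r l)) k l m)) j)"
    unfolding wedge2_def[of nr]
    by (intro deg_ge_delta_inv2 deg_ge_add deg_ge_diff deg_ge_mono[OF c] deg_ge_mono[OF nr]) simp_all
  moreover have "deg_ge (2 + 1) (delta_inv2 \<iota> F j)" by (rule deg_ge_delta_inv2) (rule F)
  ultimately show ?thesis unfolding r_rhs_def by (simp add: deg_ge_add)
qed

text \<open>Multiplication by a form of degree at least 3 gains three degrees, of which the division by \<open>\<hbar>\<close>
  costs two; \<open>\<delta>\<^sup>-\<^sup>1\<close> gains one degree for every term. Only the
  antisymmetrised derivative of \<open>r\<close> enters. This matters in a chart, where the covariant derivatives
  agree only after antisymmetrisation.\<close>

lemma r_rhs_contraction: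
  assumes r: "\<And>k. deg_ge 3 (r k)" "\<And>k. deg_ge 3 (r' k)"
    and diff: "\<And>k. deg_ge D (\<lambda>m. r k m - r' k m)"
    and nr: "\<And>k l. deg_ge D (\<lambda>m. wedge2 nr k l m - wedge2 nr' k l m)"
  shows "deg_ge (D + 1) (\<lambda>m. r_rhs \<iota> wbar F nr r j m - r_rhs \<iota> wbar F nr' r' j m)"
proof -
  have c: "deg_ge (D + 3) (\<lambda>m. circ \<iota> wbar (r k) (r l) m - circ \<iota> wbar (r' k) (r' l) m)" for k l
    by (rule deg_ge_circ_diff[OF r(1) diff diff r(2)]) auto
  have c': "deg_ge (D + 3) (\<lambda>m. wedge2 (\<lambda>k l. circ \<iota> wbar (r k) (r l)) k l m
      - wedge2 (\<lambda>k l. circ \<iota> wbar (r' k) (r' l)) k l m)" for k l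
    unfolding wedge2_def using deg_ge_diff[OF c[of k l] c[of l k]] by (simp add: algebra_simps)
  have "deg_ge (D + 1) (delta_inv2 \<iota> (\<lambda>k l m. (wedge2 nr k l m - wedge2 nr' k l m) +
      i_over_hbar \<iota> (wedge2 (\<lambda>k l. circ \<iota> wbar (r k) (r l)) k l m
      - wedge2 (\<lambda>k l. circ \<iota> wbar (r' k) (r' l)) k l m)) j)"
    by (intro deg_ge_delta_inv2 deg_ge_add nr deg_ge_mono[OF deg_ge_i_over_hbar[OF c']]) simp
  moreover have "r_rhs \<iota> wbar F nr r j m - r_rhs \<iota> wbar F nr' r' j m =
      delta_inv2 \<iota> (\<lambda>k l m. (wedge2 nr k l m - wedge2 nr' k l m) +
      i_over_hbar \<iota> (wedge2 (\<lambda>k l. circ \<iota> wbar (r k) (r l)) k l m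
      - wedge2 (\<lambda>k l. circ \<iota> wbar (r' k) (r' l)) k l m)) j m" for m
    by (simp add: r_rhs_def i_over_hbar_diff add_diff_add flip: delta_inv2_diff)
  ultimately show ?thesis by presburger
qed

lemma lift_rhs_contraction:
  assumes r: "\<And>k. deg_ge 3 (r k)"
    and diff: "deg_ge D (\<lambda>m. a m - a' m)"
    and na: "\<And>k. deg_ge D (\<lambda>m. na k m - na' k m)"
  shows "deg_ge (D + 1) (\<lambda>m. lift_rhs \<iota> wbar r f na a m - lift_rhs \<iota> wbar r f na' a' m)"
proof -
  have c: "deg_ge (D + 3) (\<lambda>m. circ \<iota> wbar (r k) (\<lambda>m. a m - a' m) m - circ \<iota> wbar (\<lambda>m. a m - a' m) (r k) m)" for k
    using deg_ge_circ[OF r diff] deg_ge_circ[OF diff r] by (intro deg_ge_diff) (simp_all add: add.commute)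
  have "deg_ge (D + 1) (delta_inv1 \<iota> (\<lambda>k m. (na k m - na' k m) +
      i_over_hbar \<iota> (circ \<iota> wbar (r k) (\<lambda>m. a m - a' m) m - circ \<iota> wbar (\<lambda>m. a m - a' m) (r k) m)))"
    by (intro deg_ge_delta_inv1 deg_ge_add na deg_ge_mono[OF deg_ge_i_over_hbar[OF c]]) simp
  moreover have "lift_rhs \<iota> wbar r f na a m - lift_rhs \<iota> wbar r f na' a' m =
      delta_inv1 \<iota> (\<lambda>k m. (na k m - na' k m) +
      i_over_hbar \<iota> (circ \<iota> wbar (r k) (\<lambda>m. a m - a' m) m - circ \<iota> wbar (\<lambda>m. a m - a' m) (r k) m)) m" for m
    by (simp add: lift_rhs_def circ_diff_left circ_diff_right i_over_hbar_diff flip: delta_inv1_diff)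
      (simp add: algebra_simps)
  ultimately show ?thesis by presburger
qed

lemma deg_ge_unbounded: "(\<And>N. deg_ge (int N) a) \<Longrightarrow> a m = 0"
  by (rule fps_ext) (metis deg_geD fps_zero_nth lessI of_nat_less_iff)

text \<open>The recursions of the formula over an arbitrary ring of coefficients with derivations \<open>d k\<close>. They
  are used for the universal polynomials, for the expressions at a point, and for the flat quotient.\<close>

definition r_iter ::
  "(complex \<Rightarrow> 'a::comm_ring_1) \<Rightarrow> ('n::finite \<Rightarrow> 'n \<Rightarrow> 'a fps) \<Rightarrow> ('n \<Rightarrow> 'n \<Rightarrow> ('n, 'a) weyl) \<Rightarrow>
   ('n \<Rightarrow> 'a \<Rightarrow> 'a) \<Rightarrow> nat \<Rightarrow> 'n \<Rightarrow> ('n, 'a) weyl" where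
  "r_iter \<iota> wbar F d N = ((\<lambda>r. r_rhs \<iota> wbar F (\<lambda>k l m. fps_map (d k) (r l m)) r) ^^ N) (\<lambda>_ _. 0)"

definition r_solution ::
  "(complex \<Rightarrow> 'a::comm_ring_1) \<Rightarrow> ('n::finite \<Rightarrow> 'n \<Rightarrow> 'a fps) \<Rightarrow> ('n \<Rightarrow> 'n \<Rightarrow> ('n, 'a) weyl) \<Rightarrow>
   ('n \<Rightarrow> 'a \<Rightarrow> 'a) \<Rightarrow> 'n \<Rightarrow> ('n, 'a) weyl" where
  "r_solution \<iota> wbar F d j m = Abs_fps (\<lambda>h. fps_nth (r_iter \<iota> wbar F d (2 * h + size m) j m) h)"

definition lift_iter ::
  "(complex \<Rightarrow> 'a::comm_ring_1) \<Rightarrow> ('n::finite \<Rightarrow> 'n \<Rightarrow> 'a fps) \<Rightarrow> ('n \<Rightarrow> ('n, 'a) weyl) \<Rightarrow>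
   ('n \<Rightarrow> 'a \<Rightarrow> 'a) \<Rightarrow> 'a \<Rightarrow> nat \<Rightarrow> ('n, 'a) weyl" where
  "lift_iter \<iota> wbar r d f N = ((\<lambda>a. lift_rhs \<iota> wbar r f (\<lambda>k m. fps_map (d k) (a m)) a) ^^ N) (\<lambda>_. 0)"

definition lift_solution ::
  "(complex \<Rightarrow> 'a::comm_ring_1) \<Rightarrow> ('n::finite \<Rightarrow> 'n \<Rightarrow> 'a fps) \<Rightarrow> ('n \<Rightarrow> ('n, 'a) weyl) \<Rightarrow>
   ('n \<Rightarrow> 'a \<Rightarrow> 'a) \<Rightarrow> 'a \<Rightarrow> ('n, 'a) weyl" where
  "lift_solution \<iota> wbar r d f m = Abs_fps (\<lambda>h. fps_nth (lift_iter \<iota> wbar r d f (2 * h + size m + 1) m) h)"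

lemma r_iter_0: "r_iter \<iota> wbar F d 0 = (\<lambda>_ _. 0)"
  by (simp add: r_iter_def)

lemma r_iter_Suc: "r_iter \<iota> wbar F d (Suc N) =
    r_rhs \<iota> wbar F (\<lambda>k l m. fps_map (d k) (r_iter \<iota> wbar F d N l m)) (r_iter \<iota> wbar F d N)"
  by (simp add: r_iter_def)

lemma lift_iter_0: "lift_iter \<iota> wbar r d f 0 = (\<lambda>_. 0)"
  by (simp add: lift_iter_def)

lemma lift_iter_Suc: "lift_iter \<iota> wbar r d f (Suc N) =
    lift_rhs \<iota> wbar r f (\<lambda>k m. fps_map (d k) (lift_iter \<iota> wbar r d f N m)) (lift_iter \<iota> wbar r d f N)"
  by (simp add: lift_iter_def)

context coefficient_map
begin

lemma r_iter_map:
  assumes "\<And>k x. \<phi> (d k x) = d' k (\<phi> x)"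
  shows "(\<lambda>j m. fps_map \<phi> (r_iter \<iota> wbar F d N j m)) =
    r_iter \<iota>' (\<lambda>i j. fps_map \<phi> (wbar i j)) (\<lambda>k l m. fps_map \<phi> (F k l m)) d' N"
proof (induction N)
  case 0
  show ?case by (simp add: r_iter_0 fps.zero)
next
  case (Suc N)
  have "fps_map \<phi> (fps_map (d k) s) = fps_map (d' k) (fps_map \<phi> s)" for k s
    by (simp add: fps_eq_iff assms)
  then show ?case by (simp add: r_iter_Suc r_rhs_map fun_eq_iff flip: Suc.IH)
qed

lemma r_solution_map:
  assumes "\<And>k x. \<phi> (d k x) = d' k (\<phi> x)"
  shows "fps_map \<phi> (r_solution \<iota> wbar F d j m) =
    r_solution \<iota>' (\<lambda>i j. fps_map \<phi> (wbar i j)) (\<lambda>k l m. fps_map \<phi> (F k l m)) d' j m"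
  by (simp add: fps_eq_iff r_solution_def flip: r_iter_map[where d = d, OF assms])

lemma lift_iter_map:
  assumes "\<And>k x. \<phi> (d k x) = d' k (\<phi> x)"
  shows "(\<lambda>m. fps_map \<phi> (lift_iter \<iota> wbar r d f N m)) =
    lift_iter \<iota>' (\<lambda>i j. fps_map \<phi> (wbar i j)) (\<lambda>k m. fps_map \<phi> (r k m)) d' (\<phi> f) N"
proof (induction N)
  case 0
  show ?case by (simp add: lift_iter_0 fps.zero)
next
  case (Suc N)
  have "fps_map \<phi> (fps_map (d k) s) = fps_map (d' k) (fps_map \<phi> s)" for k s
    by (simp add: fps_eq_iff assms)
  then show ?case by (simp add: lift_iter_Suc lift_rhs_map fun_eq_iff flip: Suc.IH)
qed

lemma lift_solution_map:
  assumes "\<And>k x. \<phi> (d k x) = d' k (\<phi> x)"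
  shows "fps_map \<phi> (lift_solution \<iota> wbar r d f m) =
    lift_solution \<iota>' (\<lambda>i j. fps_map \<phi> (wbar i j)) (\<lambda>k m. fps_map \<phi> (r k m)) d' (\<phi> f) m"
  by (simp add: fps_eq_iff lift_solution_def flip: lift_iter_map[where d = d, OF assms])

end

context
  fixes d :: "'n::finite \<Rightarrow> 'a::comm_ring_1 \<Rightarrow> 'a" and \<iota> :: "complex \<Rightarrow> 'a"
  assumes d: "\<And>k. Modules.additive (d k)"
begin

lemma deg_ge_r_iter: "(\<And>k l. deg_ge 2 (F k l)) \<Longrightarrow> deg_ge 3 (r_iter \<iota> wbar F d N j)"
  by (induction N arbitrary: j) (simp_all add: r_iter_0 r_iter_Suc deg_ge_r_rhs deg_ge_fps_map[OF d])

lemma wedge_deriv_diff: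
  "wedge2 (\<lambda>k l m. fps_map (d k) (r l m)) k l m - wedge2 (\<lambda>k l m. fps_map (d k) (r' l m)) k l m
   = fps_map (d k) (r l m - r' l m) - fps_map (d l) (r k m - r' k m)"
  using additive_fps_map[OF d] by (simp add: wedge2_def Modules.additive.diff)

lemma r_rhs_deriv_contraction:
  assumes "\<And>k. deg_ge 3 (r k)" "\<And>k. deg_ge 3 (r' k)" "\<And>k. deg_ge D (\<lambda>m. r k m - r' k m)"
  shows "deg_ge (D + 1) (\<lambda>m. r_rhs \<iota> wbar F (\<lambda>k l m. fps_map (d k) (r l m)) r j m
    - r_rhs \<iota> wbar F (\<lambda>k l m. fps_map (d k) (r' l m)) r' j m)"
  by (rule r_rhs_contraction[OF assms])
    (simp add: wedge_deriv_diff deg_ge_diff deg_ge_fps_map[OF d] assms(3))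

lemma r_iter_stable:
  assumes F: "\<And>k l. deg_ge 2 (F k l)" and "N \<le> M"
  shows "deg_ge (int N + 3) (\<lambda>m. r_iter \<iota> wbar F d M j m - r_iter \<iota> wbar F d N j m)"
proof -
  note r3 = deg_ge_r_iter[OF F, where wbar = wbar]
  have consecutive: "deg_ge (int N + 3) (\<lambda>m. r_iter \<iota> wbar F d (Suc N) j m - r_iter \<iota> wbar F d N j m)" for N j
  proof (induction N arbitrary: j)
    case 0
    show ?case using r3[where N = "Suc 0"] by (simp add: r_iter_0)
  next
    case (Suc N)
    have "deg_ge (int N + 3 + 1) (\<lambda>m. r_iter \<iota> wbar F d (Suc (Suc N)) j m - r_iter \<iota> wbar F d (Suc N) j m)"
      unfolding r_iter_Suc[of _ _ _ _ "Suc N"] r_iter_Suc[of _ _ _ _ N]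
      by (rule r_rhs_deriv_contraction) (use r3[where N = "Suc N"] r3[where N = N] Suc in \<open>simp_all add: r_iter_Suc\<close>)
    then show ?case by (simp add: algebra_simps)
  qed
  show ?thesis using \<open>N \<le> M\<close>
  proof (induction M rule: dec_induct)
    case (step M)
    have "deg_ge (int N + 3) (\<lambda>m. r_iter \<iota> wbar F d (Suc M) j m - r_iter \<iota> wbar F d M j m)"
      by (rule deg_ge_mono[OF consecutive]) (use step.hyps in simp)
    from deg_ge_add[OF this step.IH] show ?case by simp
  qed simp
qed

text \<open>The coefficient of the solution at \<open>\<hbar>\<^sup>h y\<^sup>m\<close> is read off from the iterate with number \<open>2 h + |m|\<close>,
  which is already stable in this degree.\<close>

lemma r_solution_iter:
  assumes F: "\<And>k l. deg_ge 2 (F k l)"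
  shows "deg_ge (int N + 3) (\<lambda>m. r_solution \<iota> wbar F d j m - r_iter \<iota> wbar F d N j m)"
proof (rule deg_geI)
  fix m :: "'n multiset" and h assume deg: "int (2 * h + size m) < int N + 3"
  let ?K = "2 * h + size m"
  have "fps_nth (r_iter \<iota> wbar F d ?K j m) h = fps_nth (r_iter \<iota> wbar F d N j m) h"
  proof (cases "N \<le> ?K")
    case True
    from deg_geD[OF r_iter_stable[OF F this] deg, where wbar1 = wbar and j1 = j] show ?thesis by simp
  next
    case False
    then have "?K \<le> N" by simp
    from deg_geD[OF r_iter_stable[OF F this], where wbar1 = wbar and j1 = j] show ?thesis by simp
  qed
  then show "fps_nth (r_solution \<iota> wbar F d j m - r_iter \<iota> wbar F d N j m) h = 0"
    by (simp add: r_solution_def)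
qed

lemma deg_ge_r_solution:
  assumes F: "\<And>k l. deg_ge 2 (F k l)"
  shows "deg_ge 3 (r_solution \<iota> wbar F d j)"
  using r_solution_iter[OF F, where N = 0 and wbar = wbar and j = j] by (simp add: r_iter_0)

lemma r_solution_fixed:
  fixes wbar :: "'n \<Rightarrow> 'n \<Rightarrow> 'a fps"
  assumes F: "\<And>k l. deg_ge 2 (F k l)"
  defines "r \<equiv> r_solution \<iota> wbar F d"
  shows "r j m = r_rhs \<iota> wbar F (\<lambda>k l m. fps_map (d k) (r l m)) r j m"
proof -
  let ?R = "r_rhs \<iota> wbar F (\<lambda>k l m. fps_map (d k) (r l m)) r"
  have "deg_ge (int N) (\<lambda>m. r j m - ?R j m)" for N
  proof -
    have R: "deg_ge (int N + 3 + 1) (\<lambda>m. ?R j m - r_iter \<iota> wbar F d (Suc N) j m)"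
      unfolding r_iter_Suc r_def
      by (rule r_rhs_deriv_contraction deg_ge_r_solution deg_ge_r_iter r_solution_iter F)+
    have r: "deg_ge (int (Suc N) + 3) (\<lambda>m. r j m - r_iter \<iota> wbar F d (Suc N) j m)"
      unfolding r_def by (rule r_solution_iter) (rule F)
    have "deg_ge (int N) (\<lambda>m. (r j m - r_iter \<iota> wbar F d (Suc N) j m)
        - (?R j m - r_iter \<iota> wbar F d (Suc N) j m))"
      by (rule deg_ge_diff[OF deg_ge_mono[OF r] deg_ge_mono[OF R]]) simp_all
    then show ?thesis by simp
  qed
  from deg_ge_unbounded[where a = "\<lambda>m. r j m - ?R j m", OF this] show ?thesis by simp
qed

text \<open>The starting point 0 of the iteration agrees with any fixed point in degrees below 0, and each step
  gains one degree. An explicit fixed point is therefore the iterative solution.\<close>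

lemma lift_solution_unique:
  assumes r: "\<And>k. deg_ge 3 (r k)"
    and a: "\<And>m. a m = lift_rhs \<iota> wbar r f (\<lambda>k m. fps_map (d k) (a m)) a m"
  shows "lift_solution \<iota> wbar r d f m = a m"
proof -
  have iter: "deg_ge (int N) (\<lambda>m. lift_iter \<iota> wbar r d f N m - a m)" for N
  proof (induction N)
    case (Suc N)
    have "deg_ge (int N + 1) (\<lambda>m. lift_iter \<iota> wbar r d f (Suc N) m
        - lift_rhs \<iota> wbar r f (\<lambda>k m. fps_map (d k) (a m)) a m)"
      unfolding lift_iter_Suc
      by (rule lift_rhs_contraction[OF r Suc])
        (use deg_ge_fps_map[OF d Suc] in \<open>simp add: Modules.additive.diff[OF additive_fps_map[OF d]]\<close>)
    then show ?case by (simp add: add.commute flip: a)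
  qed (simp add: deg_ge_def)
  show ?thesis
  proof (rule fps_ext)
    fix h
    have "int (2 * h + size m) < int (2 * h + size m + 1)" by simp
    from deg_geD[OF iter this] show "fps_nth (lift_solution \<iota> wbar r d f m) h = fps_nth (a m) h"
      by (simp add: lift_solution_def)
  qed
qed

end

section \<open>Covariance of the iterates\<close>

lemma ymul_add: "ymul i (\<lambda>m. a m + b m) m = ymul i a m + ymul i b m"
  by (simp add: ymul_def)

lemma ymul_diff: "ymul i (\<lambda>m. a m - b m) m = ymul i a m - ymul i b m"
  by (simp add: ymul_def)

lemma ymul_smult: "ymul i (\<lambda>m. s * a m) m = s * ymul i a m"
  by (simp add: ymul_def)

lemma ymul_sum: "ymul i (\<lambda>m. \<Sum>l\<in>A. a l m) m = (\<Sum>l\<in>A. ymul i (a l) m)"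
  by (simp add: ymul_def)

lemma ymul_commute: "ymul i (ymul j a) m = ymul j (ymul i a) m"
  by (cases "i = j") (auto simp: ymul_def in_diff_count add_mset_commute)

lemma ymul_cong: "(\<And>m. a m = b m) \<Longrightarrow> ymul i a m = ymul i b m"
  by (simp add: ymul_def)

lemma dy_diff: "dy i (\<lambda>m. a m - b m) m = dy i a m - dy i b m"
  by (simp add: dy_def right_diff_distrib)

lemma dy_sum: "dy i (\<lambda>m. \<Sum>l\<in>A. a l m) m = (\<Sum>l\<in>A. dy i (a l) m)"
  by (simp add: dy_def sum_distrib_left)

lemma bidiff_zero_left: "bidiff wbar n (\<lambda>m. 0) b m = 0"
  using bidiff_smult_left[of wbar n 0 "\<lambda>m. 0" b m] by simp

lemma bidiff_sum_left:
  "finite A \<Longrightarrow> bidiff wbar n (\<lambda>m. \<Sum>l\<in>A. a l m) b m = (\<Sum>l\<in>A. bidiff wbar n (a l) b m)"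
  by (induction A rule: finite_induct) (simp_all add: bidiff_zero_left bidiff_add_left)

lemma bidiff_sum_right:
  "finite A \<Longrightarrow> bidiff wbar n a (\<lambda>m. \<Sum>l\<in>A. b l m) m = (\<Sum>l\<in>A. bidiff wbar n a (b l) m)"
  using bidiff_sum_left[of A "\<lambda>i j. wbar j i" n b a m] by (simp add: bidiff_flip[of wbar])

lemma weyl_mult_sum_left:
  "finite A \<Longrightarrow> weyl_mult (\<lambda>m. \<Sum>l\<in>A. a l m) b m = (\<Sum>l\<in>A. weyl_mult (a l) b m)"
  by (induction A rule: finite_induct) (simp_all add: weyl_mult_def distrib_right sum.distrib)

lemma weyl_mult_diff_left: "weyl_mult (\<lambda>m. a m - a' m) b m = weyl_mult a b m - weyl_mult a' b m"
  by (simp add: weyl_mult_def left_diff_distrib sum_subtractf)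

lemma weyl_mult_diff_right: "weyl_mult a (\<lambda>m. b m - b' m) m = weyl_mult a b m - weyl_mult a b' m"
  by (simp add: weyl_mult_def right_diff_distrib sum_subtractf)

lemma dy_nth: "fps_nth (dy i a m) h = of_nat (Suc (count m i)) * fps_nth (a (add_mset i m)) h"
  by (simp add: dy_def flip: fps_of_nat del: of_nat_Suc)

lemma ymul_nth: "fps_nth (ymul i a m) h = (if i \<in># m then fps_nth (a (m - {#i#})) h else 0)"
  by (simp add: ymul_def)

text \<open>The vector field \<open>G\<^sup>l\<^sub>i y\<^sup>i \<partial>/\<partial>y\<^sup>l\<close> on the fibre, that is, the infinitesimal action of the
  matrix \<open>G\<close> on the formal Weyl algebra.\<close>

definition gl_act :: "('n::finite \<Rightarrow> 'n \<Rightarrow> 'a::comm_ring_1) \<Rightarrow> ('n, 'a) weyl \<Rightarrow> ('n, 'a) weyl" where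
  "gl_act G a m = (\<Sum>l\<in>UNIV. \<Sum>i\<in>UNIV. fps_const (G l i) * ymul i (dy l a) m)"

lemma gl_act_add: "gl_act G (\<lambda>m. a m + b m) m = gl_act G a m + gl_act G b m"
  by (simp add: gl_act_def dy_add ymul_add distrib_left sum.distrib)

lemma gl_act_smult: "gl_act G (\<lambda>m. s * a m) m = s * gl_act G a m"
  by (simp add: gl_act_def dy_smult ymul_smult sum_distrib_left ac_simps)

lemma gl_act_size:
  "gl_act G (\<lambda>m. c (size m) * a m) m = c (size m) * gl_act G a m"
proof -
  have "ymul i (dy l (\<lambda>m. c (size m) * a m)) m = c (size m) * ymul i (dy l a) m" for i l
    by (auto simp: ymul_def dy_def ac_simps dest!: multi_member_split)
  then show ?thesis by (simp add: gl_act_def sum_distrib_left ac_simps)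
qed

lemma gl_act_weyl_mult:
  "gl_act G (weyl_mult a b) m = weyl_mult (gl_act G a) b m + weyl_mult a (gl_act G b) m"
proof -
  have 1: "ymul i (dy l (weyl_mult a b)) m
      = weyl_mult (ymul i (dy l a)) b m + weyl_mult a (ymul i (dy l b)) m" for i l
  proof -
    have "ymul i (dy l (weyl_mult a b)) m
      = ymul i (\<lambda>m. weyl_mult (dy l a) b m + weyl_mult a (dy l b) m) m"
      by (rule ymul_cong) (rule dy_weyl_mult)
    also have "\<dots> = ymul i (weyl_mult (dy l a) b) m + ymul i (weyl_mult (dy l b) a) m"
      by (simp add: ymul_def weyl_mult_commute[of a])
    finally show ?thesis
      by (simp add: weyl_mult_commute[of a] flip: weyl_mult_ymul_left)
  qed
  have 2: "weyl_mult (gl_act G a) b m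
      = (\<Sum>l\<in>UNIV. \<Sum>i\<in>UNIV. fps_const (G l i) * weyl_mult (ymul i (dy l a)) b m)" for a b
    by (simp add: gl_act_def[abs_def] weyl_mult_sum_left weyl_mult_smult_left)
  show ?thesis
    unfolding weyl_mult_commute[of a "gl_act G b"] 2 unfolding gl_act_def 1
    by (simp add: distrib_left sum.distrib weyl_mult_commute[of a])
qed

lemma dy_gl_act: "dy p (gl_act G a) m = gl_act G (dy p a) m + (\<Sum>l\<in>UNIV. fps_const (G l p) * dy l a m)"
proof -
  have "dy p (gl_act G a) m = (\<Sum>l\<in>UNIV. \<Sum>i\<in>UNIV. fps_const (G l i) * dy p (ymul i (dy l a)) m)"
    by (simp add: gl_act_def[abs_def] dy_sum dy_smult)
  also have "\<dots> = (\<Sum>l\<in>UNIV. \<Sum>i\<in>UNIV. (if p = i then fps_const (G l i) * dy l a m else 0)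
      + fps_const (G l i) * ymul i (dy l (dy p a)) m)"
    unfolding dy_ymul dy_commute[of p] by (intro sum.cong refl) (simp add: distrib_left)
  finally show ?thesis by (simp add: sum.distrib gl_act_def)
qed

lemma gl_act_ymul: "gl_act G (ymul k a) m = ymul k (gl_act G a) m + (\<Sum>i\<in>UNIV. fps_const (G k i) * ymul i a m)"
proof -
  have "ymul i (dy l (ymul k a)) m = (if l = k then ymul i a m else 0) + ymul k (ymul i (dy l a)) m" for i l
  proof -
    have "ymul i (dy l (ymul k a)) m = ymul i (\<lambda>m. (if l = k then a m else 0) + ymul k (dy l a) m) m"
      by (rule ymul_cong) (rule dy_ymul)
    then show ?thesis by (simp add: ymul_add ymul_commute[of k]) (simp add: ymul_def)
  qed
  then have "gl_act G (ymul k a) m = (\<Sum>l\<in>UNIV. \<Sum>i\<in>UNIV. (if l = k then fps_const (G l i) * ymul i a m else 0)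
      + fps_const (G l i) * ymul k (ymul i (dy l a)) m)"
    unfolding gl_act_def by (intro sum.cong refl) (simp add: distrib_left)
  also have "\<dots> = (\<Sum>l\<in>UNIV. \<Sum>i\<in>UNIV. if l = k then fps_const (G l i) * ymul i a m else 0)
      + ymul k (gl_act G a) m"
    by (simp only: sum.distrib) (simp add: gl_act_def[abs_def] ymul_sum ymul_smult)
  also have "(\<Sum>l\<in>UNIV. \<Sum>i\<in>UNIV. if l = k then fps_const (G l i) * ymul i a m else 0)
      = (\<Sum>l\<in>UNIV. if l = k then (\<Sum>i\<in>UNIV. fps_const (G l i) * ymul i a m) else 0)"
    by (rule sum.cong[OF refl]) auto
  finally show ?thesis by (simp add: add.commute)
qed

text \<open>The derivation \<open>L\<close> is the effect of an infinitesimal change of frame with matrix \<open>G\<close> on the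
  components of tensors: \<open>wbar\<close> transforms as a contravariant tensor, and \<open>L_d\<close> says that the
  derivations \<open>d k\<close> transform like the components of a covariant vector.\<close>

locale lie_derivative = derivation L for L :: "'a::comm_ring_1 \<Rightarrow> 'a" +
  fixes \<iota> :: "complex \<Rightarrow> 'a" and G :: "'n::finite \<Rightarrow> 'n \<Rightarrow> 'a"
    and wbar :: "'n \<Rightarrow> 'n \<Rightarrow> 'a fps" and d :: "'n \<Rightarrow> 'a \<Rightarrow> 'a"
  assumes scalar: "L (\<iota> z) = 0"
    and wbar: "fps_map L (wbar i j)
      = - (\<Sum>l\<in>UNIV. fps_const (G i l) * wbar l j + fps_const (G j l) * wbar i l)"
    and d_additive: "Modules.additive (d k)"
    and d_G: "d k (G l i * x) = G l i * d k x"
    and L_d: "L (d k x) = d k (L x) + (\<Sum>l\<in>UNIV. G l k * d l x)"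
begin

sublocale fps: derivation "fps_map L"
  by (rule derivation_fps_map) unfold_locales

lemma L_scalar_mult: "L c = 0 \<Longrightarrow> L (c * x) = c * L x"
  by (simp add: leibniz)

lemma L_power: "L c = 0 \<Longrightarrow> L (c ^ n) = 0"
proof (induction n)
  case 0
  have "L (1 * 1) = L 1 + L 1" by (subst leibniz) simp
  then show ?case by simp
qed (simp add: leibniz)

text \<open>The total variation of a section of the Weyl bundle: the variation of its coefficients minus that of
  the monomials in \<open>y\<close>. It vanishes on invariant sections.\<close>

definition Lam :: "('n, 'a) weyl \<Rightarrow> ('n, 'a) weyl" where
  "Lam a m = fps_map L (a m) - gl_act G a m"

lemma Lam_add: "Lam (\<lambda>m. a m + b m) m = Lam a m + Lam b m"
  by (simp add: Lam_def fps.add gl_act_add)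

lemma Lam_smult: "Lam (\<lambda>m. s * a m) m = fps_map L s * a m + s * Lam a m"
  by (simp add: Lam_def fps.leibniz gl_act_smult algebra_simps)

lemma Lam_zero: "Lam (\<lambda>m. 0) m = 0"
  using Lam_add[of "\<lambda>m. 0" "\<lambda>m. 0" m] by simp

lemma Lam_diff: "Lam (\<lambda>m. a m - b m) m = Lam a m - Lam b m"
  using Lam_add[of "\<lambda>m. a m - b m" b m] by simp

lemma Lam_sum: "finite A \<Longrightarrow> Lam (\<lambda>m. \<Sum>l\<in>A. a l m) m = (\<Sum>l\<in>A. Lam (a l) m)"
  by (induction A rule: finite_induct) (simp_all add: Lam_zero Lam_add)

lemma Lam_weyl_mult: "Lam (weyl_mult a b) m = weyl_mult (Lam a) b m + weyl_mult a (Lam b) m"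
proof -
  have "fps_map L (weyl_mult a b m) = weyl_mult (\<lambda>m. fps_map L (a m)) b m + weyl_mult a (\<lambda>m. fps_map L (b m)) m"
    by (simp add: weyl_mult_def fps.sum fps.leibniz sum.distrib)
  then show ?thesis
    by (simp add: Lam_def[abs_def] gl_act_weyl_mult weyl_mult_diff_left weyl_mult_diff_right)
qed

lemma Lam_dy: "Lam (dy p a) = (\<lambda>m. dy p (Lam a) m + (\<Sum>l\<in>UNIV. fps_const (G l p) * dy l a m))"
proof
  fix m
  have "dy p (Lam a) m = dy p (\<lambda>m. fps_map L (a m)) m - dy p (gl_act G a) m"
    by (simp add: Lam_def[abs_def] dy_diff)
  then show "Lam (dy p a) m = dy p (Lam a) m + (\<Sum>l\<in>UNIV. fps_const (G l p) * dy l a m)"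
    unfolding dy_gl_act dy_fps_map[OF additive_axioms] by (simp add: Lam_def)
qed

text \<open>The total variation is a derivation of each term of the Moyal product, because the variation of
  \<open>wbar\<close> cancels the commutators of the total variation with the fibre derivatives. The cancellation
  takes place separately in the two indices of \<open>wbar\<close>.\<close>

lemma Lam_bidiff:
  "Lam (bidiff wbar n a b) m = bidiff wbar n (Lam a) b m + bidiff wbar n a (Lam b) m"
proof (induction n arbitrary: a b m)
  case 0
  show ?case by (simp add: Lam_weyl_mult)
next
  case (Suc n)
  define X where "X i j = bidiff wbar n (dy i a) (dy j b) m" for i j
  have left: "bidiff wbar n (Lam (dy i a)) (dy j b) m
      = bidiff wbar n (dy i (Lam a)) (dy j b) m + (\<Sum>l\<in>UNIV. fps_const (G l i) * X l j)" for i j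
    unfolding Lam_dy X_def by (simp add: bidiff_add_left bidiff_sum_left bidiff_smult_left)
  have right: "bidiff wbar n (dy i a) (Lam (dy j b)) m
      = bidiff wbar n (dy i a) (dy j (Lam b)) m + (\<Sum>l\<in>UNIV. fps_const (G l j) * X i l)" for i j
    unfolding Lam_dy X_def by (simp add: bidiff_add_right bidiff_sum_right bidiff_smult_right)
  have cancel1: "(\<Sum>i\<in>UNIV. \<Sum>j\<in>UNIV. \<Sum>l\<in>UNIV. fps_const (G i l) * wbar l j * X i j)
      = (\<Sum>i\<in>UNIV. \<Sum>j\<in>UNIV. \<Sum>l\<in>UNIV. wbar i j * (fps_const (G l i) * X l j))"
  proof -
    have "(\<Sum>i\<in>UNIV. \<Sum>j\<in>UNIV. \<Sum>l\<in>UNIV. fps_const (G i l) * wbar l j * X i j)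
      = (\<Sum>j\<in>UNIV. \<Sum>i\<in>UNIV. \<Sum>l\<in>UNIV. wbar l j * (fps_const (G i l) * X i j))"
      by (subst sum.swap) (simp add: ac_simps)
    also have "\<dots> = (\<Sum>j\<in>UNIV. \<Sum>l\<in>UNIV. \<Sum>i\<in>UNIV. wbar l j * (fps_const (G i l) * X i j))"
      by (rule sum.cong[OF refl], rule sum.swap)
    also have "\<dots> = (\<Sum>l\<in>UNIV. \<Sum>j\<in>UNIV. \<Sum>i\<in>UNIV. wbar l j * (fps_const (G i l) * X i j))"
      by (rule sum.swap)
    finally show ?thesis .
  qed
  have cancel2: "(\<Sum>i\<in>UNIV. \<Sum>j\<in>UNIV. \<Sum>l\<in>UNIV. fps_const (G j l) * wbar i l * X i j)
      = (\<Sum>i\<in>UNIV. \<Sum>j\<in>UNIV. \<Sum>l\<in>UNIV. wbar i j * (fps_const (G l j) * X i l))"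
    by (rule sum.cong[OF refl], subst sum.swap) (simp add: ac_simps)
  have "Lam (bidiff wbar (Suc n) a b) m = (\<Sum>i\<in>UNIV. \<Sum>j\<in>UNIV. fps_map L (wbar i j) * X i j
      + wbar i j * (bidiff wbar n (Lam (dy i a)) (dy j b) m + bidiff wbar n (dy i a) (Lam (dy j b)) m))"
    by (simp add: Lam_sum Lam_smult Suc.IH X_def)
  also have "\<dots> = (\<Sum>i\<in>UNIV. \<Sum>j\<in>UNIV.
        - (\<Sum>l\<in>UNIV. fps_const (G i l) * wbar l j * X i j)
        - (\<Sum>l\<in>UNIV. fps_const (G j l) * wbar i l * X i j)
        + (\<Sum>l\<in>UNIV. wbar i j * (fps_const (G l i) * X l j))
        + (\<Sum>l\<in>UNIV. wbar i j * (fps_const (G l j) * X i l))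
        + (wbar i j * bidiff wbar n (dy i (Lam a)) (dy j b) m
        + wbar i j * bidiff wbar n (dy i a) (dy j (Lam b)) m))"
    unfolding left right wbar
    by (intro sum.cong refl)
      (simp add: sum.distrib distrib_left distrib_right left_diff_distrib sum_distrib_left sum_distrib_right)
  also have "\<dots> = bidiff wbar (Suc n) (Lam a) b m + bidiff wbar (Suc n) a (Lam b) m"
    by (simp add: sum.distrib sum_subtractf sum_negf cancel1 cancel2)
  finally show ?case .
qed

lemma gl_act_nth_cong:
  assumes "\<And>m. fps_nth (a m) h = fps_nth (b m) h'"
  shows "fps_nth (gl_act G a m) h = fps_nth (gl_act G b m) h'"
  by (simp add: gl_act_def fps_sum_nth ymul_nth dy_nth assms cong: if_cong)

lemma Lam_nth_cong:
  assumes "\<And>m. fps_nth (a m) h = fps_nth (b m) h'"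
  shows "fps_nth (Lam a m) h = fps_nth (Lam b m) h'"
  by (simp add: Lam_def assms gl_act_nth_cong[of a h b h', OF assms])

lemma Lam_fps_const_mult: "L c = 0 \<Longrightarrow> Lam (\<lambda>m. fps_const c * a m) m = fps_const c * Lam a m"
  by (simp add: Lam_smult fps_map_const[OF additive_axioms])

lemma Lam_circ: "Lam (circ \<iota> wbar a b) m = circ \<iota> wbar (Lam a) b m + circ \<iota> wbar a (Lam b) m"
proof (rule fps_ext)
  fix h
  let ?c = "\<lambda>n. \<iota> (- \<i> / 2) ^ n * \<iota> (1 / fact n)"
  have c: "L (?c n) = 0" for n by (simp add: leibniz L_power scalar)
  \<comment> \<open>Up to the order \<open>h\<close> in \<open>\<hbar>\<close> the product is a finite sum, on which \<open>Lam\<close> acts termwise.\<close>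
  let ?S = "\<lambda>m. \<Sum>n\<le>h. fps_const (?c n) * (fps_X ^ n * bidiff wbar n a b m)"
  have X: "fps_map L (fps_X ^ n) = 0" for n
  proof (rule fps_ext)
    show "fps_nth (fps_map L (fps_X ^ n)) k = fps_nth 0 k" for k
      using L_power[of 0 0] by (simp add: zero)
  qed
  have "fps_nth (Lam (circ \<iota> wbar a b) m) h = fps_nth (Lam ?S m) h"
    by (rule Lam_nth_cong) (simp add: circ_nth fps_sum_nth fps_X_power_mult_nth)
  also have "Lam ?S m = (\<Sum>n\<le>h. fps_const (?c n) * (fps_X ^ n * Lam (bidiff wbar n a b) m))"
    by (simp only: Lam_sum[OF finite_atMost] Lam_fps_const_mult[OF c] Lam_smult[of "fps_X ^ n" for n] X) simp
  also have "fps_nth \<dots> h = fps_nth (circ \<iota> wbar (Lam a) b m + circ \<iota> wbar a (Lam b) m) h"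
    by (simp add: circ_nth fps_sum_nth fps_X_power_mult_nth Lam_bidiff distrib_left sum.distrib)
  finally show "fps_nth (Lam (circ \<iota> wbar a b) m) h
    = fps_nth (circ \<iota> wbar (Lam a) b m + circ \<iota> wbar a (Lam b) m) h" .
qed

lemma Lam_ymul: "Lam (ymul k a) m = ymul k (Lam a) m - (\<Sum>i\<in>UNIV. fps_const (G k i) * ymul i a m)"
proof -
  have "ymul k (Lam a) m = fps_map L (ymul k a m) - ymul k (gl_act G a) m"
    by (simp add: Lam_def[abs_def] ymul_diff ymul_fps_map[OF additive_axioms])
  then show ?thesis by (simp add: Lam_def gl_act_ymul)
qed

lemma Lam_i_over_hbar: "Lam (\<lambda>m. i_over_hbar \<iota> (a m)) m = i_over_hbar \<iota> (Lam a m)"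
proof (rule fps_ext)
  fix h
  have "fps_nth (Lam (\<lambda>m. i_over_hbar \<iota> (a m)) m) h = fps_nth (Lam (\<lambda>m. fps_const (\<iota> \<i>) * a m) m) (h + 1)"
    by (rule Lam_nth_cong) (simp add: i_over_hbar_def)
  also have "\<dots> = fps_nth (i_over_hbar \<iota> (Lam a m)) h"
    by (simp add: Lam_fps_const_mult scalar i_over_hbar_def)
  finally show "fps_nth (Lam (\<lambda>m. i_over_hbar \<iota> (a m)) m) h = fps_nth (i_over_hbar \<iota> (Lam a m)) h" .
qed

lemma Lam_size:
  assumes "\<And>p. L (c p) = 0"
  shows "Lam (\<lambda>m. fps_const (c (size m)) * a m) m = fps_const (c (size m)) * Lam a m"
  using gl_act_size[of G "\<lambda>p. fps_const (c p)" a m] assms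
  by (simp add: Lam_def fps.leibniz fps_map_const[OF additive_axioms] right_diff_distrib)

lemma Lam_d: "Lam (\<lambda>m. fps_map (d k) (a m)) m
    = fps_map (d k) (Lam a m) + (\<Sum>l\<in>UNIV. fps_const (G l k) * fps_map (d l) (a m))"
proof -
  have "gl_act G (\<lambda>m. fps_map (d k) (a m)) m = fps_map (d k) (gl_act G a m)"
  proof -
    interpret D: Modules.additive "fps_map (d k)" by (rule additive_fps_map) (rule d_additive)
    have "fps_map (d k) (fps_const (G l i) * s) = fps_const (G l i) * fps_map (d k) s" for l i s
      by (simp add: fps_eq_iff d_G)
    then show ?thesis
      by (simp add: gl_act_def D.sum dy_fps_map[OF d_additive] ymul_fps_map[OF d_additive])
  qed
  moreover have "fps_map L (fps_map (d k) s) = fps_map (d k) (fps_map L s)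
      + (\<Sum>l\<in>UNIV. fps_const (G l k) * fps_map (d l) s)" for s
    by (simp add: fps_eq_iff fps_sum_nth L_d)
  moreover have "fps_map (d k) (s - t) = fps_map (d k) s - fps_map (d k) t" for s t
    by (rule Modules.additive.diff[OF additive_fps_map[OF d_additive]])
  ultimately show ?thesis by (simp add: Lam_def)
qed

text \<open>Sections and forms with values in the Weyl bundle that transform correctly under changes of frame,
  with no, one and two form indices.\<close>

definition tensor0 :: "('n, 'a) weyl \<Rightarrow> bool" where
  "tensor0 a \<longleftrightarrow> (\<forall>m. Lam a m = 0)"

definition tensor1 :: "('n \<Rightarrow> ('n, 'a) weyl) \<Rightarrow> bool" where
  "tensor1 a \<longleftrightarrow> (\<forall>k m. Lam (a k) m = (\<Sum>p\<in>UNIV. fps_const (G p k) * a p m))"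

definition tensor2 :: "('n \<Rightarrow> 'n \<Rightarrow> ('n, 'a) weyl) \<Rightarrow> bool" where
  "tensor2 a \<longleftrightarrow> (\<forall>k l m. Lam (a k l) m =
     (\<Sum>p\<in>UNIV. fps_const (G p k) * a p l m) + (\<Sum>p\<in>UNIV. fps_const (G p l) * a k p m))"

lemma tensor1_add: "tensor1 a \<Longrightarrow> tensor1 b \<Longrightarrow> tensor1 (\<lambda>k m. a k m + b k m)"
  by (simp add: tensor1_def Lam_add distrib_left sum.distrib)

lemma tensor2_add: "tensor2 a \<Longrightarrow> tensor2 b \<Longrightarrow> tensor2 (\<lambda>k l m. a k l m + b k l m)"
  by (simp add: tensor2_def Lam_add distrib_left sum.distrib)

lemma tensor2_wedge2: "tensor2 a \<Longrightarrow> tensor2 (wedge2 a)"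
  by (simp add: tensor2_def wedge2_def[abs_def] Lam_diff right_diff_distrib sum_subtractf)

lemma i_over_hbar_add: "i_over_hbar \<iota> (s + t) = i_over_hbar \<iota> s + i_over_hbar \<iota> t"
  by (simp add: fps_eq_iff i_over_hbar_def distrib_left)

lemma i_over_hbar_sum_smult:
  "i_over_hbar \<iota> (\<Sum>p\<in>A. fps_const (c p) * s p) = (\<Sum>p\<in>A. fps_const (c p) * i_over_hbar \<iota> (s p))"
  by (simp add: fps_eq_iff i_over_hbar_def fps_sum_nth sum_distrib_left ac_simps)

lemma tensor1_i_over_hbar: "tensor1 a \<Longrightarrow> tensor1 (\<lambda>k m. i_over_hbar \<iota> (a k m))"
  by (simp add: tensor1_def Lam_i_over_hbar i_over_hbar_sum_smult)

lemma tensor2_i_over_hbar: "tensor2 a \<Longrightarrow> tensor2 (\<lambda>k l m. i_over_hbar \<iota> (a k l m))"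
  by (simp add: tensor2_def Lam_i_over_hbar i_over_hbar_add i_over_hbar_sum_smult)

lemma tensor1_d: "tensor0 a \<Longrightarrow> tensor1 (\<lambda>k m. fps_map (d k) (a m))"
  by (simp add: tensor0_def tensor1_def Lam_d Modules.additive.zero[OF additive_fps_map[OF d_additive]])

lemma tensor2_d: 
  assumes "tensor1 r"
  shows "tensor2 (\<lambda>k l m. fps_map (d k) (r l m))"
proof -
  have "fps_map (d k) (\<Sum>p\<in>UNIV. fps_const (G p l) * r p m) = (\<Sum>p\<in>UNIV. fps_const (G p l) * fps_map (d k) (r p m))" for k l m
  proof -
    interpret D: Modules.additive "fps_map (d k)" by (rule additive_fps_map) (rule d_additive)
    have "fps_map (d k) (fps_const (G l i) * s) = fps_const (G l i) * fps_map (d k) s" for l i s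
      by (simp add: fps_eq_iff d_G)
    then show ?thesis by (simp add: D.sum)
  qed
  then show ?thesis using assms by (simp add: tensor1_def tensor2_def Lam_d)
qed

lemma tensor2_circ:
  assumes "tensor1 a" "tensor1 b"
  shows "tensor2 (\<lambda>k l. circ \<iota> wbar (a k) (b l))"
proof -
  have "Lam (a k) = (\<lambda>m. \<Sum>p\<in>UNIV. fps_const (G p k) * a p m)"
    "Lam (b k) = (\<lambda>m. \<Sum>p\<in>UNIV. fps_const (G p k) * b p m)" for k
    using assms by (auto simp: tensor1_def)
  then show ?thesis
    by (simp add: tensor2_def Lam_circ circ_sum_left circ_sum_right circ_smult_const_left circ_smult_const_right)
qed

lemma tensor1_commutator:
  assumes "tensor1 r" "tensor0 a"
  shows "tensor1 (\<lambda>k m. circ \<iota> wbar (r k) a m - circ \<iota> wbar a (r k) m)"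
proof -
  have "Lam (r k) = (\<lambda>m. \<Sum>p\<in>UNIV. fps_const (G p k) * r p m)" "Lam a = (\<lambda>m. 0)" for k
    using assms by (auto simp: tensor1_def tensor0_def)
  then show ?thesis
    by (simp add: tensor1_def Lam_diff Lam_circ circ_sum_left circ_sum_right circ_smult_const_left
      circ_smult_const_right circ_zero_left circ_zero_right sum_subtractf right_diff_distrib)
qed

text \<open>Contracting a form index with \<open>y\<close> removes it from the transformation law; \<open>e\<close> collects the
  contributions of the other indices.\<close>

lemma Lam_ymul_contract:
  assumes "\<And>k m. Lam (a k) m = (\<Sum>p\<in>UNIV. fps_const (G p k) * a p m) + e k m"
  shows "(\<Sum>k\<in>UNIV. Lam (ymul k (a k)) m) = (\<Sum>k\<in>UNIV. ymul k (e k) m)"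
proof -
  have "ymul k (Lam (a k)) m = (\<Sum>p\<in>UNIV. fps_const (G p k) * ymul k (a p) m) + ymul k (e k) m" for k
    by (simp add: assms[abs_def] ymul_def)
  moreover have "(\<Sum>k\<in>UNIV. \<Sum>p\<in>UNIV. fps_const (G p k) * ymul k (a p) m)
      = (\<Sum>k\<in>UNIV. \<Sum>p\<in>UNIV. fps_const (G k p) * ymul p (a k) m)"
    by (rule sum.swap)
  ultimately show ?thesis by (simp add: Lam_ymul sum_subtractf sum.distrib)
qed

lemma tensor0_delta_inv1: "tensor1 a \<Longrightarrow> tensor0 (delta_inv1 \<iota> a)"
  using Lam_ymul_contract[of a "\<lambda>_ _. 0"]
  by (simp add: tensor0_def tensor1_def delta_inv1_ymul[abs_def] Lam_size[of "\<lambda>p. \<iota> (1 / of_nat p)"]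
    scalar Lam_sum ymul_def[of _ "\<lambda>_. 0"])

lemma tensor1_delta_inv2:
  assumes "tensor2 a"
  shows "tensor1 (delta_inv2 \<iota> a)"
proof -
  have "Lam (delta_inv2 \<iota> a j) m = (\<Sum>p\<in>UNIV. fps_const (G p j) * delta_inv2 \<iota> a p m)" for j m
  proof -
    have "(\<Sum>k\<in>UNIV. Lam (ymul k (a k j)) m)
        = (\<Sum>k\<in>UNIV. ymul k (\<lambda>m. \<Sum>p\<in>UNIV. fps_const (G p j) * a k p m) m)"
      by (rule Lam_ymul_contract) (use assms in \<open>simp add: tensor2_def\<close>)
    also have "\<dots> = (\<Sum>p\<in>UNIV. fps_const (G p j) * (\<Sum>k\<in>UNIV. ymul k (a k p) m))"
      unfolding sum_distrib_left by (subst sum.swap) (simp add: ymul_sum ymul_smult)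
    finally have "(\<Sum>k\<in>UNIV. Lam (ymul k (a k j)) m)
        = (\<Sum>p\<in>UNIV. fps_const (G p j) * (\<Sum>k\<in>UNIV. ymul k (a k p) m))" .
    moreover have "Lam (delta_inv2 \<iota> a j) m
        = fps_const (\<iota> (1 / of_nat (size m + 1))) * (\<Sum>k\<in>UNIV. Lam (ymul k (a k j)) m)"
      unfolding delta_inv2_ymul[abs_def] Lam_sum[OF finite, symmetric] by (rule Lam_size) (rule scalar)
    ultimately show ?thesis
      by (simp only: delta_inv2_ymul) (simp add: sum_distrib_left mult.left_commute)
  qed
  then show ?thesis by (simp add: tensor1_def)
qed

lemma tensor1_r_rhs:
  assumes "tensor2 F" "tensor1 r"
  shows "tensor1 (r_rhs \<iota> wbar F (\<lambda>k l m. fps_map (d k) (r l m)) r)"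
  unfolding r_rhs_def[abs_def]
  by (intro tensor1_add tensor1_delta_inv2 tensor2_add tensor2_wedge2 tensor2_d tensor2_i_over_hbar
    tensor2_circ assms)

lemma tensor1_zero: "tensor1 (\<lambda>_ _. 0)"
  by (simp add: tensor1_def Lam_zero)

lemma tensor1_r_iter: "tensor2 F \<Longrightarrow> tensor1 (r_iter \<iota> wbar F d N)"
  by (induction N) (simp_all add: r_iter_0 r_iter_Suc tensor1_zero tensor1_r_rhs)

text \<open>The total variation preserves the degrees in \<open>\<hbar>\<close> and in \<open>y\<close>. For this reason the transformation
  law passes from the iterates to the solution that is assembled from them.\<close>

lemma Lam_nth_cong_size:
  assumes "\<And>m'. size m' = size m \<Longrightarrow> fps_nth (a m') h = fps_nth (b m') h"
  shows "fps_nth (Lam a m) h = fps_nth (Lam b m) h"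
proof -
  have "fps_nth (ymul i (dy l a) m) h = fps_nth (ymul i (dy l b) m) h" for i l
    by (auto simp: ymul_nth dy_nth assms dest!: multi_member_split)
  then show ?thesis by (simp add: Lam_def assms gl_act_def fps_sum_nth)
qed

lemma tensor1_r_solution:
  assumes "tensor2 F"
  shows "tensor1 (r_solution \<iota> wbar F d)"
  unfolding tensor1_def
proof (intro allI fps_ext)
  fix k :: 'n and m :: "'n multiset" and h
  let ?N = "2 * h + size m"
  have "fps_nth (Lam (r_solution \<iota> wbar F d k) m) h = fps_nth (Lam (r_iter \<iota> wbar F d ?N k) m) h"
    by (rule Lam_nth_cong_size) (simp add: r_solution_def)
  also have "\<dots> = fps_nth (\<Sum>p\<in>UNIV. fps_const (G p k) * r_iter \<iota> wbar F d ?N p m) h"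
    using tensor1_r_iter[OF assms, of ?N] by (simp add: tensor1_def)
  also have "\<dots> = fps_nth (\<Sum>p\<in>UNIV. fps_const (G p k) * r_solution \<iota> wbar F d p m) h"
    by (simp add: r_solution_def fps_sum_nth)
  finally show "fps_nth (Lam (r_solution \<iota> wbar F d k) m) h
    = fps_nth (\<Sum>p\<in>UNIV. fps_const (G p k) * r_solution \<iota> wbar F d p m) h" .
qed

lemma tensor0_lift_rhs:
  assumes "tensor1 r" "L f = 0" "tensor0 a"
  shows "tensor0 (lift_rhs \<iota> wbar r f (\<lambda>k m. fps_map (d k) (a m)) a)"
proof -
  have "tensor0 (delta_inv1 \<iota> (\<lambda>k m. fps_map (d k) (a m)
        + i_over_hbar \<iota> (circ \<iota> wbar (r k) a m - circ \<iota> wbar a (r k) m)))"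
    using assms by (intro tensor0_delta_inv1 tensor1_add tensor1_d tensor1_i_over_hbar tensor1_commutator)
  moreover have "Lam (\<lambda>m. if m = {#} then fps_const f else 0) m = 0" for m :: "'n multiset"
  proof -
    have "ymul i (dy l (\<lambda>m. if m = {#} then fps_const f else 0)) m = 0" for i l
      by (simp add: ymul_def dy_def)
    then show ?thesis
      using assms(2) by (simp add: Lam_def gl_act_def fps_map_const[OF additive_axioms] fps.zero)
  qed
  ultimately show ?thesis
    unfolding tensor0_def lift_rhs_def[abs_def] Lam_add by simp
qed

lemma tensor0_lift_iter:
  assumes "tensor1 r" "L f = 0"
  shows "tensor0 (lift_iter \<iota> wbar r d f N)"
  by (induction N) (simp_all add: lift_iter_0 lift_iter_Suc tensor0_lift_rhs assms,
    simp add: tensor0_def Lam_zero)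

end

section \<open>Partial derivatives and smooth functions\<close>

lemma pd_eqI: "(u has_derivative u') (at x) \<Longrightarrow> pd i u x = u' (axis i 1)"
  by (simp add: pd_def frechet_derivative_at[symmetric])

lemma pd_cong_open:
  assumes "open S" "x \<in> S" "\<And>y. y \<in> S \<Longrightarrow> u y = v y"
  shows "pd i u x = pd i v x"
proof -
  have "(u has_derivative D) (at x) \<longleftrightarrow> (v has_derivative D) (at x)" for D
    using has_derivative_transform_within_open[OF _ assms(1,2), of u D UNIV v]
      has_derivative_transform_within_open[OF _ assms(1,2), of v D UNIV u] assms(3) by auto
  then show ?thesis by (simp add: pd_def frechet_derivative_def)
qed

lemma pd_add:
  "u differentiable at x \<Longrightarrow> v differentiable at x \<Longrightarrow> pd i (\<lambda>x. u x + v x) x = pd i u x + pd i v x"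
  by (rule trans[OF pd_eqI[OF has_derivative_add]], rule frechet_derivative_works[THEN iffD1], assumption,
    rule frechet_derivative_works[THEN iffD1], assumption) (simp add: pd_def)

lemma pd_mult:
  fixes u v :: "real^'n::finite \<Rightarrow> 'b::real_normed_algebra"
  shows "u differentiable at x \<Longrightarrow> v differentiable at x \<Longrightarrow>
    pd i (\<lambda>x. u x * v x) x = pd i u x * v x + u x * pd i v x"
  by (rule trans[OF pd_eqI[OF has_derivative_mult]], rule frechet_derivative_works[THEN iffD1], assumption,
    rule frechet_derivative_works[THEN iffD1], assumption) (simp add: pd_def)

lemma pd_const [simp]: "pd i (\<lambda>x. c) x = 0"
  by (rule pd_eqI[OF has_derivative_const])

lemma pd_bounded_linear:
  assumes "bounded_linear L" "u differentiable at x"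
  shows "pd i (\<lambda>x. L (u x)) x = L (pd i u x)"
  using pd_eqI[OF bounded_linear.has_derivative[OF assms(1) frechet_derivative_works[THEN iffD1, OF assms(2)]]]
  by (simp add: pd_def)

lemma pd_sum:
  assumes "finite A" "\<And>l. l \<in> A \<Longrightarrow> u l differentiable at x"
  shows "pd i (\<lambda>x. \<Sum>l\<in>A. u l x) x = (\<Sum>l\<in>A. pd i (u l) x)"
  using assms by (induction A rule: finite_induct) (simp_all add: pd_add)

lemma differentiable_of_bounded_linear:
  "bounded_linear L \<Longrightarrow> u differentiable at x \<Longrightarrow> (\<lambda>x. L (u x)) differentiable at x"
  using bounded_linear.has_derivative unfolding differentiable_def by blast

lemma differentiable_transform_open:
  assumes "v differentiable at x" "open S" "x \<in> S" "\<And>y. y \<in> S \<Longrightarrow> v y = w y"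
  shows "w differentiable at x"
proof -
  obtain D where "(v has_derivative D) (at x)" using assms(1) by (auto simp: differentiable_def)
  from has_derivative_transform_within_open[OF this assms(2-4)] show ?thesis
    by (auto simp: differentiable_def)
qed

text \<open>Smoothness asks for all iterated derivatives. A class of differentiable functions consists of smooth
  functions if it contains, up to equality on the open set, the partial derivatives of its members.\<close>

lemma smooth_on_coinduct:
  assumes S: "open S" and u: "P u"
    and diff: "\<And>u x. P u \<Longrightarrow> x \<in> S \<Longrightarrow> u differentiable at x"
    and step: "\<And>u k. P u \<Longrightarrow> \<exists>v. P v \<and> (\<forall>x\<in>S. pd k u x = v x)"
  shows "smooth_on S u"
proof -
  have "\<exists>v. P v \<and> (\<forall>x\<in>S. foldr pd I u x = v x)" for I
  proof (induction I)
    case Nil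
    show ?case using u by auto
  next
    case (Cons k I)
    then obtain v where v: "P v" "\<And>x. x \<in> S \<Longrightarrow> foldr pd I u x = v x" by auto
    obtain v' where v': "P v'" "\<And>x. x \<in> S \<Longrightarrow> pd k v x = v' x" using step[OF v(1)] by blast
    have "foldr pd (k # I) u x = v' x" if "x \<in> S" for x
      using pd_cong_open[OF S that v(2)] v'(2)[OF that] by simp
    then show ?case using v'(1) by blast
  qed
  moreover have "w differentiable_on S" if "P v" "\<forall>x\<in>S. w x = v x" for v w
    unfolding differentiable_on_eq_differentiable_at[OF S]
  proof
    fix x assume x: "x \<in> S"
    show "w differentiable at x"
      by (rule differentiable_transform_open[OF diff[OF that(1) x] S x]) (simp add: that(2))
  qed
  ultimately show ?thesis unfolding smooth_on_def by blast
qed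

lemma smooth_on_differentiable: "open S \<Longrightarrow> smooth_on S u \<Longrightarrow> x \<in> S \<Longrightarrow> u differentiable at x"
  unfolding smooth_on_def
  by (metis differentiable_on_eq_differentiable_at foldr.simps(1) id_apply)

lemma smooth_on_pd: "smooth_on S u \<Longrightarrow> smooth_on S (pd k u)"
  unfolding smooth_on_def
proof
  fix I assume *: "\<forall>I. foldr pd I u differentiable_on S"
  show "foldr pd I (pd k u) differentiable_on S" using *[rule_format, of "I @ [k]"] by simp
qed

text \<open>The iterated derivatives of a product are sums of products; closing the smooth functions under both
  operations gives a class to which coinduction applies, without an explicit Leibniz formula.\<close>

inductive smooth_algebra ::
  "(real^'n::finite) set \<Rightarrow> (real^'n \<Rightarrow> 'b::real_normed_algebra) \<Rightarrow> bool" for S where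
  base: "smooth_on S u \<Longrightarrow> smooth_algebra S u"
| add: "smooth_algebra S u \<Longrightarrow> smooth_algebra S v \<Longrightarrow> smooth_algebra S (\<lambda>x. u x + v x)"
| mult: "smooth_algebra S u \<Longrightarrow> smooth_algebra S v \<Longrightarrow> smooth_algebra S (\<lambda>x. u x * v x)"

lemma smooth_algebra_smooth_on:
  assumes S: "open S" and "smooth_algebra S u"
  shows "smooth_on S u"
  using S \<open>smooth_algebra S u\<close>
proof (rule smooth_on_coinduct)
  show diff: "u differentiable at x" if "smooth_algebra S u" "x \<in> S" for u :: "real^'a \<Rightarrow> 'b" and x
    using that(1)
  proof induction
    case (base u)
    then show ?case by (rule smooth_on_differentiable[OF S _ that(2)])
  qed (simp_all add: differentiable_mult)
  show "\<exists>v. smooth_algebra S v \<and> (\<forall>x\<in>S. pd k u x = v x)" if "smooth_algebra S u" for u :: "real^'a \<Rightarrow> 'b" and k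
    using that
  proof induction
    case (base u)
    show ?case
      by (rule exI[of _ "pd k u"]) (simp add: smooth_algebra.base[OF smooth_on_pd[OF base]])
  next
    case (add u v)
    obtain u' v' where *: "smooth_algebra S u'" "\<forall>x\<in>S. pd k u x = u' x"
      "smooth_algebra S v'" "\<forall>x\<in>S. pd k v x = v' x" using add.IH by blast
    have "smooth_algebra S (\<lambda>x. u' x + v' x)"
      by (rule smooth_algebra.add[OF *(1,3)])
    moreover have "pd k (\<lambda>x. u x + v x) x = u' x + v' x" if "x \<in> S" for x
      using pd_add[OF diff[OF add.hyps(1) that] diff[OF add.hyps(2) that]] *(2,4) that by simp
    ultimately show ?case by blast
  next
    case (mult u v)
    obtain u' v' where *: "smooth_algebra S u'" "\<forall>x\<in>S. pd k u x = u' x"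
      "smooth_algebra S v'" "\<forall>x\<in>S. pd k v x = v' x" using mult.IH by blast
    have "smooth_algebra S (\<lambda>x. u' x * v x + u x * v' x)"
      by (rule smooth_algebra.add[OF smooth_algebra.mult[OF *(1) mult.hyps(2)]
            smooth_algebra.mult[OF mult.hyps(1) *(3)]])
    moreover have "pd k (\<lambda>x. u x * v x) x = u' x * v x + u x * v' x" if "x \<in> S" for x
      using pd_mult[OF diff[OF mult.hyps(1) that] diff[OF mult.hyps(2) that]] *(2,4) that by simp
    ultimately show ?case by blast
  qed
qed

lemma smooth_on_add:
  fixes u v :: "real^'n::finite \<Rightarrow> 'b::real_normed_algebra"
  shows "open S \<Longrightarrow> smooth_on S u \<Longrightarrow> smooth_on S v \<Longrightarrow> smooth_on S (\<lambda>x. u x + v x)"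
  by (rule smooth_algebra_smooth_on[OF _ smooth_algebra.add[OF smooth_algebra.base smooth_algebra.base]])

lemma smooth_on_mult:
  fixes u v :: "real^'n::finite \<Rightarrow> 'b::real_normed_algebra"
  shows "open S \<Longrightarrow> smooth_on S u \<Longrightarrow> smooth_on S v \<Longrightarrow> smooth_on S (\<lambda>x. u x * v x)"
  by (rule smooth_algebra_smooth_on[OF _ smooth_algebra.mult[OF smooth_algebra.base smooth_algebra.base]])

lemma smooth_on_const: 
  assumes "open S"
  shows "smooth_on S (\<lambda>x. c)"
proof (rule smooth_on_coinduct[OF assms, where P = "\<lambda>u. \<exists>c. u = (\<lambda>x. c)"])
  show "\<exists>v. (\<exists>c. v = (\<lambda>x. c)) \<and> (\<forall>x\<in>S. pd k u x = v x)" if "\<exists>c. u = (\<lambda>x. c)" for u :: "real^'a \<Rightarrow> 'b" and k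
    using that by (intro exI[of _ "\<lambda>x. 0"]) auto
qed auto

lemma smooth_on_bounded_linear:
  assumes S: "open S" and L: "bounded_linear L" and u: "smooth_on S u"
  shows "smooth_on S (\<lambda>x. L (u x))"
proof (rule smooth_on_coinduct[OF S, where P = "\<lambda>v. \<exists>u. smooth_on S u \<and> v = (\<lambda>x. L (u x))"])
  show "\<exists>u'. smooth_on S u' \<and> (\<lambda>x. L (u x)) = (\<lambda>x. L (u' x))" using u by (intro exI[of _ u]) simp
next
  fix w x assume w: "\<exists>u. smooth_on S u \<and> w = (\<lambda>x. L (u x))" and x: "x \<in> S"
  then obtain u where u: "smooth_on S u" "w = (\<lambda>x. L (u x))" by auto
  show "w differentiable at x"
    unfolding u(2) by (rule differentiable_of_bounded_linear[OF L smooth_on_differentiable[OF S u(1) x]])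
next
  fix w k assume "\<exists>u. smooth_on S u \<and> w = (\<lambda>x. L (u x))"
  then obtain u where u: "smooth_on S u" "w = (\<lambda>x. L (u x))" by auto
  have "pd k w x = L (pd k u x)" if "x \<in> S" for x
    unfolding u(2) by (rule pd_bounded_linear[OF L smooth_on_differentiable[OF S u(1) that]])
  then show "\<exists>v. (\<exists>u. smooth_on S u \<and> v = (\<lambda>x. L (u x))) \<and> (\<forall>x\<in>S. pd k w x = v x)"
    using smooth_on_pd[OF u(1)] by (intro exI[of _ "\<lambda>x. L (pd k u x)"]) auto
qed

lemma smooth_on_minus:
  fixes u :: "real^'n::finite \<Rightarrow> 'b::real_normed_algebra"
  shows "open S \<Longrightarrow> smooth_on S u \<Longrightarrow> smooth_on S (\<lambda>x. - u x)"
  by (rule smooth_on_bounded_linear[OF _ bounded_linear_minus[OF bounded_linear_ident]])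

lemma smooth_on_diff:
  fixes u v :: "real^'n::finite \<Rightarrow> 'b::real_normed_algebra"
  shows "open S \<Longrightarrow> smooth_on S u \<Longrightarrow> smooth_on S v \<Longrightarrow> smooth_on S (\<lambda>x. u x - v x)"
  using smooth_on_add[of S u "\<lambda>x. - v x"] smooth_on_minus[of S v] by simp

lemma smooth_on_sum:
  fixes u :: "'l \<Rightarrow> real^'n::finite \<Rightarrow> 'b::real_normed_algebra"
  assumes "open S" "\<And>l. l \<in> A \<Longrightarrow> smooth_on S (u l)"
  shows "smooth_on S (\<lambda>x. \<Sum>l\<in>A. u l x)"
  using assms(2)
  by (induction A rule: infinite_finite_induct) (simp_all add: smooth_on_const smooth_on_add assms(1))

lemma smooth_on_of_real:
  "open S \<Longrightarrow> smooth_on S u \<Longrightarrow> smooth_on S (\<lambda>x. complex_of_real (u x))"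
  by (rule smooth_on_bounded_linear[OF _ bounded_linear_of_real])

lemma smooth_on_covd:
  assumes S: "open S" and \<Gamma>: "\<And>k i j. smooth_on S (\<lambda>x. \<Gamma> x k i j)" and T: "\<And>J. smooth_on S (\<lambda>x. T x J)"
  shows "smooth_on S (\<lambda>x. covd \<Gamma> T x J)"
proof (cases J)
  case Nil
  then show ?thesis by (simp add: smooth_on_const S)
next
  case (Cons k J')
  show ?thesis
    unfolding Cons covd.simps
    by (intro smooth_on_diff smooth_on_pd smooth_on_sum smooth_on_mult smooth_on_of_real S \<Gamma> T)
qed

lemma smooth_on_covd_iter:
  assumes S: "open S" and \<Gamma>: "\<And>k i j. smooth_on S (\<lambda>x. \<Gamma> x k i j)" and T: "\<And>J. smooth_on S (\<lambda>x. T x J)"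
  shows "smooth_on S (\<lambda>x. (covd \<Gamma> ^^ n) T x J)"
  by (induction n arbitrary: J) (simp_all add: T smooth_on_covd[OF S \<Gamma>])

section \<open>Inverse matrices\<close>

lemma tensor_inverse_eqI:
  fixes A B :: "'n::finite \<Rightarrow> 'n \<Rightarrow> 'a::comm_ring_1"
  assumes AB: "\<And>i k. (\<Sum>j\<in>UNIV. A i j * B j k) = (if i = k then 1 else 0)"
    and BA: "\<And>i k. (\<Sum>j\<in>UNIV. B i j * A j k) = (if i = k then 1 else 0)"
  shows "tensor_inverse A = B"
  unfolding tensor_inverse_def
proof (rule the_equality)
  show "\<forall>i k. (\<Sum>j\<in>UNIV. A i j * B j k) = (if i = k then 1 else 0)" using AB by blast
  fix C assume C: "\<forall>i k. (\<Sum>j\<in>UNIV. A i j * C j k) = (if i = k then 1 else 0)"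
  show "C = B"
  proof (intro ext)
    fix i k
    have "(\<Sum>j\<in>UNIV. B i j * (\<Sum>l\<in>UNIV. A j l * C l k)) = B i k"
      by (simp add: C if_distrib cong: if_cong)
    moreover have "(\<Sum>j\<in>UNIV. B i j * (\<Sum>l\<in>UNIV. A j l * C l k))
        = (\<Sum>l\<in>UNIV. (\<Sum>j\<in>UNIV. B i j * A j l) * C l k)"
      unfolding sum_distrib_left sum_distrib_right by (subst sum.swap) (simp add: ac_simps)
    moreover have "\<dots> = C i k"
      by (simp add: BA if_distrib[of "\<lambda>x. x * _"] cong: if_cong)
    ultimately show "C i k = B i k" by simp
  qed
qed

lemma tensor_inverse_real:
  fixes A :: "'n::finite \<Rightarrow> 'n \<Rightarrow> real"
  assumes "invertible (\<chi> i j. A i j)"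
  shows "(\<Sum>j\<in>UNIV. A i j * tensor_inverse A j k) = (if i = k then 1 else 0)"
    and "(\<Sum>j\<in>UNIV. tensor_inverse A i j * A j k) = (if i = k then 1 else 0)"
proof -
  obtain B where B: "(\<chi> i j. A i j) ** B = mat 1" "B ** (\<chi> i j. A i j) = mat 1"
    using assms by (auto simp: invertible_def)
  have 1: "(\<Sum>j\<in>UNIV. A i j * B $ j $ k) = (if i = k then 1 else 0)" for i k
    using arg_cong[OF B(1), of "\<lambda>M. M $ i $ k"] by (simp add: matrix_matrix_mult_def mat_def)
  have 2: "(\<Sum>j\<in>UNIV. B $ i $ j * A j k) = (if i = k then 1 else 0)" for i k
    using arg_cong[OF B(2), of "\<lambda>M. M $ i $ k"] by (simp add: matrix_matrix_mult_def mat_def)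
  have "tensor_inverse A = (\<lambda>i j. B $ i $ j)" by (rule tensor_inverse_eqI[OF 1 2])
  then show "(\<Sum>j\<in>UNIV. A i j * tensor_inverse A j k) = (if i = k then 1 else 0)"
    and "(\<Sum>j\<in>UNIV. tensor_inverse A i j * A j k) = (if i = k then 1 else 0)"
    by (simp_all add: 1 2)
qed

lemma differentiable_prod:
  fixes u :: "'l \<Rightarrow> real^'n::finite \<Rightarrow> real"
  shows "finite A \<Longrightarrow> (\<And>l. l \<in> A \<Longrightarrow> u l differentiable at x) \<Longrightarrow> (\<lambda>x. \<Prod>l\<in>A. u l x) differentiable at x"
  by (induction A rule: finite_induct) simp_all

lemma differentiable_det:
  fixes A :: "real^'n::finite \<Rightarrow> 'k::finite \<Rightarrow> 'k \<Rightarrow> real"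
  assumes "\<And>i j. (\<lambda>x. A x i j) differentiable at x"
  shows "(\<lambda>x. det (\<chi> i j. A x i j)) differentiable at x"
  unfolding det_def using assms
  by (intro differentiable_sum ballI) (auto intro!: differentiable_mult differentiable_prod)

text \<open>By Cramer's rule the components of the inverse are quotients of determinants.\<close>

lemma differentiable_tensor_inverse:
  fixes A :: "real^'n::finite \<Rightarrow> 'k::finite \<Rightarrow> 'k \<Rightarrow> real"
  assumes S: "open S" "x \<in> S" and inv: "\<And>x. x \<in> S \<Longrightarrow> invertible (\<chi> i j. A x i j)"
    and A: "\<And>i j. (\<lambda>x. A x i j) differentiable at x"
  shows "(\<lambda>x. tensor_inverse (A x) i k) differentiable at x"
proof -
  \<comment> \<open>The \<open>i\<close>-th column is replaced by the \<open>k\<close>-th unit vector.\<close>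
  let ?M = "\<lambda>x a b. if b = i then (if a = k then 1 else 0) else A x a b"
  have quotient: "det (\<chi> a b. ?M y a b) / det (\<chi> a b. A y a b) = tensor_inverse (A y) i k" if "y \<in> S" for y
  proof -
    have mv: "(\<chi> a b. A y a b) *v (\<chi> j. tensor_inverse (A y) j k) = (\<chi> a. if a = k then 1 else 0)"
      using tensor_inverse_real(1)[OF inv[OF that]] by (simp add: matrix_vector_mult_def vec_eq_iff)
    have "det (\<chi> a b. A y a b) \<noteq> 0" using inv[OF that] by (simp add: invertible_det_nz)
    note e = iffD1[OF cramer[OF this] mv]
    from arg_cong[OF e, of "\<lambda>v. v $ i"] show ?thesis by (simp cong: if_cong)
  qed
  have "(\<lambda>x. ?M x a b) differentiable at x" for a b
    using A by (cases "b = i") simp_all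
  then have "(\<lambda>y. det (\<chi> a b. ?M y a b) / det (\<chi> a b. A y a b)) differentiable at x"
    using inv[OF S(2)]
    by (intro differentiable_divide differentiable_det A) (auto simp: invertible_det_nz)
  then show ?thesis
    by (rule differentiable_transform_open[OF _ S quotient])
qed

section \<open>Evaluation of the universal formulas in a chart\<close>

definition wconst :: "'a::comm_ring_1 fps \<Rightarrow> ('n, 'a) weyl" where
  "wconst s m = (if m = {#} then s else 0)"

lemma wconst_add: "wconst (s + t) m = wconst s m + wconst t m"
  by (simp add: wconst_def)

lemma wconst_sum: "wconst (\<Sum>l\<in>A. s l) m = (\<Sum>l\<in>A. wconst (s l) m)"
  by (simp add: wconst_def)

lemma wconst_mult: "wconst (s * t) m = s * wconst t m"
  by (simp add: wconst_def)

lemma ymul_ymul_wconst: "ymul i (ymul j (wconst s)) m = (if m = {#i, j#} then s else 0)"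
proof -
  have "i \<in># m \<and> j \<in># m - {#i#} \<and> m - {#i#} - {#j#} = {#} \<longleftrightarrow> m = {#i, j#}"
    by (auto dest!: multi_member_split) 
  then show ?thesis by (auto simp: ymul_def wconst_def)
qed

text \<open>Written through multiplication by coordinates, the curvature term is a double contraction with \<open>y\<close>,
  to which the lemma \<open>Lam_ymul_contract\<close> applies twice.\<close>

lemma source_form_ymul:
  "source_form \<iota> R A = wedge2 (\<lambda>k l m.
     (\<Sum>i\<in>UNIV. ymul i (\<lambda>m. \<Sum>j\<in>UNIV. ymul j (wconst (fps_const (\<iota> (1 / 4) * R i j k l))) m) m)
     + wconst (fps_const (\<iota> (1 / 2)) * A k l) m)"
  unfolding source_form_def ymul_sum ymul_ymul_wconst wconst_def ..

lemma deg_ge_source_form: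
  fixes B :: "'n::finite \<Rightarrow> 'n \<Rightarrow> 'a::comm_ring_1 fps"
  assumes "\<And>k l. fps_nth (B k l) 0 = 0"
  shows "deg_ge 2 (source_form \<iota> R B k l)"
proof (rule deg_geI)
  fix m :: "'n multiset" and h assume "int (2 * h + size m) < 2"
  then have h: "h = 0" and "size m < 2" by auto
  then have "m \<noteq> {#i, j#}" for i j by auto
  then show "fps_nth (source_form \<iota> R B k l m) h = 0"
    by (simp add: source_form_def wedge2_def h assms)
qed

context lie_derivative
begin

lemma Lam_wconst: "Lam (wconst s) m = wconst (fps_map L s) m"
proof -
  have "ymul i (dy l (wconst s)) m = 0" for i l
    by (simp add: ymul_def dy_def wconst_def)
  then show ?thesis by (simp add: Lam_def gl_act_def wconst_def fps.zero)
qed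

lemma tensor2_source_form:
  assumes R: "\<And>i j k l. L (R i j k l) = (\<Sum>p\<in>UNIV. G p i * R p j k l) + (\<Sum>p\<in>UNIV. G p j * R i p k l)
      + (\<Sum>p\<in>UNIV. G p k * R i j p l) + (\<Sum>p\<in>UNIV. G p l * R i j k p)"
    and A: "\<And>k l. fps_map L (A k l) = (\<Sum>p\<in>UNIV. fps_const (G p k) * A p l) + (\<Sum>p\<in>UNIV. fps_const (G p l) * A k p)"
  shows "tensor2 (source_form \<iota> R A)"
proof -
  define c where "c i j k l = fps_const (\<iota> (1 / 4) * R i j k l)" for i j k l
  define T where "T k l i = (\<lambda>m. \<Sum>j\<in>UNIV. ymul j (wconst (c i j k l)) m)" for i k l
  have Lc: "fps_map L (c i j k l) = (\<Sum>p\<in>UNIV. fps_const (G p j) * c i p k l)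
    + ((\<Sum>p\<in>UNIV. fps_const (G p i) * c p j k l)
    + (\<Sum>p\<in>UNIV. fps_const (G p k) * c i j p l) + (\<Sum>p\<in>UNIV. fps_const (G p l) * c i j k p))" for i j k l
    by (simp add: c_def fps_map_const[OF additive_axioms] L_scalar_mult scalar R fps_eq_iff fps_sum_nth
      distrib_left sum_distrib_left mult.left_commute add_ac)
  have LT: "Lam (T k l i) m = (\<Sum>p\<in>UNIV. fps_const (G p i) * T k l p m)
    + ((\<Sum>p\<in>UNIV. fps_const (G p k) * T p l i m) + (\<Sum>p\<in>UNIV. fps_const (G p l) * T k p i m))" for i k l m
  proof -
    have "Lam (T k l i) m = (\<Sum>j\<in>UNIV. ymul j (\<lambda>m. wconst ((\<Sum>p\<in>UNIV. fps_const (G p i) * c p j k l)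
      + (\<Sum>p\<in>UNIV. fps_const (G p k) * c i j p l) + (\<Sum>p\<in>UNIV. fps_const (G p l) * c i j k p)) m) m)"
      unfolding T_def Lam_sum[OF finite]
      by (rule Lam_ymul_contract) (simp add: Lam_wconst Lc wconst_add wconst_sum wconst_mult)
    also have "\<dots> = (\<Sum>j\<in>UNIV. (\<Sum>p\<in>UNIV. fps_const (G p i) * ymul j (wconst (c p j k l)) m)
      + (\<Sum>p\<in>UNIV. fps_const (G p k) * ymul j (wconst (c i j p l)) m)
      + (\<Sum>p\<in>UNIV. fps_const (G p l) * ymul j (wconst (c i j k p)) m))"
      by (simp add: wconst_add wconst_sum wconst_mult ymul_add ymul_sum ymul_smult)
    also have "\<dots> = (\<Sum>p\<in>UNIV. fps_const (G p i) * T k l p m)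
    + ((\<Sum>p\<in>UNIV. fps_const (G p k) * T p l i m) + (\<Sum>p\<in>UNIV. fps_const (G p l) * T k p i m))"
      unfolding sum.distrib T_def sum_distrib_left add.assoc
      by (intro arg_cong2[where f = "(+)"]; rule sum.swap)
    finally show ?thesis .
  qed
  have "tensor2 (\<lambda>k l m. \<Sum>i\<in>UNIV. ymul i (T k l i) m)"
  proof -
    have "Lam (\<lambda>m. \<Sum>i\<in>UNIV. ymul i (T k l i) m) m
      = (\<Sum>p\<in>UNIV. fps_const (G p k) * (\<Sum>i\<in>UNIV. ymul i (T p l i) m))
      + (\<Sum>p\<in>UNIV. fps_const (G p l) * (\<Sum>i\<in>UNIV. ymul i (T k p i) m))" for k l m
    proof -
      have "Lam (\<lambda>m. \<Sum>i\<in>UNIV. ymul i (T k l i) m) m = (\<Sum>i\<in>UNIV. ymul i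
        (\<lambda>m. (\<Sum>p\<in>UNIV. fps_const (G p k) * T p l i m) + (\<Sum>p\<in>UNIV. fps_const (G p l) * T k p i m)) m)"
        unfolding Lam_sum[OF finite] by (rule Lam_ymul_contract) (rule LT)
      also have "\<dots> = (\<Sum>p\<in>UNIV. fps_const (G p k) * (\<Sum>i\<in>UNIV. ymul i (T p l i) m))
        + (\<Sum>p\<in>UNIV. fps_const (G p l) * (\<Sum>i\<in>UNIV. ymul i (T k p i) m))"
        unfolding ymul_add ymul_sum ymul_smult sum.distrib sum_distrib_left
        by (intro arg_cong2[where f = "(+)"]; rule sum.swap)
      finally show ?thesis .
    qed
    then show ?thesis by (simp add: tensor2_def)
  qed
  moreover have "tensor2 (\<lambda>k l m. wconst (fps_const (\<iota> (1 / 2)) * A k l) m)"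
  proof -
    define B where "B k l = fps_const (\<iota> (1 / 2)) * A k l" for k l
    have "fps_map L (B k l) = (\<Sum>p\<in>UNIV. fps_const (G p k) * B p l) + (\<Sum>p\<in>UNIV. fps_const (G p l) * B k p)" for k l
      by (simp add: B_def fps.leibniz A fps_map_const[OF additive_axioms] scalar distrib_left sum_distrib_left ac_simps)
    then have "tensor2 (\<lambda>k l m. wconst (B k l) m)"
      by (simp add: tensor2_def Lam_wconst wconst_add wconst_sum wconst_mult)
    then show ?thesis by (simp add: B_def)
  qed
  ultimately show ?thesis
    unfolding source_form_ymul T_def c_def by (intro tensor2_wedge2 tensor2_add)
qed

end

subsection \<open>Universal formulas\<close>

text \<open>The components of the inverse symplectic matrix are adjoined as variables, so that the solutions of
  the recursions do not depend on the point of the manifold and tensoriality becomes an identity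
  between polynomials.\<close>

type_synonym 'n universal = "('n symbol + 'n \<times> 'n) polynomial"

abbreviation u_sym :: "'n symbol \<Rightarrow> 'n universal" where
  "u_sym s \<equiv> poly_var (Inl s)"

abbreviation u_wbar :: "'n \<Rightarrow> 'n \<Rightarrow> 'n universal" where
  "u_wbar i j \<equiv> poly_var (Inr (i, j))"

fun symbol_indices :: "'n symbol \<Rightarrow> 'n list" where
  "symbol_indices (FSym I) = I"
| "symbol_indices (GSym I) = I"
| "symbol_indices (ASym n I i j) = I @ [i, j]"
| "symbol_indices (RSym I i j k l) = I @ [i, j, k, l]"

text \<open>The symbol of the same kind with another list of indices, in which the indices of differentiation
  come first.\<close>

fun set_indices :: "'n symbol \<Rightarrow> 'n list \<Rightarrow> 'n symbol" where
  "set_indices (FSym I) J = FSym J"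
| "set_indices (GSym I) J = GSym J"
| "set_indices (ASym n I i j) J = ASym n (take (length I) J) (J ! length I) (J ! (length I + 1))"
| "set_indices (RSym I i j k l) J = RSym (take (length I) J) (J ! length I) (J ! (length I + 1))
     (J ! (length I + 2)) (J ! (length I + 3))"

lemma set_symbol_indices: "set_indices s (symbol_indices s) = s"
  by (cases s) (simp_all add: nth_append)

lemma symbol_indices_deriv: "symbol_indices (symbol_deriv k s) = k # symbol_indices s"
  by (cases s) simp_all

lemma set_indices_deriv: "set_indices (symbol_deriv k s) (l # J) = symbol_deriv l (set_indices s J)"
  by (cases s) (simp_all add: add.commute)

abbreviation u_bar :: "'n \<Rightarrow> 'n \<Rightarrow> 'n universal fps" where
  "u_bar \<equiv> \<lambda>i j. fps_const (u_wbar i j)"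

abbreviation u_R :: "'n \<Rightarrow> 'n \<Rightarrow> 'n \<Rightarrow> 'n \<Rightarrow> 'n universal" where
  "u_R i j k l \<equiv> u_sym (RSym [] i j k l)"

definition u_deriv :: "'n \<Rightarrow> 'n universal \<Rightarrow> 'n universal" where
  "u_deriv k = poly_deriv (case_sum (\<lambda>s. u_sym (symbol_deriv k s)) (\<lambda>_. 0))"

text \<open>The infinitesimal change of frame: every lower index of a symbol is transformed by \<open>G\<close>, and the
  upper indices of the inverse symplectic matrix by the negative transpose.\<close>

definition u_lie :: "('n::finite \<Rightarrow> 'n \<Rightarrow> complex) \<Rightarrow> 'n universal \<Rightarrow> 'n universal" where
  "u_lie G = poly_deriv (case_sum
     (\<lambda>s. \<Sum>t<length (symbol_indices s). \<Sum>l\<in>UNIV.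
        poly_const (G l (symbol_indices s ! t)) * u_sym (set_indices s ((symbol_indices s)[t := l])))
     (\<lambda>(i, j). - (\<Sum>l\<in>UNIV. poly_const (G i l) * u_wbar l j + poly_const (G j l) * u_wbar i l)))"

lemma u_deriv_simps [simp]:
  "u_deriv k (poly_const z) = 0"
  "u_deriv k (u_sym s) = u_sym (symbol_deriv k s)"
  "u_deriv k (u_wbar i j) = 0"
  by (simp_all add: u_deriv_def poly_deriv_const poly_deriv_var)

lemma u_lie_simps:
  "u_lie G (poly_const z) = 0"
  "u_lie G (u_sym s) = (\<Sum>t<length (symbol_indices s). \<Sum>l\<in>UNIV.
     poly_const (G l (symbol_indices s ! t)) * u_sym (set_indices s ((symbol_indices s)[t := l])))"
  "u_lie G (u_wbar i j) = - (\<Sum>l\<in>UNIV. poly_const (G i l) * u_wbar l j + poly_const (G j l) * u_wbar i l)"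
  by (simp_all add: u_lie_def poly_deriv_const poly_deriv_var)

lemma derivation_u_deriv: "derivation (u_deriv k)"
  unfolding u_deriv_def by (rule derivation_poly_deriv)

lemma derivation_u_lie: "derivation (u_lie G)"
  unfolding u_lie_def by (rule derivation_poly_deriv)

lemma derivation_scalar: "derivation D \<Longrightarrow> D c = 0 \<Longrightarrow> D (c * x) = c * D x"
  by (simp add: derivation.leibniz)

lemma derivation_additive: "derivation D \<Longrightarrow> Modules.additive D"
  by (rule derivation.axioms(1))

text \<open>The two derivations commute up to the transformation of the new index, because differentiating a
  symbol prepends an index to its list. Both sides obey the same Leibniz rule.\<close>

lemma u_lie_u_deriv:
  fixes P :: "'n::finite universal"
  shows "u_lie G (u_deriv k P) = u_deriv k (u_lie G P) + (\<Sum>l\<in>UNIV. poly_const (G l k) * u_deriv l P)"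
proof (induction P rule: polynomial_induct)
  case (const z)
  show ?case
    by (simp add: u_lie_simps Modules.additive.zero[OF derivation_additive[OF derivation_u_lie]]
      Modules.additive.zero[OF derivation_additive[OF derivation_u_deriv]])
next
  case (var v)
  interpret d: derivation "u_deriv k'" for k' by (rule derivation_u_deriv)
  interpret L: derivation "u_lie G" by (rule derivation_u_lie)
  have scalar: "u_deriv k (poly_const z * x) = poly_const z * u_deriv k x" for z x
    by (rule derivation_scalar[OF derivation_u_deriv]) simp
  show ?case
  proof (cases v)
    case (Inl s)
    have "u_lie G (u_sym (symbol_deriv k s)) =
      (\<Sum>l\<in>UNIV. poly_const (G l k) * u_sym (symbol_deriv l s))
      + (\<Sum>t<length (symbol_indices s). \<Sum>l\<in>UNIV. poly_const (G l (symbol_indices s ! t)) *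
          u_sym (symbol_deriv k (set_indices s ((symbol_indices s)[t := l]))))"
      by (simp add: u_lie_simps symbol_indices_deriv sum.lessThan_Suc_shift set_indices_deriv set_symbol_indices
        del: sum.lessThan_Suc)
    then show ?thesis
      by (simp add: Inl u_lie_simps d.sum scalar)
  next
    case (Inr ij)
    obtain i j where "v = Inr (i, j)" using Inr by (cases ij) auto
    then show ?thesis
      by (simp add: u_lie_simps d.sum d.add d.minus scalar L.zero)
  qed
next
  case (add P P')
  then show ?case
    by (simp add: Modules.additive.add[OF derivation_additive[OF derivation_u_lie]]
      Modules.additive.add[OF derivation_additive[OF derivation_u_deriv]] distrib_left sum.distrib)
next
  case (mult P P')
  have "(\<Sum>l\<in>UNIV. poly_const (G l k) * (u_deriv l P * P' + P * u_deriv l P'))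
    = (\<Sum>l\<in>UNIV. poly_const (G l k) * u_deriv l P) * P' + P * (\<Sum>l\<in>UNIV. poly_const (G l k) * u_deriv l P')"
    by (simp add: sum_distrib_left sum_distrib_right distrib_left sum.distrib ac_simps)
  then show ?case
    by (simp add: derivation.leibniz[OF derivation_u_lie] derivation.leibniz[OF derivation_u_deriv]
      Modules.additive.add[OF derivation_additive[OF derivation_u_lie]]
      Modules.additive.add[OF derivation_additive[OF derivation_u_deriv]] mult algebra_simps)
qed

lemma lie_derivative_universal:
  "lie_derivative (u_lie G) poly_const (\<lambda>l i. poly_const (G l i)) u_bar u_deriv"
proof -
  interpret L: derivation "u_lie G" by (rule derivation_u_lie)
  show ?thesis
  proof unfold_locales
    show "u_lie G (poly_const z) = 0" for z by (simp add: u_lie_simps)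
    show "fps_map (u_lie G) (fps_const (u_wbar i j)) = - (\<Sum>l\<in>UNIV. fps_const (poly_const (G i l)) * fps_const (u_wbar l j)
        + fps_const (poly_const (G j l)) * fps_const (u_wbar i l))" for i j
      by (simp add: fps_map_const[OF L.additive_axioms] u_lie_simps fps_eq_iff fps_sum_nth flip: sum.distrib)
    show "u_deriv k (x + y) = u_deriv k x + u_deriv k y" for k and x y :: "'a universal"
      by (rule Modules.additive.add[OF derivation_additive[OF derivation_u_deriv]])
    show "u_deriv k (poly_const (G l i) * x) = poly_const (G l i) * u_deriv k x" for k l i x
      by (rule derivation_scalar[OF derivation_u_deriv]) simp
  qed (rule u_lie_u_deriv)
qed

abbreviation "u_Lam G \<equiv> lie_derivative.Lam (u_lie G) (\<lambda>l i. poly_const (G l i))"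
abbreviation "u_tensor1 G \<equiv> lie_derivative.tensor1 (u_lie G) (\<lambda>l i. poly_const (G l i))"

definition covariant_form :: "('n::finite \<Rightarrow> 'n \<Rightarrow> 'n universal fps) \<Rightarrow> bool" where
  "covariant_form A \<longleftrightarrow> (\<forall>G k l. fps_map (u_lie G) (A k l) =
     (\<Sum>p\<in>UNIV. fps_const (poly_const (G p k)) * A p l) + (\<Sum>p\<in>UNIV. fps_const (poly_const (G p l)) * A k p))"

abbreviation "u_source A \<equiv> source_form poly_const u_R A"
abbreviation "u_iter A \<equiv> r_iter poly_const u_bar (u_source A) u_deriv"
abbreviation "u_r A \<equiv> r_solution poly_const u_bar (u_source A) u_deriv"
abbreviation "u_lift_iter A \<equiv> lift_iter poly_const u_bar (u_r A) u_deriv"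
abbreviation "u_lift A \<equiv> lift_solution poly_const u_bar (u_r A) u_deriv"

lemma u_lie_R:
  "u_lie G (u_R i j k l) = (\<Sum>p\<in>UNIV. poly_const (G p i) * u_R p j k l) + (\<Sum>p\<in>UNIV. poly_const (G p j) * u_R i p k l)
      + (\<Sum>p\<in>UNIV. poly_const (G p k) * u_R i j p l) + (\<Sum>p\<in>UNIV. poly_const (G p l) * u_R i j k p)"
  by (simp add: u_lie_simps lessThan_Suc numeral_eq_Suc eval_nat_numeral add.assoc ac_simps)

lemma u_lie_A:
  "u_lie G (u_sym (ASym n [] k l)) = (\<Sum>p\<in>UNIV. poly_const (G p k) * u_sym (ASym n [] p l))
     + (\<Sum>p\<in>UNIV. poly_const (G p l) * u_sym (ASym n [] k p))"
  by (simp add: u_lie_simps lessThan_Suc eval_nat_numeral add.commute)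

subsection \<open>Values in a chart\<close>

fun symbol_depth :: "'n symbol \<Rightarrow> nat" where
  "symbol_depth (FSym I) = length I"
| "symbol_depth (GSym I) = length I"
| "symbol_depth (ASym n I i j) = length I"
| "symbol_depth (RSym I i j k l) = length I"

lemma take_append_nth2:
  assumes "length J = n + 2"
  shows "take n J @ [J ! n, J ! (n + 1)] = J"
proof (rule nth_equalityI)
  fix i assume "i < length (take n J @ [J ! n, J ! (n + 1)])"
  then have "i < n \<or> i = n \<or> i = n + 1" using assms by auto
  then show "(take n J @ [J ! n, J ! (n + 1)]) ! i = J ! i" using assms by (auto simp: nth_append)
qed (simp add: assms)

lemma take_append_nth4:
  assumes "length J = n + 4"
  shows "take n J @ [J ! n, J ! (n + 1), J ! (n + 2), J ! (n + 3)] = J"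
proof (rule nth_equalityI)
  fix i assume "i < length (take n J @ [J ! n, J ! (n + 1), J ! (n + 2), J ! (n + 3)])"
  then have "i < n \<or> i = n \<or> i = n + 1 \<or> i = n + 2 \<or> i = n + 3" using assms by auto
  then show "(take n J @ [J ! n, J ! (n + 1), J ! (n + 2), J ! (n + 3)]) ! i = J ! i"
    using assms by (auto simp: nth_append)
qed (simp add: assms)

text \<open>The data of a chart: the components of \<open>\<omega>\<close>, of the connection and of \<open>\<alpha>\<close>, and two functions, on an
  open subset of a Euclidean space.\<close>

locale chart_data =
  fixes S :: "(real^'n::finite) set" and w :: "real^'n \<Rightarrow> 'n \<Rightarrow> 'n \<Rightarrow> real"
    and \<Gamma> :: "real^'n \<Rightarrow> 'n \<Rightarrow> 'n \<Rightarrow> 'n \<Rightarrow> real" and \<alpha> :: "real^'n \<Rightarrow> 'n \<Rightarrow> 'n \<Rightarrow> complex fps"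
    and f g :: "real^'n \<Rightarrow> complex"
  assumes open_S: "open S"
    and smooth_w: "smooth_on S (\<lambda>x. w x i j)"
    and smooth_\<Gamma>: "smooth_on S (\<lambda>x. \<Gamma> x k i j)"
    and smooth_\<alpha>: "smooth_on S (\<lambda>x. fps_nth (\<alpha> x i j) n)"
    and smooth_f: "smooth_on S f" and smooth_g: "smooth_on S g"
    and torsion_free: "x \<in> S \<Longrightarrow> \<Gamma> x k i j = \<Gamma> x k j i"
    and parallel: "x \<in> S \<Longrightarrow> pd k (\<lambda>x. w x i j) x
      = (\<Sum>l\<in>UNIV. \<Gamma> x l k i * w x l j) + (\<Sum>l\<in>UNIV. \<Gamma> x l k j * w x i l)"
    and nondegenerate: "x \<in> S \<Longrightarrow> invertible (\<chi> i j. w x i j)"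
begin

definition winv :: "real^'n \<Rightarrow> 'n \<Rightarrow> 'n \<Rightarrow> real" where
  "winv x = tensor_inverse (w x)"

lemma w_winv: "x \<in> S \<Longrightarrow> (\<Sum>j\<in>UNIV. w x i j * winv x j k) = (if i = k then 1 else 0)"
  unfolding winv_def by (rule tensor_inverse_real(1)) (rule nondegenerate)

lemma winv_w: "x \<in> S \<Longrightarrow> (\<Sum>j\<in>UNIV. winv x i j * w x j k) = (if i = k then 1 else 0)"
  unfolding winv_def by (rule tensor_inverse_real(2)) (rule nondegenerate)

lemma differentiable_w: "x \<in> S \<Longrightarrow> (\<lambda>x. w x i j) differentiable at x"
  by (rule smooth_on_differentiable[OF open_S smooth_w])

lemma differentiable_winv: "x \<in> S \<Longrightarrow> (\<lambda>x. winv x i j) differentiable at x"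
  unfolding winv_def
  by (rule differentiable_tensor_inverse[OF open_S _ nondegenerate]) (auto intro: differentiable_w)

lemma solve_w:
  assumes x: "x \<in> S" and eq: "\<And>a. (\<Sum>b\<in>UNIV. w x a b * z b) = y a"
  shows "z i = (\<Sum>a\<in>UNIV. winv x i a * y a)"
proof -
  have "(\<Sum>a\<in>UNIV. winv x i a * y a) = (\<Sum>a\<in>UNIV. \<Sum>b\<in>UNIV. winv x i a * w x a b * z b)"
    by (simp add: sum_distrib_left mult.assoc flip: eq)
  also have "\<dots> = (\<Sum>b\<in>UNIV. (\<Sum>a\<in>UNIV. winv x i a * w x a b) * z b)"
    unfolding sum_distrib_right by (rule sum.swap)
  also have "\<dots> = z i"
    by (simp add: winv_w[OF x] if_distrib[of "\<lambda>t. t * _"] cong: if_cong)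
  finally show ?thesis by simp
qed

text \<open>\<open>\<nabla>\<omega> = 0\<close> implies that the inverse is parallel as well; this is seen by differentiating the product
  of \<open>\<omega>\<close> and its inverse.\<close>

lemma pd_winv:
  assumes x: "x \<in> S"
  shows "pd k (\<lambda>x. winv x i j) x = - (\<Sum>l\<in>UNIV. \<Gamma> x i k l * winv x l j) - (\<Sum>l\<in>UNIV. \<Gamma> x j k l * winv x i l)"
proof -
  \<comment> \<open>\<open>z\<close> consists of two of the three terms of the covariant derivative of the inverse; multiplying it by
    \<open>\<omega>\<close> gives the third one, up to sign.\<close>
  define z where "z b = pd k (\<lambda>x. winv x b j) x + (\<Sum>c\<in>UNIV. \<Gamma> x b k c * winv x c j)" for b
  have "(\<Sum>b\<in>UNIV. w x a b * z b) = - \<Gamma> x j k a" for a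
  proof -
    have "0 = pd k (\<lambda>x. \<Sum>b\<in>UNIV. w x a b * winv x b j) x"
      using pd_cong_open[OF open_S x, of "\<lambda>x. \<Sum>b\<in>UNIV. w x a b * winv x b j" "\<lambda>x. if a = j then 1 else 0" k]
      by (simp add: w_winv)
    also have "\<dots> = (\<Sum>b\<in>UNIV. pd k (\<lambda>x. w x a b) x * winv x b j + w x a b * pd k (\<lambda>x. winv x b j) x)"
      by (subst pd_sum) (simp_all add: pd_mult differentiable_w differentiable_winv differentiable_mult x)
    also have "\<dots> = (\<Sum>b\<in>UNIV. (\<Sum>l\<in>UNIV. \<Gamma> x l k a * (w x l b * winv x b j)))
        + (\<Sum>b\<in>UNIV. (\<Sum>l\<in>UNIV. w x a l * (\<Gamma> x l k b * winv x b j)))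
        + (\<Sum>b\<in>UNIV. w x a b * pd k (\<lambda>x. winv x b j) x)"
      by (simp add: parallel[OF x] sum.distrib distrib_right sum_distrib_right mult.assoc)
        (simp add: mult.left_commute mult.commute)
    also have "(\<Sum>b\<in>UNIV. (\<Sum>l\<in>UNIV. \<Gamma> x l k a * (w x l b * winv x b j))) = \<Gamma> x j k a"
      by (subst sum.swap)
        (simp add: sum_distrib_left[symmetric] w_winv[OF x] if_distrib cong: if_cong)
    also have "(\<Sum>b\<in>UNIV. (\<Sum>l\<in>UNIV. w x a l * (\<Gamma> x l k b * winv x b j)))
        = (\<Sum>b\<in>UNIV. w x a b * (\<Sum>c\<in>UNIV. \<Gamma> x b k c * winv x c j))"
      unfolding sum_distrib_left by (rule sum.swap)
    finally show ?thesis by (simp add: z_def distrib_left sum.distrib)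
  qed
  from solve_w[OF x this, of i] show ?thesis
    by (simp add: z_def sum_negf ac_simps)
qed

abbreviation symval :: "real^'n \<Rightarrow> 'n symbol \<Rightarrow> complex" where
  "symval \<equiv> symbol_value w \<Gamma> \<alpha> f g"

text \<open>The tensor whose iterated covariant derivatives are the values of a symbol, as a function of a point
  and a list of indices.\<close>

primrec base_tensor :: "'n symbol \<Rightarrow> real^'n \<Rightarrow> 'n list \<Rightarrow> complex" where
  "base_tensor (FSym I) = (\<lambda>x J. f x)"
| "base_tensor (GSym I) = (\<lambda>x J. g x)"
| "base_tensor (ASym n I i j) = (\<lambda>x J. fps_nth (\<alpha> x (J ! 0) (J ! 1)) n)"
| "base_tensor (RSym I i j k l) = (\<lambda>x J.
     complex_of_real (lowered_curvature w \<Gamma> x (J ! 0) (J ! 1) (J ! 2) (J ! 3)))"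

abbreviation symbol_tensor :: "'n symbol \<Rightarrow> real^'n \<Rightarrow> 'n list \<Rightarrow> complex" where
  "symbol_tensor s \<equiv> (covd \<Gamma> ^^ symbol_depth s) (base_tensor s)"

lemma symval_set_indices:
  "length J = length (symbol_indices s) \<Longrightarrow> symval x (set_indices s J) = symbol_tensor s x J"
proof (cases s)
  case (RSym I i j k l)
  moreover assume "length J = length (symbol_indices s)"
  ultimately have len: "length J = length I + 4" by simp
  from take_append_nth4[OF len] show ?thesis by (simp add: RSym len)
qed (simp_all add: take_append_nth2[simplified])

lemma symval_eq: "symval x s = symbol_tensor s x (symbol_indices s)"
  using symval_set_indices[of "symbol_indices s" s x] by (simp add: set_symbol_indices)

lemma symval_deriv: "symval x (symbol_deriv k s) = covd \<Gamma> (symbol_tensor s) x (k # symbol_indices s)"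
  by (cases s) simp_all

lemma smooth_lowered_curvature: "smooth_on S (\<lambda>x. lowered_curvature w \<Gamma> x i j k l)"
  unfolding lowered_curvature_def curvature_def
  by (intro smooth_on_sum smooth_on_mult smooth_on_add smooth_on_diff smooth_on_pd open_S smooth_w smooth_\<Gamma>)

lemma smooth_base_tensor: "smooth_on S (\<lambda>x. base_tensor s x J)"
  by (cases s) (simp_all add: smooth_f smooth_g smooth_\<alpha> smooth_on_of_real open_S smooth_lowered_curvature)

lemma smooth_symval: "smooth_on S (\<lambda>x. symval x s)"
  unfolding symval_eq by (rule smooth_on_covd_iter[OF open_S smooth_\<Gamma> smooth_base_tensor])

text \<open>This is the definition of the covariant derivative, solved for the partial derivative. The sum over
  the positions of the indices is the change of frame \<open>u_lie\<close>.\<close>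

lemma pd_symval:
  "pd k (\<lambda>x. symval x s) x = symval x (symbol_deriv k s)
    + (\<Sum>t<length (symbol_indices s). \<Sum>l\<in>UNIV.
        complex_of_real (\<Gamma> x l k (symbol_indices s ! t)) * symval x (set_indices s ((symbol_indices s)[t := l])))"
  by (simp add: symval_deriv symval_set_indices) (simp add: symval_eq)

definition val :: "real^'n \<Rightarrow> 'n symbol + 'n \<times> 'n \<Rightarrow> complex" where
  "val x = case_sum (symval x) (\<lambda>(i, j). complex_of_real (winv x i j))"

definition ev :: "real^'n \<Rightarrow> 'n universal \<Rightarrow> complex" where
  "ev x = poly_subst (\<lambda>z. z) (val x)"

lemma ring_map_id: "ring_map (\<lambda>z::complex. z)"
  by unfold_locales simp_all

lemma coefficient_map_ev: "coefficient_map (ev x) poly_const (\<lambda>z. z)"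
  unfolding coefficient_map_def ev_def coefficient_map_axioms_def
  by (simp add: ring_map_poly_subst poly_subst_const ring_map_id)

lemma ev_simps [simp]:
  "ev x (poly_const z) = z"
  "ev x (u_sym s) = symval x s"
  "ev x (u_wbar i j) = complex_of_real (winv x i j)"
  by (simp_all add: ev_def poly_subst_const poly_subst_var ring_map_id val_def)

definition Gam :: "real^'n \<Rightarrow> 'n \<Rightarrow> 'n \<Rightarrow> 'n \<Rightarrow> complex" where
  "Gam x k l i = complex_of_real (\<Gamma> x l k i)"

text \<open>Both sides are derivations along the evaluation homomorphism, so it suffices to compare them on the
  variables. The change of frame has the matrix \<open>\<Gamma>\<^sup>l\<^sub>k\<^sub>i\<close> of the connection in the direction \<open>k\<close>.\<close>

lemma pd_ev:
  assumes x: "x \<in> S"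
  shows "(\<lambda>x. ev x P) differentiable at x \<and>
    pd k (\<lambda>x. ev x P) x = ev x (u_deriv k P) + ev x (u_lie (Gam x k) P)"
proof -
  interpret e: coefficient_map "ev y" poly_const "\<lambda>z. z" for y by (rule coefficient_map_ev)
  interpret d: derivation "u_deriv k" by (rule derivation_u_deriv)
  interpret L: derivation "u_lie (Gam x k)" by (rule derivation_u_lie)
  show ?thesis
  proof (induction P rule: polynomial_induct)
    case (const z)
    show ?case by (simp add: u_lie_simps e.zero)
  next
    case (var v)
    show ?case
    proof (cases v)
      case (Inl s)
      have "(\<lambda>x. symval x s) differentiable at x"
        by (rule smooth_on_differentiable[OF open_S smooth_symval x])
      then show ?thesis
        by (simp add: Inl pd_symval u_lie_simps e.sum e.map_mult Gam_def)
    next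
      case (Inr ij)
      obtain i j where v: "v = Inr (i, j)" using Inr by (cases ij) auto
      have of_real: "bounded_linear complex_of_real" by (rule bounded_linear_of_real)
      show ?thesis
        using differentiable_of_bounded_linear[OF of_real differentiable_winv[OF x, of i j]]
          pd_bounded_linear[OF of_real differentiable_winv[OF x, of i j]]
        by (simp add: v pd_winv[OF x] u_lie_simps e.sum e.minus e.add e.diff e.zero e.map_mult Gam_def sum.distrib)
    qed
  next
    case (add P P')
    then show ?case by (simp add: e.add d.add L.add pd_add)
  next
    case (mult P P')
    then show ?case by (simp add: e.add e.map_mult d.leibniz L.leibniz pd_mult algebra_simps)
  qed
qed

subsection \<open>The evaluated iterates solve the recursions\<close>

abbreviation wbar :: "real^'n \<Rightarrow> 'n \<Rightarrow> 'n \<Rightarrow> complex fps" where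
  "wbar x \<equiv> const_matrix (\<lambda>z. z) (tensor_inverse (w x))"

abbreviation evw :: "real^'n \<Rightarrow> ('n, 'n universal) weyl \<Rightarrow> ('n, complex) weyl" where
  "evw x a \<equiv> \<lambda>m. fps_map (ev x) (a m)"

text \<open>The covariant derivative of an evaluated section differs from the evaluated symbolic derivative by
  its total variation, that is, by the failure to be invariant.\<close>

lemma weyl_cov_evw:
  assumes x: "x \<in> S"
  shows "weyl_cov \<Gamma> k (\<lambda>x. evw x a) x m = fps_map (ev x) (fps_map (u_deriv k) (a m))
    + fps_map (ev x) (u_Lam (Gam x k) a m)"
proof -
  interpret L: lie_derivative "u_lie (Gam x k)" poly_const "\<lambda>l i. poly_const (Gam x k l i)"
    u_bar u_deriv by (rule lie_derivative_universal)
  interpret e: coefficient_map "ev x" poly_const "\<lambda>z. z" by (rule coefficient_map_ev)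
  have "(\<Sum>i\<in>set_mset m. fps_const (complex_of_real (\<Gamma> x l k i)) * dy l (evw x a) (m - {#i#}))
      = (\<Sum>i\<in>UNIV. fps_const (Gam x k l i) * fps_map (ev x) (ymul i (dy l a) m))" for l
    by (rule sum.mono_neutral_cong_left)
      (auto simp: Gam_def dy_fps_map[OF e.additive_axioms] ymul_def e.fps.zero)
  then have "fps_map (ev x) (gl_act (\<lambda>l i. poly_const (Gam x k l i)) a m) = (\<Sum>l\<in>UNIV. \<Sum>i\<in>set_mset m.
      fps_const (complex_of_real (\<Gamma> x l k i)) * dy l (evw x a) (m - {#i#}))"
    by (simp add: gl_act_def e.fps.sum e.fps.map_mult fps_map_const[OF e.additive_axioms])
  moreover have "Abs_fps (\<lambda>h. pd k (\<lambda>x. fps_nth (evw x a m) h) x)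
      = fps_map (ev x) (fps_map (u_deriv k) (a m)) + fps_map (ev x) (fps_map (u_lie (Gam x k)) (a m))"
    using pd_ev[OF x] by (simp add: fps_eq_iff)
  ultimately show ?thesis
    unfolding weyl_cov_def L.Lam_def e.fps.diff by simp
qed

text \<open>The covariant derivative preserves both degrees, and its value at a point depends on a section near
  that point only.\<close>

lemma deg_ge_weyl_cov_diff:
  assumes x: "x \<in> S" and ab: "\<And>x. x \<in> S \<Longrightarrow> deg_ge D (\<lambda>m. a x m - b x m)"
  shows "deg_ge D (\<lambda>m. weyl_cov \<Gamma> k a x m - weyl_cov \<Gamma> k b x m)"
proof (rule deg_geI)
  fix m :: "'n multiset" and h assume deg: "int (2 * h + size m) < D"
  have eq: "fps_nth (a y m') h = fps_nth (b y m') h" if "size m' = size m" "y \<in> S" for m' y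
    using deg_geD[OF ab[OF that(2)], of h m'] deg that(1) by simp
  have "pd k (\<lambda>x. fps_nth (a x m) h) x = pd k (\<lambda>x. fps_nth (b x m) h) x"
    by (rule pd_cong_open[OF open_S x]) (rule eq[OF refl])
  moreover have "fps_nth (dy l (a x) (m - {#i#})) h = fps_nth (dy l (b x) (m - {#i#})) h" if "i \<in># m" for i l
    using that x by (auto simp: dy_nth eq dest!: multi_member_split)
  ultimately show "fps_nth (weyl_cov \<Gamma> k a x m - weyl_cov \<Gamma> k b x m) h = 0"
    by (simp add: weyl_cov_def fps_sum_nth)
qed

context
  fixes A :: "'n \<Rightarrow> 'n \<Rightarrow> 'n universal fps" and \<beta> :: "real^'n \<Rightarrow> 'n \<Rightarrow> 'n \<Rightarrow> complex fps"
  assumes A_cov: "covariant_form A"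
    and A_0: "\<And>k l. fps_nth (A k l) 0 = 0"
    and ev_A: "\<And>x k l. x \<in> S \<Longrightarrow> fps_map (ev x) (A k l) = \<beta> x k l"
begin

definition source :: "real^'n \<Rightarrow> 'n \<Rightarrow> 'n \<Rightarrow> ('n, complex) weyl" where
  "source x = source_form (\<lambda>z. z) (\<lambda>i j k l. complex_of_real (lowered_curvature w \<Gamma> x i j k l)) (\<beta> x)"

lemma tensor_u_iter: "u_tensor1 G (u_iter A N)"
  and tensor_u_r: "u_tensor1 G (u_r A)"
proof -
  interpret L: lie_derivative "u_lie G" poly_const "\<lambda>l i. poly_const (G l i)"
    u_bar u_deriv by (rule lie_derivative_universal)
  have "L.tensor2 (u_source A)" by (rule L.tensor2_source_form[OF u_lie_R])
      (use A_cov in \<open>simp add: covariant_form_def\<close>)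
  then show "L.tensor1 (u_iter A N)" "L.tensor1 (u_r A)"
    by (rule L.tensor1_r_iter, rule L.tensor1_r_solution)
qed

lemma evw_source: "x \<in> S \<Longrightarrow> fps_map (ev x) (u_source A k l m) = source x k l m"
proof -
  assume x: "x \<in> S"
  interpret e: coefficient_map "ev x" poly_const "\<lambda>z. z" by (rule coefficient_map_ev)
  show ?thesis by (simp add: e.source_form_map ev_A[OF x] source_def)
qed

lemma evw_wbar: "fps_map (ev x) (fps_const (u_wbar i j)) = wbar x i j"
proof -
  interpret e: coefficient_map "ev x" poly_const "\<lambda>z. z" by (rule coefficient_map_ev)
  show ?thesis by (simp add: fps_map_const[OF e.additive_axioms] const_matrix_def winv_def)
qed

text \<open>The covariant derivative in \<open>\<partial>r\<close> does not act on the form index of \<open>r\<close>, whereas the symbolic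
  derivative does. The difference is symmetric since the connection has no torsion.\<close>

lemma wedge_weyl_cov_evw:
  assumes x: "x \<in> S" and t: "\<And>G. u_tensor1 G r"
  shows "wedge2 (\<lambda>k l m. fps_map (ev x) (fps_map (u_deriv k) (r l m))) k l m
    = wedge2 (\<lambda>k l. weyl_cov \<Gamma> k (\<lambda>x. evw x (r l)) x) k l m"
proof -
  interpret e: coefficient_map "ev x" poly_const "\<lambda>z. z" by (rule coefficient_map_ev)
  have "fps_map (ev x) (u_Lam (Gam x k) (r l) m)
      = (\<Sum>p\<in>UNIV. fps_const (Gam x k p l) * fps_map (ev x) (r p m))" for k l
  proof -
    interpret L: lie_derivative "u_lie (Gam x k)" poly_const "\<lambda>l i. poly_const (Gam x k l i)"
      u_bar u_deriv by (rule lie_derivative_universal)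
    show ?thesis using t[of "Gam x k"]
      by (simp add: L.tensor1_def e.fps.sum e.fps.map_mult fps_map_const[OF e.additive_axioms])
  qed
  moreover have "Gam x k p l = Gam x l p k" for p by (simp add: Gam_def torsion_free[OF x, of p k l])
  ultimately show ?thesis
    unfolding wedge2_def weyl_cov_evw[OF x] by simp
qed

text \<open>Both \<open>r\<close> and the zeroth iterate vanish in degrees below 3. Each application of the right-hand side
  makes one more degree agree, simultaneously at all points of the chart, as is needed for the
  derivatives.\<close>

lemma r_unique:
  assumes r3: "\<And>x j. x \<in> S \<Longrightarrow> deg_ge 3 (r x j)"
    and r: "\<And>x. x \<in> S \<Longrightarrow> r x = r_rhs (\<lambda>z. z) (wbar x) (source x) (\<lambda>k l. weyl_cov \<Gamma> k (\<lambda>x. r x l) x) (r x)"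
    and x: "x \<in> S"
  shows "r x j m = fps_map (ev x) (u_r A j m)"
proof -
  have iter3: "deg_ge 3 (u_iter A N j)" for N j
    by (rule deg_ge_r_iter[OF derivation_additive[OF derivation_u_deriv]]) (rule deg_ge_source_form, rule A_0)
  have iter: "deg_ge (int N + 3) (\<lambda>m. evw x (u_iter A N j) m - r x j m)" if "x \<in> S" for N j x
    using that
  proof (induction N arbitrary: x j)
    case 0
    interpret e: coefficient_map "ev x" poly_const "\<lambda>z. z" by (rule coefficient_map_ev)
    show ?case using deg_ge_diff[OF deg_ge_zero r3[OF 0]] by (simp add: r_iter_0 e.fps.zero)
  next
    case (Suc N)
    interpret e: coefficient_map "ev x" poly_const "\<lambda>z. z" by (rule coefficient_map_ev)
    have "evw x (u_iter A (Suc N) j) m = r_rhs (\<lambda>z. z) (wbar x) (source x)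
       (\<lambda>k l m. fps_map (ev x) (fps_map (u_deriv k) (u_iter A N l m))) (\<lambda>l. evw x (u_iter A N l)) j m" for m
      by (simp add: r_iter_Suc e.r_rhs_map evw_source[OF Suc.prems] evw_wbar)
    moreover have "deg_ge (int N + 3 + 1) (\<lambda>m. r_rhs (\<lambda>z. z) (wbar x) (source x)
       (\<lambda>k l m. fps_map (ev x) (fps_map (u_deriv k) (u_iter A N l m))) (\<lambda>l. evw x (u_iter A N l)) j m
       - r_rhs (\<lambda>z. z) (wbar x) (source x) (\<lambda>k l. weyl_cov \<Gamma> k (\<lambda>x. r x l) x) (r x) j m)"
    proof (rule r_rhs_contraction)
      show "deg_ge 3 (evw x (u_iter A N k))" for k
        by (rule deg_ge_fps_map[OF e.additive_axioms iter3])
      show "deg_ge 3 (r x k)" for k by (rule r3[OF Suc.prems])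
      show "deg_ge (int N + 3) (\<lambda>m. evw x (u_iter A N k) m - r x k m)" for k by (rule Suc.IH[OF Suc.prems])
      have d: "deg_ge (int N + 3) (\<lambda>m. weyl_cov \<Gamma> k (\<lambda>x. evw x (u_iter A N l)) x m - weyl_cov \<Gamma> k (\<lambda>x. r x l) x m)" for k l
        by (rule deg_ge_weyl_cov_diff[OF Suc.prems]) (rule Suc.IH)
      show "deg_ge (int N + 3) (\<lambda>m. wedge2 (\<lambda>k l m. fps_map (ev x) (fps_map (u_deriv k) (u_iter A N l m))) k l m
        - wedge2 (\<lambda>k l. weyl_cov \<Gamma> k (\<lambda>x. r x l) x) k l m)" for k l
        unfolding wedge_weyl_cov_evw[OF Suc.prems tensor_u_iter] wedge2_def
        using deg_ge_diff[OF d[of k l] d[of l k]] by (simp add: algebra_simps)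
    qed
    moreover have "r x j m = r_rhs (\<lambda>z. z) (wbar x) (source x) (\<lambda>k l. weyl_cov \<Gamma> k (\<lambda>x. r x l) x) (r x) j m" for m
      using fun_cong[OF fun_cong[OF r[OF Suc.prems]]] .
    ultimately show ?case by (simp add: algebra_simps)
  qed
  show ?thesis
  proof (rule fps_ext)
    fix h
    have "int (2 * h + size m) < int (2 * h + size m) + 3" by simp
    from deg_geD[OF iter[OF x] this] show "fps_nth (r x j m) h = fps_nth (fps_map (ev x) (u_r A j m)) h"
      by (simp add: r_solution_def)
  qed
qed

lemma lift_unique:
  assumes \<phi>: "\<And>G. u_lie G \<phi> = 0"
    and a: "\<And>x. x \<in> S \<Longrightarrow> a x = lift_rhs (\<lambda>z. z) (wbar x) (\<lambda>j. evw x (u_r A j)) (ev x \<phi>) (\<lambda>k. weyl_cov \<Gamma> k a x) (a x)"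
    and x: "x \<in> S"
  shows "a x m = fps_map (ev x) (u_lift A \<phi> m)"
proof -
  let ?a = "u_lift_iter A \<phi>"
  have r3: "deg_ge 3 (u_r A j)" for j
    by (rule deg_ge_r_solution[OF derivation_additive[OF derivation_u_deriv]]) (rule deg_ge_source_form, rule A_0)
  have cov: "weyl_cov \<Gamma> k (\<lambda>x. evw x (?a N)) x m = fps_map (ev x) (fps_map (u_deriv k) (?a N m))"
    if "x \<in> S" for N k x m
  proof -
    interpret L: lie_derivative "u_lie (Gam x k)" poly_const "\<lambda>l i. poly_const (Gam x k l i)"
      u_bar u_deriv by (rule lie_derivative_universal)
    interpret e: coefficient_map "ev x" poly_const "\<lambda>z. z" by (rule coefficient_map_ev)
    show ?thesis
      using L.tensor0_lift_iter[OF tensor_u_r \<phi>, of N]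
      by (simp add: weyl_cov_evw[OF that] L.tensor0_def e.fps.zero)
  qed
  have iter: "deg_ge (int N) (\<lambda>m. evw x (?a N) m - a x m)" if "x \<in> S" for N x
    using that
  proof (induction N arbitrary: x)
    case 0
    show ?case by (simp add: deg_ge_def)
  next
    case (Suc N)
    interpret e: coefficient_map "ev x" poly_const "\<lambda>z. z" by (rule coefficient_map_ev)
    have "evw x (?a (Suc N)) m = lift_rhs (\<lambda>z. z) (wbar x) (\<lambda>j. evw x (u_r A j)) (ev x \<phi>)
       (\<lambda>k. weyl_cov \<Gamma> k (\<lambda>x. evw x (?a N)) x) (evw x (?a N)) m" for m
      by (simp add: lift_iter_Suc e.lift_rhs_map evw_wbar cov[OF Suc.prems, abs_def])
    moreover have "deg_ge (int N + 1) (\<lambda>m. lift_rhs (\<lambda>z. z) (wbar x) (\<lambda>j. evw x (u_r A j)) (ev x \<phi>)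
       (\<lambda>k. weyl_cov \<Gamma> k (\<lambda>x. evw x (?a N)) x) (evw x (?a N)) m
       - lift_rhs (\<lambda>z. z) (wbar x) (\<lambda>j. evw x (u_r A j)) (ev x \<phi>) (\<lambda>k. weyl_cov \<Gamma> k a x) (a x) m)"
      by (rule lift_rhs_contraction deg_ge_fps_map[OF e.additive_axioms] r3 Suc deg_ge_weyl_cov_diff)+
    moreover have "a x m = lift_rhs (\<lambda>z. z) (wbar x) (\<lambda>j. evw x (u_r A j)) (ev x \<phi>) (\<lambda>k. weyl_cov \<Gamma> k a x) (a x) m" for m
      using fun_cong[OF a[OF Suc.prems]] .
    ultimately show ?case by (simp add: add.commute)
  qed
  show ?thesis
  proof (rule fps_ext)
    fix h
    have "int (2 * h + size m) < int (2 * h + size m + 1)" by simp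
    from deg_geD[OF iter[OF x] this]
    show "fps_nth (a x m) h = fps_nth (fps_map (ev x) (u_lift A \<phi> m)) h"
      by (simp add: lift_solution_def)
  qed
qed

end

end

section \<open>The formal Poisson bivector as a geometric series\<close>

lemma matrix_mul_uminus_left: "(- A) ** B = - (A ** B)" for A :: "'a::comm_ring_1^'n^'m"
  by (simp add: matrix_matrix_mult_def vec_eq_iff sum_negf)

lemma matrix_mul_uminus_right: "A ** (- B) = - (A ** B)" for A :: "'a::comm_ring_1^'n^'m"
  by (simp add: matrix_matrix_mult_def vec_eq_iff sum_negf)

lemma matrix_add_rdistrib: "(A + B) ** C = A ** C + B ** C" for A :: "'a::comm_ring_1^'n^'m"
  by (simp add: matrix_matrix_mult_def vec_eq_iff distrib_right sum.distrib)

lemma matrix_mul_diff_right: "A ** (B - C) = A ** B - A ** C" for A :: "'a::comm_ring_1^'n^'m"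
  by (simp add: matrix_matrix_mult_def vec_eq_iff right_diff_distrib sum_subtractf)

lemma transpose_uminus: "transpose (- A) = - transpose A" for A :: "'a::comm_ring_1^'n^'m"
  by (simp add: transpose_def vec_eq_iff)

lemma transpose_add: "transpose (A + B) = transpose A + transpose B" for A :: "'a::comm_ring_1^'n^'m"
  by (simp add: transpose_def vec_eq_iff)

definition mat_of :: "('n \<Rightarrow> 'n \<Rightarrow> 'a) \<Rightarrow> 'a^'n^'n" where
  "mat_of A = (\<chi> i j. A i j)"

lemma mat_of_nth [simp]: "mat_of A $ i $ j = A i j"
  by (simp add: mat_of_def)

lemma mat_of_eq_iff: "mat_of A = M \<longleftrightarrow> (\<forall>i j. A i j = M $ i $ j)"
  by (simp add: vec_eq_iff)

lemma matrix_mul_nth: "(A ** B) $ i $ j = (\<Sum>k\<in>UNIV. A $ i $ k * B $ k $ j)"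
  by (simp add: matrix_matrix_mult_def)

lemma matrix_mul3_nth: "(A ** B ** C) $ i $ j = (\<Sum>k\<in>UNIV. \<Sum>l\<in>UNIV. A $ i $ k * B $ k $ l * C $ l $ j)"
  for A B C :: "'a::comm_ring_1^'n^'n"
proof -
  have "(A ** B ** C) $ i $ j = (\<Sum>l\<in>UNIV. \<Sum>k\<in>UNIV. A $ i $ k * B $ k $ l * C $ l $ j)"
    by (simp add: matrix_mul_nth sum_distrib_right)
  then show ?thesis by (subst sum.swap)
qed

text \<open>Substituting \<open>M u\<close> and \<open>M v\<close> into a bivector amounts to the congruence by \<open>M\<close>.\<close>

lemma bivector_apply_congruence:
  fixes M :: "'a::comm_ring_1^'n^'n"
  shows "bivector_apply A (\<lambda>i. (M *v u) $ i) (\<lambda>i. (M *v v) $ i)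
    = bivector_apply (\<lambda>i j. (transpose M ** mat_of A ** M) $ i $ j) (\<lambda>i. u $ i) (\<lambda>i. v $ i)"
proof -
  have "bivector_apply A (\<lambda>i. (M *v u) $ i) (\<lambda>i. (M *v v) $ i)
    = (\<Sum>i\<in>UNIV. \<Sum>j\<in>UNIV. \<Sum>k\<in>UNIV. \<Sum>l\<in>UNIV. M $ i $ k * A i j * M $ j $ l * (u $ k * v $ l))"
  proof -
    have "A i j * (\<Sum>k\<in>UNIV. M $ i $ k * u $ k) * (\<Sum>l\<in>UNIV. M $ j $ l * v $ l)
      = (\<Sum>k\<in>UNIV. \<Sum>l\<in>UNIV. M $ i $ k * A i j * M $ j $ l * (u $ k * v $ l))" for i j
      unfolding mult.assoc[of "A i j"] sum_product unfolding sum_distrib_left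
      by (intro sum.cong refl) (simp only: ac_simps)
    then show ?thesis by (simp add: bivector_apply_def matrix_vector_mult_def)
  qed
  also have "\<dots> = (\<Sum>i\<in>UNIV. \<Sum>k\<in>UNIV. \<Sum>j\<in>UNIV. \<Sum>l\<in>UNIV. M $ i $ k * A i j * M $ j $ l * (u $ k * v $ l))"
    by (rule sum.cong[OF refl], rule sum.swap)
  also have "\<dots> = (\<Sum>k\<in>UNIV. \<Sum>l\<in>UNIV. \<Sum>i\<in>UNIV. \<Sum>j\<in>UNIV. M $ i $ k * A i j * M $ j $ l * (u $ k * v $ l))"
    by (rule sum_swap4)
  also have "\<dots> = bivector_apply (\<lambda>i j. (transpose M ** mat_of A ** M) $ i $ j) (\<lambda>i. u $ i) (\<lambda>i. v $ i)"
    unfolding bivector_apply_def matrix_mul3_nth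
    by (simp add: transpose_def sum_distrib_right mult.assoc)
  finally show ?thesis .
qed

text \<open>The inverse of \<open>\<omega> + \<alpha>\<close>, where \<open>\<alpha>\<close> is divisible by \<open>\<hbar>\<close>, over an arbitrary ring of scalars. Both
  the formal expression for \<open>\<alpha>\<close> and its value at a point are of this kind.\<close>

locale deformed_symplectic =
  fixes \<omega> \<omega>bar \<alpha> :: "'n::finite \<Rightarrow> 'n \<Rightarrow> 'a::comm_ring_1 fps"
  assumes \<omega>_\<omega>bar: "(\<Sum>j\<in>UNIV. \<omega> i j * \<omega>bar j k) = (if i = k then 1 else 0)"
    and \<omega>bar_\<omega>: "(\<Sum>j\<in>UNIV. \<omega>bar i j * \<omega> j k) = (if i = k then 1 else 0)"
    and \<omega>_antisym: "\<omega> i j = - \<omega> j i"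
    and \<alpha>_antisym: "\<alpha> i j = - \<alpha> j i"
    and \<alpha>_0: "fps_nth (\<alpha> i j) 0 = 0"
begin

abbreviation "W \<equiv> mat_of \<omega>"
abbreviation "B \<equiv> mat_of \<omega>bar"
abbreviation "Al \<equiv> mat_of \<alpha>"

lemma W_B: "W ** B = mat 1" and B_W: "B ** W = mat 1"
  by (simp_all add: vec_eq_iff matrix_mul_nth \<omega>_\<omega>bar \<omega>bar_\<omega> mat_def)

lemma transpose_W: "transpose W = - W"
  unfolding vec_eq_iff by (auto simp: transpose_def intro: \<omega>_antisym)

lemma transpose_Al: "transpose Al = - Al"
  unfolding vec_eq_iff by (auto simp: transpose_def intro: \<alpha>_antisym)

lemma transpose_B: "transpose B = - B"
proof -
  have "transpose (W ** B) = transpose (mat 1)" by (simp add: W_B)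
  then have "transpose B ** W = - mat 1"
    by (simp add: matrix_transpose_mul transpose_W matrix_mul_uminus_right transpose_mat minus_equation_iff)
  then have "transpose B ** W ** B = - mat 1 ** B" by simp
  then show ?thesis by (simp add: W_B matrix_mul_uminus_left flip: matrix_mul_assoc)
qed

lemma \<omega>bar_antisym: "\<omega>bar i j = - \<omega>bar j i"
  using arg_cong[OF transpose_B, of "\<lambda>M. M $ j $ i"] by (simp add: transpose_def)

text \<open>The ratio of the geometric series: \<open>\<omega> + \<alpha> = \<omega> (1 - U)\<close>, and the diamond product with the raised
  \<open>\<alpha>\<close> is multiplication by \<open>U\<close>.\<close>

definition "U = - (B ** Al)"

abbreviation "\<alpha>bar \<equiv> raise \<omega>bar \<alpha>"

lemma mat_of_raise: "mat_of \<alpha>bar = - (U ** B)"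
proof -
  have "mat_of \<alpha>bar = - (B ** Al ** transpose B)"
    unfolding mat_of_eq_iff uminus_vec_def
    by (simp add: raise_def matrix_mul3_nth transpose_def ac_simps)
  then show ?thesis by (simp add: transpose_B matrix_mul_uminus_right matrix_mul_uminus_left U_def)
qed

lemma mat_of_diamond: "mat_of (diamond \<omega> A C) = transpose (mat_of A) ** W ** mat_of C"
  unfolding mat_of_eq_iff
  by (auto simp: diamond_def matrix_mul3_nth transpose_def ac_simps)

definition "P q = mat_of (diamond_power \<omega> \<alpha>bar (Suc q))"

lemma P_0: "P 0 = - (U ** B)"
  by (simp add: P_def diamond_power_def mat_of_raise)

lemma P_Suc: "P (Suc q) = U ** P q"
proof -
  have "transpose (U ** B) ** W = - U"
    by (simp add: U_def matrix_transpose_mul transpose_uminus transpose_B transpose_Al matrix_mul_uminus_left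
      matrix_mul_uminus_right B_W flip: matrix_mul_assoc)
  then show ?thesis
    by (simp add: P_def diamond_power_def mat_of_diamond mat_of_raise transpose_uminus matrix_mul_uminus_left)
qed

lemma U_0: "fps_nth (U $ i $ j) 0 = 0"
  by (simp add: U_def matrix_mul_nth fps_sum_nth \<alpha>_0)

lemma P_vanish: "h \<le> q \<Longrightarrow> fps_nth (P q $ i $ j) h = 0"
proof (induction q arbitrary: h i j)
  case 0
  then show ?case by (simp add: P_0 matrix_mul_nth fps_sum_nth U_0)
next
  case (Suc q)
  have "fps_nth (U $ i $ k) a * fps_nth (P q $ k $ j) (h - a) = 0" for k a
    using Suc.IH[of "h - a"] Suc.prems by (cases "a = 0") (simp_all add: U_0)
  then show ?case by (simp add: P_Suc matrix_mul_nth fps_sum_nth fps_mult_nth)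
qed

text \<open>The sum of all diamond powers. The coefficient of \<open>\<hbar>\<^sup>h\<close> is a finite sum because the \<open>q\<close>-th term is
  divisible by \<open>\<hbar>\<^sup>q\<^sup>+\<^sup>1\<close>.\<close>

definition "S = mat_of (\<lambda>i j. Abs_fps (\<lambda>h. \<Sum>q\<le>h. fps_nth (P q $ i $ j) h))"

lemma S_partial: "h < N \<Longrightarrow> fps_nth (\<Sum>q<N. P q $ i $ j) h = fps_nth (S $ i $ j) h"
  by (auto simp: S_def fps_sum_nth intro!: sum.mono_neutral_right) (metis P_vanish nat_le_linear)

lemma S_recursion: "S = P 0 + U ** S"
  unfolding vec_eq_iff
proof (intro allI fps_ext)
  fix i j h
  have "fps_nth ((U ** S) $ i $ j) h = (\<Sum>k\<in>UNIV. fps_nth (S $ k $ j * U $ i $ k) h)"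
    by (simp add: matrix_mul_nth fps_sum_nth mult.commute)
  also have "\<dots> = (\<Sum>k\<in>UNIV. fps_nth ((\<Sum>q<Suc h. P q $ k $ j) * U $ i $ k) h)"
    by (intro sum.cong refl fps_mult_nth_cong) (rule S_partial[symmetric], simp)
  also have "\<dots> = fps_nth (\<Sum>q<Suc h. \<Sum>k\<in>UNIV. P q $ k $ j * U $ i $ k) h"
    unfolding fps_sum_nth[symmetric] sum_distrib_right by (subst sum.swap) simp
  also have "\<dots> = fps_nth (\<Sum>q<Suc h. P (Suc q) $ i $ j) h"
    by (simp add: P_Suc matrix_mul_nth mult.commute)
  finally show "fps_nth (S $ i $ j) h = fps_nth ((P 0 + U ** S) $ i $ j) h"
    using S_partial[of h "Suc (Suc h)" i j]
    by (simp add: sum.lessThan_Suc_shift[of _ "Suc h"] del: sum.lessThan_Suc)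
qed

definition "Obar = B - S"

text \<open>The recursion \<open>S = P\<^sub>0 + U S\<close> turns into \<open>(1 - U) (\<omega>\<^sup>- - S) = \<omega>\<^sup>-\<close>.\<close>

lemma Om_Obar: "(W + Al) ** Obar = mat 1"
proof -
  have "Obar = B + U ** Obar"
    unfolding Obar_def matrix_mul_diff_right by (subst S_recursion) (simp add: P_0)
  then have "W ** Obar = W ** B + W ** U ** Obar"
    by (metis matrix_add_ldistrib matrix_mul_assoc)
  moreover have "W ** U = - Al"
    by (simp add: U_def matrix_mul_uminus_right matrix_mul_assoc W_B)
  ultimately show ?thesis
    by (simp add: W_B matrix_mul_uminus_left matrix_add_rdistrib)
qed

text \<open>Transposing the previous equation produces a left inverse. This proves at once that the inverse is
  two-sided and that it is antisymmetric.\<close>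

lemma transpose_Obar_Om: "transpose Obar ** (W + Al) = - mat 1"
proof -
  have "transpose (W + Al) = - (W + Al)"
    by (simp add: transpose_add transpose_W transpose_Al)
  moreover have "transpose ((W + Al) ** Obar) = transpose (mat 1)" by (simp add: Om_Obar)
  ultimately have "- (transpose Obar ** (W + Al)) = mat 1"
    by (simp only: matrix_transpose_mul matrix_mul_uminus_right transpose_mat)
  then show ?thesis by (metis minus_minus)
qed

lemma transpose_Obar: "transpose Obar = - Obar"
proof -
  have "transpose Obar ** ((W + Al) ** Obar) = - mat 1 ** Obar"
    by (simp only: matrix_mul_assoc transpose_Obar_Om)
  then show ?thesis by (simp add: Om_Obar matrix_mul_uminus_left)
qed

lemma Obar_Om: "Obar ** (W + Al) = mat 1"
  using transpose_Obar_Om by (simp only: transpose_Obar matrix_mul_uminus_left neg_equal_iff_equal)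

lemma tensor_inverse_deformed: "tensor_inverse (\<lambda>i j. \<omega> i j + \<alpha> i j) = (\<lambda>i j. Obar $ i $ j)"
  using arg_cong[OF Om_Obar, of "\<lambda>M. M $ _ $ _"] arg_cong[OF Obar_Om, of "\<lambda>M. M $ _ $ _"]
  by (intro tensor_inverse_eqI) (simp_all add: matrix_mul_nth mat_def)

lemma suminf_diamonds:
  "suminf (\<lambda>q. bivector_apply (diamond_power \<omega> \<alpha>bar (Suc q)) u v)
    = bivector_apply \<omega>bar u v - bivector_apply (\<lambda>i j. Obar $ i $ j) u v"
proof -
  have "suminf (\<lambda>q. bivector_apply (diamond_power \<omega> \<alpha>bar (Suc q)) u v) = bivector_apply (\<lambda>i j. S $ i $ j) u v"
  proof (rule suminf_fps_eqI)
    fix N h :: nat assume h: "h < N"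
    have "(\<Sum>q<N. bivector_apply (diamond_power \<omega> \<alpha>bar (Suc q)) u v)
      = (\<Sum>i\<in>UNIV. \<Sum>j\<in>UNIV. (\<Sum>q<N. P q $ i $ j) * (u i * v j))"
    proof -
      have "(\<Sum>q<N. bivector_apply (diamond_power \<omega> \<alpha>bar (Suc q)) u v)
        = (\<Sum>q<N. \<Sum>i\<in>UNIV. \<Sum>j\<in>UNIV. P q $ i $ j * (u i * v j))"
        by (simp add: bivector_apply_def P_def mult.assoc)
      also have "\<dots> = (\<Sum>i\<in>UNIV. \<Sum>q<N. \<Sum>j\<in>UNIV. P q $ i $ j * (u i * v j))"
        by (rule sum.swap)
      also have "\<dots> = (\<Sum>i\<in>UNIV. \<Sum>j\<in>UNIV. \<Sum>q<N. P q $ i $ j * (u i * v j))"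
        by (rule sum.cong[OF refl], rule sum.swap)
      finally show ?thesis by (simp add: sum_distrib_right)
    qed
    moreover have "fps_nth ((\<Sum>q<N. P q $ i $ j) * (u i * v j)) h = fps_nth (S $ i $ j * (u i * v j)) h" for i j
      by (rule fps_mult_nth_cong) (rule S_partial, use h in simp)
    ultimately show "fps_nth (\<Sum>q<N. bivector_apply (diamond_power \<omega> \<alpha>bar (Suc q)) u v) h
      = fps_nth (bivector_apply (\<lambda>i j. S $ i $ j) u v) h"
      by (simp add: fps_sum_nth bivector_apply_def mult.assoc)
  qed
  then show ?thesis
    by (simp add: Obar_def bivector_apply_def left_diff_distrib sum_subtractf)
qed

end

section \<open>The star product in the flat case with constant Weyl curvature\<close>

text \<open>The element \<open>c\<^sub>i y\<^sup>i\<close> of the Weyl algebra.\<close>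

definition ylin :: "('n::finite \<Rightarrow> 'a::comm_ring_1 fps) \<Rightarrow> ('n, 'a) weyl" where
  "ylin c m = (\<Sum>i\<in>UNIV. ymul i (wconst (c i)) m)"

lemma ymul_wconst: "ymul i (wconst s) m = (if m = {#i#} then s else 0)"
proof -
  have "i \<in># m \<and> m - {#i#} = {#} \<longleftrightarrow> m = {#i#}" by (auto dest!: multi_member_split)
  then show ?thesis by (auto simp: ymul_def wconst_def)
qed

lemma ylin_single [simp]: "ylin c {#i#} = c i"
  by (simp add: ylin_def ymul_wconst eq_commute[of i])

lemma ylin_size: "size m \<noteq> 1 \<Longrightarrow> ylin c m = 0"
  by (auto simp: ylin_def ymul_wconst intro!: sum.neutral)

lemma ylin_add: "ylin (\<lambda>i. a i + b i) m = ylin a m + ylin b m"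
proof (cases "size m = 1")
  case True
  then obtain i where "m = {#i#}" using size_1_singleton_mset by blast
  then show ?thesis by simp
qed (simp add: ylin_size)

lemma dy_wconst: "dy p (wconst s) = (\<lambda>m. 0)"
  by (rule ext) (simp add: dy_def wconst_def)

lemma wconst_0: "wconst 0 = (\<lambda>m. 0)"
  by (rule ext) (simp add: wconst_def)

lemma dy_ylin: "dy p (ylin c) = wconst (c p)"
proof
  fix m
  have "ymul i (dy p (wconst (c i))) m = 0" for i by (simp add: dy_wconst ymul_def)
  then show "dy p (ylin c) m = wconst (c p) m"
    by (simp add: ylin_def[abs_def] dy_sum dy_ymul)
qed

lemma fps_map_ylin: "Modules.additive D \<Longrightarrow> fps_map D (ylin c m) = ylin (\<lambda>i. fps_map D (c i)) m"
proof -
  assume "Modules.additive D"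
  then interpret Modules.additive "fps_map D" by (rule additive_fps_map)
  show ?thesis by (simp add: ylin_def sum ymul_wconst if_distrib[of "fps_map D"] zero cong: if_cong)
qed

lemma ylin_0: "ylin (\<lambda>i. 0) m = 0"
  by (simp add: ylin_def wconst_0 ymul_def)

lemma weyl_mult_wconst_left: "weyl_mult (wconst s) a m = s * a m"
proof -
  have "weyl_mult (wconst s) a m = (\<Sum>m'\<in>{{#}}. s * a (m - m'))"
    unfolding weyl_mult_def wconst_def
    by (rule sum.mono_neutral_cong_right) (auto simp: finite_submultisets)
  then show ?thesis by simp
qed

lemma bidiff_wconst_left: "bidiff wbar n (wconst s) a m = (if n = 0 then s * a m else 0)"
  by (cases n) (simp_all add: weyl_mult_wconst_left dy_wconst bidiff_zero_left)

lemma bidiff_ylin_left: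
  "bidiff wbar (Suc n) (ylin c) a m =
     (if n = 0 then \<Sum>p\<in>UNIV. \<Sum>q\<in>UNIV. wbar p q * (c p * dy q a m) else 0)"
  by (simp add: dy_ylin bidiff_wconst_left)

lemma circ_two_terms:
  assumes \<iota>: "ring_map \<iota>" and vanish: "\<And>n. 2 \<le> n \<Longrightarrow> bidiff wbar n a b m = 0"
  shows "circ \<iota> wbar a b m = bidiff wbar 0 a b m + fps_const (\<iota> (- \<i> / 2)) * fps_X * bidiff wbar 1 a b m"
proof (rule fps_ext)
  interpret ring_map \<iota> by (rule \<iota>)
  fix h
  have "fps_nth (circ \<iota> wbar a b m) h = (\<Sum>n\<in>{..h} \<inter> {0, 1}. \<iota> (- \<i> / 2) ^ n * \<iota> (1 / fact n) * fps_nth (bidiff wbar n a b m) (h - n))"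
    unfolding circ_nth
  proof (rule sum.mono_neutral_right)
    show "\<forall>n\<in>{..h} - {..h} \<inter> {0, 1}. \<iota> (- \<i> / 2) ^ n * \<iota> (1 / fact n) * fps_nth (bidiff wbar n a b m) (h - n) = 0"
    proof
      fix n assume "n \<in> {..h} - {..h} \<inter> {0, 1}"
      then have "2 \<le> n" by (cases n rule: nat.exhaust) (auto simp: Suc_le_eq)
      then show "\<iota> (- \<i> / 2) ^ n * \<iota> (1 / fact n) * fps_nth (bidiff wbar n a b m) (h - n) = 0"
        by (simp add: vanish)
    qed
  qed auto
  also have "\<dots> = fps_nth (bidiff wbar 0 a b m + fps_const (\<iota> (- \<i> / 2)) * fps_X * bidiff wbar 1 a b m) h"
  proof (cases h)
    case 0
    then have "{..h} \<inter> {0, 1} = {0}" by auto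
    then show ?thesis using 0 by (simp add: map_1 mult.assoc)
  next
    case (Suc h')
    then have "{..h} \<inter> {0, 1} = {0, 1}" by auto
    then show ?thesis using Suc by (simp add: map_1 mult.assoc)
  qed
  finally show "fps_nth (circ \<iota> wbar a b m) h =
    fps_nth (bidiff wbar 0 a b m + fps_const (\<iota> (- \<i> / 2)) * fps_X * bidiff wbar 1 a b m) h" .
qed

lemma delta_inv1_wconst:
  assumes "ring_map \<iota>"
  shows "delta_inv1 \<iota> (\<lambda>k. wconst (s k)) m = ylin s m"
proof (cases "size m = 1")
  case True
  then show ?thesis
    unfolding delta_inv1_ymul by (simp add: ylin_def ring_map.map_1[OF assms])
next
  case False
  then have "(\<Sum>k\<in>UNIV. ymul k (wconst (s k)) m) = 0" using ylin_size by (simp add: ylin_def)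
  then show ?thesis using False by (simp add: delta_inv1_ymul ylin_size)
qed

lemma delta_inv2_wconst:
  "delta_inv2 \<iota> (\<lambda>k l. wconst (s k l)) j m = ylin (\<lambda>i. fps_const (\<iota> (1 / 2)) * s i j) m"
proof (cases "size m = 1")
  case True
  then show ?thesis
    unfolding delta_inv2_ymul by (simp add: ylin_def wconst_mult[abs_def] ymul_smult sum_distrib_left)
next
  case False
  then have "(\<Sum>k\<in>UNIV. ymul k (wconst (s k j)) m) = 0" using ylin_size[of m] by (simp add: ylin_def)
  then show ?thesis using False by (simp add: delta_inv2_ymul ylin_size)
qed

text \<open>Fedosov's recursions without curvature and with constant \<open>\<alpha>\<close>: the derivations \<open>d k\<close> annihilate all
  coefficients and act on functions only.\<close>

locale flat_fedosov = deformed_symplectic \<omega> \<omega>bar \<alpha>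
  for \<omega> \<omega>bar \<alpha> :: "'n::finite \<Rightarrow> 'n \<Rightarrow> 'a::comm_ring_1 fps" +
  fixes \<iota> :: "complex \<Rightarrow> 'a" and d :: "'n \<Rightarrow> 'a \<Rightarrow> 'a"
  assumes \<iota>: "ring_map \<iota>"
    and d: "derivation (d k)"
    and d_scalar: "d k (\<iota> z) = 0"
    and d_\<omega>: "fps_map (d k) (\<omega> i j) = 0"
    and d_\<omega>bar: "fps_map (d k) (\<omega>bar i j) = 0"
    and d_\<alpha>: "fps_map (d k) (\<alpha> i j) = 0"
begin

sublocale \<iota>: ring_map \<iota> by (rule \<iota>)

sublocale D: derivation "fps_map (d k)" for k by (rule derivation_fps_map[OF d])

text \<open>The commutator with a linear element has a single contraction. Its symmetric part cancels and its
  antisymmetric part doubles, so that \<open>(i/\<hbar>)[c\<^sub>i y\<^sup>i, \<sqdot>]\<close> is the vector field \<open>\<omega>\<^sup>-\<^sup>p\<^sup>q c\<^sub>p \<partial>/\<partial>y\<^sup>q\<close>.\<close>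

lemma commutator_ylin:
  "i_over_hbar \<iota> (circ \<iota> \<omega>bar (ylin c) a m - circ \<iota> \<omega>bar a (ylin c) m)
    = (\<Sum>p\<in>UNIV. \<Sum>q\<in>UNIV. \<omega>bar p q * (c p * dy q a m))"
proof -
  let ?s = "\<Sum>p\<in>UNIV. \<Sum>q\<in>UNIV. \<omega>bar p q * (c p * dy q a m)"
  have two: "bidiff w n (ylin c) a m = 0" if "2 \<le> n" for w n
    using that by (cases n) (auto simp: bidiff_ylin_left simp del: bidiff.simps)
  have 1: "circ \<iota> \<omega>bar (ylin c) a m = weyl_mult (ylin c) a m + fps_const (\<iota> (- \<i> / 2)) * fps_X * ?s"
    using circ_two_terms[OF \<iota>, of \<omega>bar "ylin c" a m] two bidiff_ylin_left[of \<omega>bar 0 c a m] by simp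
  have neg: "(\<Sum>p\<in>UNIV. \<Sum>q\<in>UNIV. \<omega>bar q p * (c p * dy q a m)) = - ?s"
    unfolding sum_negf[symmetric] by (intro sum.cong refl) (subst \<omega>bar_antisym, simp)
  have 0: "bidiff \<omega>bar 0 a (ylin c) m = weyl_mult (ylin c) a m"
    by (simp add: weyl_mult_commute)
  have flip1: "bidiff \<omega>bar 1 a (ylin c) m = - ?s"
    unfolding One_nat_def bidiff_flip[of \<omega>bar "Suc 0" a] bidiff_ylin_left by (simp add: neg)
  have two': "bidiff \<omega>bar n a (ylin c) m = 0" if "2 \<le> n" for n
    unfolding bidiff_flip[of \<omega>bar n a] by (rule two) (rule that)
  have 2: "circ \<iota> \<omega>bar a (ylin c) m = weyl_mult (ylin c) a m + fps_const (\<iota> (- \<i> / 2)) * fps_X * - ?s"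
    using circ_two_terms[OF \<iota>, of \<omega>bar a "ylin c" m] two' by (simp only: 0 flip1)
  have half: "\<iota> \<i> * (\<iota> (- \<i> / 2) + \<iota> (- \<i> / 2)) = 1"
  proof -
    have "\<iota> \<i> * (\<iota> (- \<i> / 2) + \<iota> (- \<i> / 2)) = \<iota> (\<i> * (- \<i> / 2 + - \<i> / 2))"
      by (simp only: \<iota>.map_mult \<iota>.map_add)
    also have "\<i> * (- \<i> / 2 + - \<i> / 2) = 1" by (simp add: field_simps)
    finally show ?thesis by (simp add: \<iota>.map_1)
  qed
  have "circ \<iota> \<omega>bar (ylin c) a m - circ \<iota> \<omega>bar a (ylin c) m
      = fps_X * (fps_const (\<iota> (- \<i> / 2) + \<iota> (- \<i> / 2)) * ?s)"
  proof -
    have "(x + k * fps_X * s) - (x + k * fps_X * - s) = fps_X * ((k + k) * s)" for x k s :: "'a fps"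
      by (simp add: algebra_simps)
    then show ?thesis unfolding 1 2 fps_const_add[symmetric] .
  qed
  then have "i_over_hbar \<iota> (circ \<iota> \<omega>bar (ylin c) a m - circ \<iota> \<omega>bar a (ylin c) m)
      = fps_const (\<iota> \<i> * (\<iota> (- \<i> / 2) + \<iota> (- \<i> / 2))) * ?s"
    by (simp add: fps_eq_iff i_over_hbar_def mult.assoc)
  then show ?thesis unfolding half by simp
qed

abbreviation "flat_source \<equiv> source_form \<iota> (\<lambda>i j k l. 0) \<alpha>"
abbreviation "flat_r \<equiv> r_solution \<iota> \<omega>bar flat_source d"

lemma flat_source_eq: "flat_source k l m = wconst (\<alpha> k l) m"
proof -
  have h: "fps_const (\<iota> (1 / 2)) * \<alpha> k l - fps_const (\<iota> (1 / 2)) * \<alpha> l k = \<alpha> k l"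
  proof -
    have "fps_const (\<iota> (1 / 2)) * \<alpha> k l - fps_const (\<iota> (1 / 2)) * \<alpha> l k
      = fps_const (\<iota> (1 / 2) + \<iota> (1 / 2)) * \<alpha> k l"
      by (subst \<alpha>_antisym[of l k])
        (simp only: fps_const_add[symmetric] mult_minus_right diff_minus_eq_add distrib_right)
    also have "\<iota> (1 / 2) + \<iota> (1 / 2) = \<iota> (1 / 2 + 1 / 2)" by (simp only: \<iota>.map_add)
    also have "\<dots> = 1" by (simp add: \<iota>.map_1)
    finally show ?thesis by simp
  qed
  show ?thesis by (simp add: source_form_def wedge2_def wconst_def h cong: if_cong)
qed

text \<open>The commutator of two linear elements is a scalar, and \<open>\<delta>\<^sup>-\<^sup>1\<close> of a scalar 2-form is linear again:
  linear forms with constant coefficients are stable under the recursion.\<close>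

lemma r_rhs_ylin:
  assumes "\<And>k i j. fps_map (d k) (c i j) = 0"
  shows "r_rhs \<iota> \<omega>bar flat_source (\<lambda>k l m. fps_map (d k) (ylin (\<lambda>i. c i l) m)) (\<lambda>l. ylin (\<lambda>i. c i l)) j m
    = ylin (\<lambda>i. fps_const (\<iota> (1 / 2)) * (\<alpha> i j + (\<Sum>p\<in>UNIV. \<Sum>q\<in>UNIV. \<omega>bar p q * (c p i * c q j)))) m"
proof -
  have d0: "fps_map (d k) (ylin (\<lambda>i. c i l) m) = 0" for k l m
    by (simp add: fps_map_ylin[OF derivation_additive[OF d]] assms ylin_0)
  have "i_over_hbar \<iota> (wedge2 (\<lambda>k l. circ \<iota> \<omega>bar (ylin (\<lambda>i. c i k)) (ylin (\<lambda>i. c i l))) k l m)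
      = wconst (\<Sum>p\<in>UNIV. \<Sum>q\<in>UNIV. \<omega>bar p q * (c p k * c q l)) m" for k l m
    unfolding wedge2_def commutator_ylin by (simp add: dy_ylin wconst_sum wconst_mult)
  then have "r_rhs \<iota> \<omega>bar flat_source (\<lambda>k l m. fps_map (d k) (ylin (\<lambda>i. c i l) m)) (\<lambda>l. ylin (\<lambda>i. c i l)) j m
      = delta_inv2 \<iota> (\<lambda>k l. wconst (\<alpha> k l)) j m
      + delta_inv2 \<iota> (\<lambda>k l. wconst (\<Sum>p\<in>UNIV. \<Sum>q\<in>UNIV. \<omega>bar p q * (c p k * c q l))) j m"
    by (simp add: r_rhs_def flat_source_eq[abs_def] d0 wedge2_def[of "\<lambda>k l m. 0"])
  then show ?thesis
    unfolding delta_inv2_wconst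
    by (simp only: distrib_left ylin_add)
qed

definition C :: "'n \<Rightarrow> 'n \<Rightarrow> 'a fps" where
  "C i j = flat_r j {#i#}"

lemma flat_r_iter:
  "\<exists>c. r_iter \<iota> \<omega>bar flat_source d N = (\<lambda>l. ylin (\<lambda>i. c i l)) \<and> (\<forall>k i j. fps_map (d k) (c i j) = 0)"
proof (induction N)
  case 0
  show ?case by (rule exI[of _ "\<lambda>_ _. 0"]) (simp add: r_iter_0 fun_eq_iff ylin_0 D.zero)
next
  case (Suc N)
  then obtain c where c: "r_iter \<iota> \<omega>bar flat_source d N = (\<lambda>l. ylin (\<lambda>i. c i l))"
    and dc: "\<And>k i j. fps_map (d k) (c i j) = 0" by blast
  have "fps_map (d k) (fps_const (\<iota> (1 / 2))) = 0" for k
    by (simp add: fps_map_const[OF derivation_additive[OF d]] d_scalar)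
  then show ?case
    unfolding r_iter_Suc c
    by (intro exI[of _ "\<lambda>i j. fps_const (\<iota> (1 / 2)) * (\<alpha> i j + (\<Sum>p\<in>UNIV. \<Sum>q\<in>UNIV. \<omega>bar p q * (c p i * c q j)))"])
      (simp add: fun_eq_iff r_rhs_ylin[OF dc] D.leibniz D.add D.sum dc d_\<alpha> d_\<omega>bar)
qed

lemma flat_r_eq: "flat_r = (\<lambda>j. ylin (\<lambda>i. C i j))"
proof (intro ext fps_ext)
  fix j :: 'n and m :: "'n multiset" and h
  obtain c where c: "r_iter \<iota> \<omega>bar flat_source d (2 * h + size m) = (\<lambda>l. ylin (\<lambda>i. c i l))"
    using flat_r_iter by blast
  show "fps_nth (flat_r j m) h = fps_nth (ylin (\<lambda>i. C i j) m) h"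
  proof (cases "size m = 1")
    case True
    then obtain i where "m = {#i#}" using size_1_singleton_mset by blast
    then show ?thesis by (simp add: C_def)
  next
    case False
    then show ?thesis by (simp add: r_solution_def c ylin_size)
  qed
qed

lemma d_C: "fps_map (d k) (C i j) = 0"
proof (rule fps_ext)
  fix h
  obtain c where c: "r_iter \<iota> \<omega>bar flat_source d (2 * h + size {#i#}) = (\<lambda>l. ylin (\<lambda>i. c i l))"
    "\<And>k i j. fps_map (d k) (c i j) = 0"
    using flat_r_iter by blast
  have "fps_nth (fps_map (d k) (C i j)) h = fps_nth (fps_map (d k) (c i j)) h"
    using c(1) by (simp add: C_def r_solution_def)
  then show "fps_nth (fps_map (d k) (C i j)) h = fps_nth 0 h" using c(2) by simp
qed

lemma deg_ge_flat_r: "deg_ge 3 (flat_r j)"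
  by (rule deg_ge_r_solution[OF derivation_additive[OF d]]) (rule deg_ge_source_form, rule \<alpha>_0)

lemma C_equation: "C i j = fps_const (\<iota> (1 / 2)) * (\<alpha> i j + (\<Sum>p\<in>UNIV. \<Sum>q\<in>UNIV. \<omega>bar p q * (C p i * C q j)))"
proof -
  have "flat_r j {#i#} = r_rhs \<iota> \<omega>bar flat_source (\<lambda>k l m. fps_map (d k) (flat_r l m)) flat_r j {#i#}"
    by (rule r_solution_fixed[OF derivation_additive[OF d]]) (rule deg_ge_source_form, rule \<alpha>_0)
  then show ?thesis unfolding flat_r_eq r_rhs_ylin[OF d_C] by simp
qed

abbreviation "CM \<equiv> mat_of C"

lemma CM_equation: "CM + CM = Al + transpose CM ** B ** CM"
proof -
  have "C i j + C i j = \<alpha> i j + (\<Sum>p\<in>UNIV. \<Sum>q\<in>UNIV. \<omega>bar p q * (C p i * C q j))" for i j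
  proof -
    have "fps_const (\<iota> (1 / 2)) + fps_const (\<iota> (1 / 2)) = fps_const (\<iota> (1 / 2 + 1 / 2))"
      by (simp only: \<iota>.map_add fps_const_add)
    also have "\<dots> = 1" by (simp add: \<iota>.map_1)
    finally have h: "fps_const (\<iota> (1 / 2)) + fps_const (\<iota> (1 / 2)) = (1 :: 'a fps)" .
    show ?thesis
      by (subst (1 2) C_equation) (simp only: distrib_right[symmetric] h mult_1)
  qed
  then show ?thesis
    by (simp add: vec_eq_iff matrix_mul3_nth transpose_def ac_simps)
qed

lemma transpose_CM: "transpose CM = - CM"
proof -
  have antisym: "C j i = - C i j" for i j
  proof -
    have "(\<Sum>p\<in>UNIV. \<Sum>q\<in>UNIV. \<omega>bar p q * (C p j * C q i)) = - (\<Sum>p\<in>UNIV. \<Sum>q\<in>UNIV. \<omega>bar p q * (C p i * C q j))"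
    proof -
      have "(\<Sum>p\<in>UNIV. \<Sum>q\<in>UNIV. \<omega>bar p q * (C p j * C q i)) = (\<Sum>q\<in>UNIV. \<Sum>p\<in>UNIV. \<omega>bar p q * (C p j * C q i))"
        by (rule sum.swap)
      also have "\<dots> = (\<Sum>q\<in>UNIV. \<Sum>p\<in>UNIV. - (\<omega>bar q p * (C q i * C p j)))"
        by (intro sum.cong refl) (subst \<omega>bar_antisym, simp add: ac_simps)
      finally show ?thesis by (simp add: sum_negf)
    qed
    then show ?thesis
      by (subst (1 2) C_equation, subst \<alpha>_antisym) (simp flip: mult_minus_right)
  qed
  show ?thesis unfolding vec_eq_iff by (auto simp: transpose_def intro: antisym)
qed

text \<open>This is the quadratic equation for \<open>C\<close>, multiplied out. In other words,
  \<open>(1 + \<omega>\<^sup>- C)\<^sup>2 = \<omega>\<^sup>- \<Omega>\<close>.\<close>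

lemma square_root: "(W + CM) ** B ** (W + CM) = W + Al"
proof -
  have "(W + CM) ** B ** (W + CM) = W + (CM + CM + CM ** B ** CM)"
    by (simp add: matrix_add_ldistrib matrix_add_rdistrib W_B B_W add_ac flip: matrix_mul_assoc)
  also have "CM + CM + CM ** B ** CM = Al"
    unfolding CM_equation by (simp add: transpose_CM matrix_mul_uminus_left)
  finally show ?thesis .
qed

text \<open>The linear part of the lift of \<open>f\<close> will be \<open>M df\<close>. The matrix is the inverse of \<open>1 + C \<omega>\<^sup>-\<close>, written
  with the help of \<open>square_root\<close> such that no other inverse than that of \<open>\<Omega>\<close> is needed.\<close>

definition "M = (W + CM) ** Obar"

lemma M_equation: "M + CM ** B ** M = mat 1"
proof -
  have "M + CM ** B ** M = (W + CM) ** B ** (W + CM) ** Obar"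
    by (simp add: M_def matrix_add_rdistrib matrix_add_ldistrib W_B matrix_mul_assoc)
  then show ?thesis by (simp add: square_root Om_Obar)
qed

lemma M_congruence: "transpose M ** B ** M = Obar"
proof -
  have "transpose (W + CM) = - (W + CM)"
    by (simp add: transpose_add transpose_W transpose_CM)
  then have "transpose M ** B ** M = Obar ** ((W + CM) ** B ** (W + CM)) ** Obar"
    by (simp only: M_def matrix_transpose_mul transpose_Obar matrix_mul_uminus_left matrix_mul_uminus_right
      minus_minus matrix_mul_assoc)
  then show ?thesis
    by (simp add: square_root Obar_Om)
qed

lemma d_matrix_mul:
  assumes "\<And>i j. fps_map (d k) (A $ i $ j) = 0" "\<And>i j. fps_map (d k) (A' $ i $ j) = 0"
  shows "fps_map (d k) ((A ** A') $ i $ j) = 0"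
  unfolding matrix_mul_nth D.sum D.leibniz by (simp add: assms)

lemma d_U: "fps_map (d k) (U $ i $ j) = 0"
  unfolding U_def vector_uminus_component D.minus by (simp add: d_matrix_mul d_\<omega>bar d_\<alpha>)

lemma d_P: "fps_map (d k) (P q $ i $ j) = 0"
proof (induction q arbitrary: i j)
  case 0
  show ?case unfolding P_0 vector_uminus_component D.minus by (simp add: d_matrix_mul d_U d_\<omega>bar)
next
  case (Suc q)
  show ?case unfolding P_Suc by (rule d_matrix_mul[OF d_U Suc.IH])
qed

lemma d_Obar: "fps_map (d k) (Obar $ i $ j) = 0"
proof -
  have "d k (fps_nth (P q $ i $ j) h) = 0" for q h
    using d_P[of k q i j] by (simp add: fps_eq_iff)
  then have "fps_map (d k) (S $ i $ j) = 0"
    by (simp add: fps_eq_iff S_def Modules.additive.sum[OF derivation_additive[OF d]])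
  then show ?thesis by (simp add: Obar_def D.diff d_\<omega>bar)
qed

text \<open>Since second derivatives of \<open>f\<close> vanish, the candidate \<open>f + y\<^sup>i (M df)\<^sub>i\<close> solves the recursion as
  soon as its linear part does, which is the equation \<open>M + C \<omega>\<^sup>- M = 1\<close> applied to \<open>df\<close>.\<close>

lemma flat_lift:
  assumes df: "\<And>k l. d k (d l f) = 0"
  shows "lift_solution \<iota> \<omega>bar flat_r d f m
    = wconst (fps_const f) m + ylin (\<lambda>i. (M *v (\<chi> k. fps_const (d k f))) $ i) m"
proof -
  define a1 where "a1 i = (M *v (\<chi> k. fps_const (d k f))) $ i" for i
  define a where "a = (\<lambda>m. wconst (fps_const f) m + ylin a1 m)"
  have fdf: "fps_map (d k) (fps_const (d l f)) = 0" for k l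
    by (simp add: fps_map_const[OF derivation_additive[OF d]] df)
  have da1: "fps_map (d k) (a1 i) = 0" for k i
  proof -
    have "fps_map (d k) ((W + CM) $ i $ j) = 0" for i j
      unfolding vector_add_component D.add by (simp add: d_C d_\<omega>)
    from d_matrix_mul[OF this d_Obar] show ?thesis
      unfolding a1_def matrix_vector_mult_def vec_lambda_beta D.sum D.leibniz fdf M_def by simp
  qed
  have dya: "dy q a = wconst (a1 q)" for q
    by (simp add: a_def dy_add dy_wconst dy_ylin)
  have da: "fps_map (d k) (a m) = wconst (fps_const (d k f)) m" for k m
  proof -
    have "fps_map (d k) (wconst (fps_const f) m) = wconst (fps_const (d k f)) m"
      by (simp add: wconst_def fps_map_const[OF derivation_additive[OF d]] D.zero)
    then show ?thesis
      by (simp add: a_def D.add fps_map_ylin[OF derivation_additive[OF d]] da1 ylin_0)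
  qed
  have eq: "fps_const (d k f) + (\<Sum>p\<in>UNIV. \<Sum>q\<in>UNIV. \<omega>bar p q * (C p k * a1 q)) = a1 k" for k
  proof -
    let ?F = "\<chi> k. fps_const (d k f)"
    have "(M + CM ** B ** M) *v ?F = ?F" by (simp add: M_equation)
    then have "(M *v ?F + CM *v (B *v (M *v ?F))) $ k = ?F $ k"
      by (simp add: matrix_vector_mult_add_rdistrib matrix_vector_mul_assoc matrix_mul_assoc)
    then have "a1 k + (\<Sum>p\<in>UNIV. C k p * (\<Sum>q\<in>UNIV. \<omega>bar p q * a1 q)) = fps_const (d k f)"
      by (simp add: a1_def matrix_vector_mult_def[of CM] matrix_vector_mult_def[of B])
    moreover have "C p k = - C k p" for p
      using arg_cong[OF transpose_CM, of "\<lambda>M. M $ k $ p"] by (simp add: transpose_def)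
    ultimately show ?thesis
      by (simp add: sum_distrib_left sum_negf algebra_simps)
  qed
  have "lift_rhs \<iota> \<omega>bar flat_r f (\<lambda>k m. fps_map (d k) (a m)) a m = a m" for m
  proof -
    have "i_over_hbar \<iota> (circ \<iota> \<omega>bar (flat_r k) a m - circ \<iota> \<omega>bar a (flat_r k) m)
        = wconst (\<Sum>p\<in>UNIV. \<Sum>q\<in>UNIV. \<omega>bar p q * (C p k * a1 q)) m" for k m
      unfolding flat_r_eq commutator_ylin dya by (simp add: wconst_sum wconst_mult)
    then have "lift_rhs \<iota> \<omega>bar flat_r f (\<lambda>k m. fps_map (d k) (a m)) a m
        = wconst (fps_const f) m + delta_inv1 \<iota> (\<lambda>k. wconst (a1 k)) m"
      by (simp add: lift_rhs_def da eq flip: wconst_add) (simp add: wconst_def)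
    then show ?thesis by (simp add: delta_inv1_wconst[OF \<iota>] a_def)
  qed
  from lift_solution_unique[OF derivation_additive[OF d] deg_ge_flat_r this[symmetric]]
  show ?thesis by (simp add: a_def a1_def[abs_def])
qed

text \<open>Only the first two terms of the Moyal product contribute, since the lifts are linear in \<open>y\<close>.\<close>

lemma flat_star:
  assumes df: "\<And>k l. d k (d l f) = 0" and dg: "\<And>k l. d k (d l g) = 0"
  shows "circ \<iota> \<omega>bar (lift_solution \<iota> \<omega>bar flat_r d f) (lift_solution \<iota> \<omega>bar flat_r d g) {#}
    = fps_const (f * g) + fps_const (\<iota> (- \<i> / 2)) * fps_X *
      bivector_apply (\<lambda>i j. Obar $ i $ j) (\<lambda>i. fps_const (d i f)) (\<lambda>i. fps_const (d i g))"
proof -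
  let ?F = "\<chi> k. fps_const (d k f)" and ?G = "\<chi> k. fps_const (d k g)"
  define a where "a = (\<lambda>m. wconst (fps_const f) m + ylin (\<lambda>i. (M *v ?F) $ i) m)"
  define b where "b = (\<lambda>m. wconst (fps_const g) m + ylin (\<lambda>i. (M *v ?G) $ i) m)"
  have lift: "lift_solution \<iota> \<omega>bar flat_r d f = a" "lift_solution \<iota> \<omega>bar flat_r d g = b"
    using flat_lift[OF df] flat_lift[OF dg] by (auto simp: a_def b_def)
  have dy: "dy i a = wconst ((M *v ?F) $ i)" "dy i b = wconst ((M *v ?G) $ i)" for i
    by (simp_all add: a_def b_def dy_add dy_wconst dy_ylin)
  have b0: "bidiff \<omega>bar 0 a b {#} = fps_const (f * g)"
    by (simp add: a_def b_def weyl_mult_def wconst_def ylin_size)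
  have b1: "bidiff \<omega>bar 1 a b {#} = bivector_apply \<omega>bar (\<lambda>i. (M *v ?F) $ i) (\<lambda>i. (M *v ?G) $ i)"
    by (simp add: dy bidiff_wconst_left weyl_mult_wconst_left bivector_apply_def wconst_def mult.assoc)
  have "bidiff \<omega>bar (Suc (Suc n)) a b {#} = 0" for n
    by (simp add: dy dy_wconst bidiff_zero_left)
  then have b2: "bidiff \<omega>bar n a b {#} = 0" if "2 \<le> n" for n
    using that by (metis Suc_le_D numeral_2_eq_2 Suc_le_mono)
  show ?thesis
    using circ_two_terms[OF \<iota>, of \<omega>bar a b "{#}"] b2
    by (simp only: lift b0 b1 bivector_apply_congruence M_congruence vec_lambda_beta)
qed

end

section \<open>The formula as a specialisation of the universal one\<close>

lemma econst_eq: "econst = poly_const"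
  by (rule ext) (simp add: econst_def poly_const_def)

lemma sym_eq: "sym = poly_var"
  by (rule ext) (simp add: sym_def poly_var_def)

lemma ring_map_econst: "ring_map econst"
  unfolding econst_eq by (rule ring_map_poly_const)

lemma expr_deriv_eq: "expr_deriv k = poly_deriv (\<lambda>s. sym (symbol_deriv k s))"
proof
  fix P
  have "Poly_Mapping.single (add_mset (symbol_deriv k s) (m - {#s#})) 1
      = sym (symbol_deriv k s) * Poly_Mapping.single (m - {#s#}) (1::complex)" for m s
    by (simp add: monomial_add_mset sym_eq)
  then show "expr_deriv k P = poly_deriv (\<lambda>s. sym (symbol_deriv k s)) P"
    by (simp add: expr_deriv_def poly_deriv_def econst_eq)
qed

lemma derivation_expr_deriv: "derivation (expr_deriv k)"
  unfolding expr_deriv_eq by (rule derivation_poly_deriv)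

lemma expr_deriv_simps: "expr_deriv k (econst z) = 0" "expr_deriv k (sym s) = sym (symbol_deriv k s)"
  unfolding expr_deriv_eq econst_eq
  by (simp_all add: poly_deriv_const poly_deriv_var sym_eq)

lemma weyl_expr_deriv_eq: "weyl_expr_deriv k a m = fps_map (expr_deriv k) (a m)"
  by (simp add: weyl_expr_deriv_def fps_map_def)

lemma r_formula_eq:
  "r_formula w A = r_solution econst (const_matrix econst (tensor_inverse w))
     (source_form econst (\<lambda>i j k l. sym (RSym [] i j k l)) A) expr_deriv"
  by (intro ext) (simp add: r_formula_def r_solution_def r_iter_def weyl_expr_deriv_eq[abs_def])

lemma lift_formula_eq:
  "lift_formula w A f = lift_solution econst (const_matrix econst (tensor_inverse w)) (r_formula w A) expr_deriv f"
  by (intro ext) (simp add: lift_formula_def lift_solution_def lift_iter_def weyl_expr_deriv_eq[abs_def])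

text \<open>Substituting an actual symplectic matrix for the variables that represent its inverse turns the
  universal solution into the formula at a point.\<close>

definition specialise :: "('n::finite \<Rightarrow> 'n \<Rightarrow> real) \<Rightarrow> 'n universal \<Rightarrow> 'n expr" where
  "specialise w = poly_subst econst (case_sum sym (\<lambda>(i, j). econst (complex_of_real (tensor_inverse w i j))))"

lemma coefficient_map_specialise: "coefficient_map (specialise w) poly_const econst"
  unfolding coefficient_map_def specialise_def coefficient_map_axioms_def
  by (simp add: ring_map_poly_subst poly_subst_const ring_map_econst)

lemma specialise_simps [simp]:
  "specialise w (poly_const z) = econst z"
  "specialise w (u_sym s) = sym s"
  "specialise w (u_wbar i j) = econst (complex_of_real (tensor_inverse w i j))"
  by (simp_all add: specialise_def poly_subst_const poly_subst_var ring_map_econst)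

lemma specialise_deriv: "specialise w (u_deriv k P) = expr_deriv k (specialise w P)"
proof -
  interpret s: coefficient_map "specialise w" poly_const econst by (rule coefficient_map_specialise)
  interpret d: derivation "u_deriv k" by (rule derivation_u_deriv)
  interpret e: derivation "expr_deriv k" by (rule derivation_expr_deriv)
  show ?thesis
  proof (induction P rule: polynomial_induct)
    case (var v)
    show ?case
    proof (cases v)
      case (Inr ij)
      then show ?thesis by (cases ij) (simp add: expr_deriv_simps s.zero)
    qed (simp add: expr_deriv_simps)
  qed (simp_all add: expr_deriv_simps s.zero s.add s.map_mult d.add d.leibniz e.add e.leibniz)
qed

lemma specialise_r_solution:
  "fps_map (specialise w) (u_r A j m)
    = r_formula w (\<lambda>k l. fps_map (specialise w) (A k l)) j m"
proof -
  interpret s: coefficient_map "specialise w" poly_const econst by (rule coefficient_map_specialise)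
  show ?thesis
    by (simp add: s.r_solution_map[where d' = expr_deriv, OF specialise_deriv] r_formula_eq s.source_form_map
      fps_map_const[OF s.additive_axioms] const_matrix_def[abs_def])
qed

lemma specialise_lift_solution:
  "fps_map (specialise w) (u_lift A (u_sym s) m)
    = lift_formula w (\<lambda>k l. fps_map (specialise w) (A k l)) (sym s) m"
proof -
  interpret s: coefficient_map "specialise w" poly_const econst by (rule coefficient_map_specialise)
  show ?thesis
    by (simp add: s.lift_solution_map[where d' = expr_deriv, OF specialise_deriv] lift_formula_eq
      specialise_r_solution fps_map_const[OF s.additive_axioms] const_matrix_def[abs_def])
qed

lemma expr_value_eq: "expr_value v = poly_subst (\<lambda>z. z) v"
  by (rule ext) (simp add: expr_value_def poly_subst_def)

lemma ring_map_complex_id: "ring_map (\<lambda>z::complex. z)"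
  by unfold_locales simp_all

lemma coefficient_map_expr_value: "coefficient_map (expr_value v) econst (\<lambda>z. z)"
  unfolding coefficient_map_def expr_value_eq coefficient_map_axioms_def econst_eq
  by (simp add: ring_map_poly_subst poly_subst_const ring_map_complex_id)

lemma expr_value_simps [simp]: "expr_value v (econst z) = z" "expr_value v (sym s) = v s"
  unfolding expr_value_eq econst_eq sym_eq
  by (simp_all add: poly_subst_const poly_subst_var ring_map_complex_id)

definition u_alpha :: "'n \<Rightarrow> 'n \<Rightarrow> 'n universal fps" where
  "u_alpha i j = Abs_fps (\<lambda>k. if k = 0 then 0 else
     poly_const (1 / 2) * (u_sym (ASym k [] i j) - u_sym (ASym k [] j i)))"

lemma covariant_form_u_alpha: "covariant_form (u_alpha :: 'n::finite \<Rightarrow> _)"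
  unfolding covariant_form_def
proof (intro allI fps_ext)
  fix G :: "'n \<Rightarrow> 'n \<Rightarrow> complex" and k l :: 'n and h
  interpret L: derivation "u_lie G" by (rule derivation_u_lie)
  show "fps_nth (fps_map (u_lie G) (u_alpha k l)) h = fps_nth ((\<Sum>p\<in>UNIV. fps_const (poly_const (G p k)) * u_alpha p l)
      + (\<Sum>p\<in>UNIV. fps_const (poly_const (G p l)) * u_alpha k p)) h"
    by (simp add: u_alpha_def fps_sum_nth L.zero L.leibniz L.diff u_lie_A u_lie_simps(1) sum_distrib_left
      right_diff_distrib sum_subtractf distrib_left mult.left_commute)
qed

lemma specialise_u_alpha: "fps_map (specialise w) (u_alpha i j) = alpha_expr i j"
proof -
  interpret s: coefficient_map "specialise w" poly_const econst by (rule coefficient_map_specialise)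
  show ?thesis by (simp add: fps_eq_iff u_alpha_def alpha_expr_def s.zero s.map_mult s.diff)
qed

context chart_data
begin

lemma ev_eq: "ev x P = expr_value (symval x) (specialise (w x) P)"
proof (rule ring_map_eqI[where \<phi> = "ev x" and \<psi> = "\<lambda>P. expr_value (symval x) (specialise (w x) P)"])
  interpret s: coefficient_map "specialise (w x)" poly_const econst by (rule coefficient_map_specialise)
  interpret v: coefficient_map "expr_value (symval x)" econst "\<lambda>z. z" by (rule coefficient_map_expr_value)
  show "ring_map (ev x)" using coefficient_map_ev by (simp add: coefficient_map_def)
  show "ring_map (\<lambda>P. expr_value (symval x) (specialise (w x) P))"
    by unfold_locales (simp_all add: s.add v.add s.map_mult v.map_mult s.map_1 v.map_1)
  show "ev x (poly_var v) = expr_value (symval x) (specialise (w x) (poly_var v))" for v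
    by (cases v) (auto simp: winv_def)
qed simp

text \<open>The parameter \<open>A\<close> is the formal expression for \<open>\<Omega> - \<omega>\<close> and \<open>\<beta>\<close> its value. The choice \<open>A = 0\<close>
  covers the star product of trivial Weyl curvature.\<close>

lemma star_value:
  fixes A :: "'n \<Rightarrow> 'n \<Rightarrow> 'n universal fps"
  assumes A_cov: "covariant_form A"
    and A_0: "\<And>k l. fps_nth (A k l) 0 = 0"
    and ev_A: "\<And>x k l. x \<in> S \<Longrightarrow> fps_map (ev x) (A k l) = \<beta> x k l"
    and r3: "\<And>x j. x \<in> S \<Longrightarrow> deg_ge 3 (r x j)"
    and r: "\<And>x. x \<in> S \<Longrightarrow> r x = r_rhs (\<lambda>z. z) (wbar x) (source_form (\<lambda>z. z)
        (\<lambda>i j k l. complex_of_real (lowered_curvature w \<Gamma> x i j k l)) (\<beta> x))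
        (\<lambda>k l. weyl_cov \<Gamma> k (\<lambda>x. r x l) x) (r x)"
    and a: "\<And>x. x \<in> S \<Longrightarrow> a x = lift_rhs (\<lambda>z. z) (wbar x) (r x) (f x) (\<lambda>k. weyl_cov \<Gamma> k a x) (a x)"
    and b: "\<And>x. x \<in> S \<Longrightarrow> b x = lift_rhs (\<lambda>z. z) (wbar x) (r x) (g x) (\<lambda>k. weyl_cov \<Gamma> k b x) (b x)"
    and x: "x \<in> S"
  shows "circ (\<lambda>z. z) (wbar x) (a x) (b x) {#}
    = fps_map (expr_value (symval x)) (star_formula (w x) (\<lambda>k l. fps_map (specialise (w x)) (A k l)))"
proof -
  interpret v: coefficient_map "expr_value (symval x)" econst "\<lambda>z. z" by (rule coefficient_map_expr_value)
  have r_eq: "r y = (\<lambda>j m. fps_map (ev y) (u_r A j m))" if "y \<in> S" for y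
    by (intro ext, rule r_unique[OF A_cov A_0 ev_A r3 _ that])
      (simp_all add: source_def[OF A_cov A_0 ev_A] r[symmetric])
  have ev_fps: "fps_map (ev x) s = fps_map (expr_value (symval x)) (fps_map (specialise (w x)) s)" for s
    by (simp add: fps_eq_iff ev_eq)
  have lift: "c x m = fps_map (expr_value (symval x)) (lift_formula (w x) (\<lambda>k l. fps_map (specialise (w x)) (A k l)) (sym s) m)"
    if c: "\<And>x. x \<in> S \<Longrightarrow> c x = lift_rhs (\<lambda>z. z) (wbar x) (r x) (symval x s) (\<lambda>k. weyl_cov \<Gamma> k c x) (c x)"
      and s: "symbol_indices s = []" for c s m
  proof -
    have "c x m = fps_map (ev x) (u_lift A (u_sym s) m)"
    proof (rule lift_unique[OF A_cov A_0 ev_A _ _ x])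
      show "u_lie G (u_sym s) = 0" for G by (simp add: u_lie_simps s)
      show "c y = lift_rhs (\<lambda>z. z) (wbar y) (\<lambda>j m. fps_map (ev y) (u_r A j m)) (ev y (u_sym s)) (\<lambda>k. weyl_cov \<Gamma> k c y) (c y)"
        if "y \<in> S" for y
        using c[OF that] r_eq[OF that] by simp
    qed
    then show ?thesis by (simp add: ev_fps specialise_lift_solution)
  qed
  have "a x = (\<lambda>m. fps_map (expr_value (symval x)) (lift_formula (w x) (\<lambda>k l. fps_map (specialise (w x)) (A k l)) (sym (FSym [])) m))"
    by (rule ext, rule lift) (use a in simp_all)
  moreover have "b x = (\<lambda>m. fps_map (expr_value (symval x)) (lift_formula (w x) (\<lambda>k l. fps_map (specialise (w x)) (A k l)) (sym (GSym [])) m))"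
    by (rule ext, rule lift) (use b in simp_all)
  moreover have "fps_map (expr_value (symval x)) (const_matrix econst (tensor_inverse (w x)) i j) = wbar x i j" for i j
    by (simp add: const_matrix_def fps_map_const[OF v.additive_axioms])
  ultimately show ?thesis by (simp add: star_formula_def v.circ_map)
qed

text \<open>The lift of \<open>f\<close> starts with \<open>f + y\<^sup>i \<partial>\<^sub>i f\<close>: because \<open>r\<close> has degree at least 3, the commutator with
  \<open>r\<close> does not reach the coefficient of \<open>y\<^sup>i\<close> at \<open>\<hbar>\<^sup>0\<close>.\<close>

lemma star_low_orders:
  assumes r3: "\<And>x j. x \<in> S \<Longrightarrow> deg_ge 3 (r x j)"
    and a: "\<And>x. x \<in> S \<Longrightarrow> a x = lift_rhs (\<lambda>z. z) (wbar x) (r x) (f x) (\<lambda>k. weyl_cov \<Gamma> k a x) (a x)"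
    and b: "\<And>x. x \<in> S \<Longrightarrow> b x = lift_rhs (\<lambda>z. z) (wbar x) (r x) (g x) (\<lambda>k. weyl_cov \<Gamma> k b x) (b x)"
    and x: "x \<in> S"
  shows "fps_nth (circ (\<lambda>z. z) (wbar x) (a x) (b x) {#}) 0 = f x * g x"
    and "fps_nth (circ (\<lambda>z. z) (wbar x) (a x) (b x) {#}) 1 =
      - \<i> / 2 * (\<Sum>i\<in>UNIV. \<Sum>j\<in>UNIV. complex_of_real (winv x i j) * pd i f x * pd j g x)"
proof -
  have lift0: "c y {#} = fps_const (u y)"
    if "\<And>x. x \<in> S \<Longrightarrow> c x = lift_rhs (\<lambda>z. z) (wbar x) (r x) (u x) (\<lambda>k. weyl_cov \<Gamma> k c x) (c x)" "y \<in> S" for c u y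
    by (subst that(1)[OF that(2)]) (simp add: lift_rhs_def delta_inv1_def)
  have lift1: "fps_nth (c x {#i#}) 0 = pd i u x"
    if c: "\<And>x. x \<in> S \<Longrightarrow> c x = lift_rhs (\<lambda>z. z) (wbar x) (r x) (u x) (\<lambda>k. weyl_cov \<Gamma> k c x) (c x)" for c u i
  proof -
    have "deg_ge 0 (c x)" by (simp add: deg_ge_def)
    then have "fps_nth (circ (\<lambda>z. z) (wbar x) (r x i) (c x) {#}) 1 = 0" "fps_nth (circ (\<lambda>z. z) (wbar x) (c x) (r x i) {#}) 1 = 0"
      using deg_geD[OF deg_ge_circ[OF r3[OF x]], of 0 "c x" 1 "{#}"]
        deg_geD[OF deg_ge_circ[OF _ r3[OF x]], of 0 "c x" 1 "{#}"] by simp_all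
    moreover have "pd i (\<lambda>x. fps_nth (c x {#}) 0) x = pd i u x"
      by (rule pd_cong_open[OF open_S x]) (simp add: lift0[OF c])
    moreover have "fps_nth (c x {#i#}) 0 = fps_nth (lift_rhs (\<lambda>z. z) (wbar x) (r x) (u x) (\<lambda>k. weyl_cov \<Gamma> k c x) (c x) {#i#}) 0"
      using c[OF x] by simp
    ultimately show ?thesis
      by (simp add: lift_rhs_def delta_inv1_def weyl_cov_def i_over_hbar_def)
  qed
  show "fps_nth (circ (\<lambda>z. z) (wbar x) (a x) (b x) {#}) 0 = f x * g x"
    by (simp add: circ_nth weyl_mult_def lift0[OF a x] lift0[OF b x])
  have "bidiff (wbar x) 0 (a x) (b x) {#} = fps_const (f x * g x)"
    by (simp add: weyl_mult_def lift0[OF a x] lift0[OF b x])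
  moreover have "fps_nth (bidiff (wbar x) 1 (a x) (b x) {#}) 0
      = (\<Sum>i\<in>UNIV. \<Sum>j\<in>UNIV. complex_of_real (winv x i j) * pd i f x * pd j g x)"
    by (simp add: weyl_mult_def fps_sum_nth dy_nth lift1[OF a] lift1[OF b] const_matrix_def winv_def mult.assoc)
  ultimately show "fps_nth (circ (\<lambda>z. z) (wbar x) (a x) (b x) {#}) 1 =
      - \<i> / 2 * (\<Sum>i\<in>UNIV. \<Sum>j\<in>UNIV. complex_of_real (winv x i j) * pd i f x * pd j g x)"
    by (simp add: circ_nth del: bidiff.simps)
qed

end

section \<open>Selection of terms\<close>

text \<open>The homomorphism that sets all symbols outside of \<open>T\<close> to zero. On the level of terms it discards
  the monomials that contain one of these symbols and keeps the others.\<close>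

definition restrict_symbols :: "'n symbol set \<Rightarrow> 'n expr \<Rightarrow> 'n expr" where
  "restrict_symbols T = poly_subst econst (\<lambda>s. if s \<in> T then sym s else 0)"

lemma poly_subst_econst: "poly_subst econst v (econst z) = econst z"
  using poly_subst_const[OF ring_map_econst, of v z] by (simp only: econst_eq)

lemma coefficient_map_restrict: "coefficient_map (restrict_symbols T) econst econst"
  unfolding coefficient_map_def restrict_symbols_def coefficient_map_axioms_def
  by (simp add: ring_map_poly_subst ring_map_econst poly_subst_econst)

lemma restrict_simps [simp]:
  "restrict_symbols T (econst z) = econst z"
  "restrict_symbols T (sym s) = (if s \<in> T then sym s else 0)"
  unfolding restrict_symbols_def
  by (simp_all add: ring_map_econst poly_subst_econst poly_subst_var sym_eq)

lemma restrict_monomial: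
  "restrict_symbols T (Poly_Mapping.single m z) = (if set_mset m \<subseteq> T then Poly_Mapping.single m z else 0)"
proof (induction m)
  case empty
  show ?case using restrict_simps(1)[of T z] by (simp add: econst_def)
next
  case (add s m)
  interpret r: coefficient_map "restrict_symbols T" econst econst by (rule coefficient_map_restrict)
  show ?case unfolding monomial_add_mset r.map_mult add by (simp add: flip: sym_eq)
qed

lemma lookup_restrict:
  "Poly_Mapping.lookup (restrict_symbols T P) m = (if set_mset m \<subseteq> T then Poly_Mapping.lookup P m else 0)"
proof (induction P rule: polynomial_monomial_induct)
  case (monomial k z)
  show ?case by (auto simp: restrict_monomial lookup_single when_def)
next
  case (add P P')
  interpret r: coefficient_map "restrict_symbols T" econst econst by (rule coefficient_map_restrict)
  show ?case by (simp add: r.add lookup_add add)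
qed

lemma lookup_select:
  "Poly_Mapping.lookup (fps_nth (select_terms Q s) n) m = (if Q m then Poly_Mapping.lookup (fps_nth s n) m else 0)"
proof -
  have "Poly_Mapping.lookup (fps_nth (select_terms Q s) n) m
      = (\<Sum>k\<in>{k \<in> Poly_Mapping.keys (fps_nth s n). Q k}. if k = m then Poly_Mapping.lookup (fps_nth s n) m else 0)"
    unfolding select_terms_def fps_nth_Abs_fps lookup_sum
    by (intro sum.cong refl) (auto simp: lookup_single)
  then show ?thesis by (simp add: in_keys_iff)
qed

lemma select_cong:
  assumes "\<And>n m. Q m \<Longrightarrow> Poly_Mapping.lookup (fps_nth s n) m = Poly_Mapping.lookup (fps_nth t n) m"
  shows "select_terms Q s = select_terms Q t"
  by (intro fps_ext poly_mapping_eqI) (simp add: lookup_select assms)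

lemma select_restrict:
  assumes "\<And>m. Q m \<Longrightarrow> set_mset m \<subseteq> T"
  shows "select_terms Q (fps_map (restrict_symbols T) s) = select_terms Q s"
  by (rule select_cong) (simp add: lookup_restrict assms)

lemma select_diff: "select_terms Q (s - t) = select_terms Q s - select_terms Q t"
  by (intro fps_ext poly_mapping_eqI) (simp add: lookup_select lookup_minus)

definition all_terms :: "('n symbol multiset \<Rightarrow> bool) \<Rightarrow> 'n expr fps \<Rightarrow> bool" where
  "all_terms Q s \<longleftrightarrow> (\<forall>n. \<forall>m\<in>Poly_Mapping.keys (fps_nth s n). Q m)"

lemma select_all: "all_terms Q s \<Longrightarrow> select_terms Q s = s"
  by (intro fps_ext poly_mapping_eqI) (metis lookup_select all_terms_def in_keys_iff)

lemma all_terms_sum: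
  assumes "\<And>i. i \<in> A \<Longrightarrow> all_terms Q (s i)"
  shows "all_terms Q (\<Sum>i\<in>A. s i)"
  unfolding all_terms_def fps_sum_nth
proof (intro allI ballI)
  fix n m assume "m \<in> Poly_Mapping.keys (\<Sum>i\<in>A. fps_nth (s i) n)"
  then have "(\<Sum>i\<in>A. Poly_Mapping.lookup (fps_nth (s i) n) m) \<noteq> 0"
    by (simp add: in_keys_iff lookup_sum)
  then obtain i where "i \<in> A" "Poly_Mapping.lookup (fps_nth (s i) n) m \<noteq> 0"
    by (rule sum.not_neutral_contains_not_neutral)
  then show "Q m" using assms by (auto simp: all_terms_def in_keys_iff)
qed

lemma all_terms_diff:
  assumes "all_terms Q s" "all_terms Q t"
  shows "all_terms Q (s - t)"
  unfolding all_terms_def fps_sub_nth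
proof (intro allI ballI)
  fix n m assume "m \<in> Poly_Mapping.keys (fps_nth s n - fps_nth t n)"
  then have "Poly_Mapping.lookup (fps_nth s n) m \<noteq> 0 \<or> Poly_Mapping.lookup (fps_nth t n) m \<noteq> 0"
    by (auto simp: in_keys_iff lookup_minus)
  then show "Q m" using assms by (auto simp: all_terms_def in_keys_iff)
qed

lemma all_terms_mult:
  assumes s: "all_terms Q s" and t: "all_terms Q' t" and Q: "\<And>m k. Q m \<Longrightarrow> Q' k \<Longrightarrow> Q'' (m + k)"
  shows "all_terms Q'' (s * t)"
  unfolding all_terms_def fps_mult_nth
proof (intro allI ballI)
  fix n m assume "m \<in> Poly_Mapping.keys (\<Sum>i=0..n. fps_nth s i * fps_nth t (n - i))"
  then have "(\<Sum>i=0..n. Poly_Mapping.lookup (fps_nth s i * fps_nth t (n - i)) m) \<noteq> 0"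
    by (simp add: in_keys_iff lookup_sum)
  then obtain i where "Poly_Mapping.lookup (fps_nth s i * fps_nth t (n - i)) m \<noteq> 0"
    by (rule sum.not_neutral_contains_not_neutral)
  then have "m \<in> Poly_Mapping.keys (fps_nth s i * fps_nth t (n - i))" by (simp add: in_keys_iff)
  then obtain a b where "m = a + b" "a \<in> Poly_Mapping.keys (fps_nth s i)" "b \<in> Poly_Mapping.keys (fps_nth t (n - i))"
    using keys_mult by blast
  then show "Q'' m" using s t Q by (auto simp: all_terms_def)
qed

lemma all_terms_const_X: "all_terms (\<lambda>m. m = {#}) (fps_const (econst z) * fps_X)"
  unfolding all_terms_def
proof (intro allI ballI)
  fix n m assume "m \<in> Poly_Mapping.keys (fps_nth (fps_const (econst z) * fps_X) n)"
  moreover have "fps_nth (fps_const (econst z) * fps_X) n = (if n = 1 then econst z else 0)"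
    by (simp add: fps_X_nth)
  ultimately show "m = {#}" by (auto simp: econst_def split: if_splits)
qed

section \<open>The one-differentiable terms of the formula\<close>

text \<open>The symbols that survive in the quotient by the differential ideal generated by the curvature, the
  derivatives of \<open>\<alpha>\<close> and the second derivatives of \<open>f\<close> and \<open>g\<close>. The functions themselves have to
  be kept although they do not occur in selected terms, since their derivatives do.\<close>

definition flat_symbols :: "'n symbol set" where
  "flat_symbols = {FSym I | I. length I \<le> 1} \<union> {GSym I | I. length I \<le> 1} \<union> {ASym n [] i j | n i j. True}"

definition flat_deriv :: "'n \<Rightarrow> 'n expr \<Rightarrow> 'n expr" where
  "flat_deriv k = poly_deriv (\<lambda>s. if s = FSym [] then sym (FSym [k]) else if s = GSym [] then sym (GSym [k]) else 0)"

lemma derivation_flat_deriv: "derivation (flat_deriv k)"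
  unfolding flat_deriv_def by (rule derivation_poly_deriv)

lemma flat_deriv_simps:
  "flat_deriv k (econst z) = 0"
  "flat_deriv k (sym s) = (if s = FSym [] then sym (FSym [k]) else if s = GSym [] then sym (GSym [k]) else 0)"
  unfolding flat_deriv_def econst_eq by (simp_all add: poly_deriv_const poly_deriv_var sym_eq)

text \<open>Differentiating a discarded symbol gives a discarded symbol, so that covariant differentiation
  descends to the quotient.\<close>

lemma restrict_flat_deriv: "restrict_symbols flat_symbols (expr_deriv k P) = flat_deriv k (restrict_symbols flat_symbols P)"
proof -
  interpret r: coefficient_map "restrict_symbols flat_symbols" econst econst by (rule coefficient_map_restrict)
  interpret d: derivation "flat_deriv k" by (rule derivation_flat_deriv)
  interpret e: derivation "expr_deriv k" by (rule derivation_expr_deriv)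
  show ?thesis
  proof (induction P rule: polynomial_induct)
    case (const z)
    show ?case by (simp add: expr_deriv_simps flat_deriv_simps r.zero flip: econst_eq)
  next
    case (var s)
    show ?case unfolding sym_eq[symmetric]
      by (cases s) (auto simp: expr_deriv_simps flat_deriv_simps flat_symbols_def d.zero)
  qed (simp_all add: r.add r.map_mult d.add d.leibniz e.add e.leibniz)
qed

abbreviation (input) selected :: "'n symbol multiset \<Rightarrow> bool" where
  "selected m \<equiv> one_differentiable m \<and> \<not> contains_R m \<and> \<not> contains_deriv_alpha m"

lemma selected_flat: "selected m \<Longrightarrow> set_mset m \<subseteq> flat_symbols"
proof
  fix s assume m: "selected m" and s: "s \<in> set_mset m"
  obtain i j where ij: "filter_mset function_symbol m = {#FSym [i], GSym [j]#}"
    using m by (auto simp: one_differentiable_def)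
  have fs: "function_symbol s \<Longrightarrow> s \<in># {#FSym [i], GSym [j]#}"
    unfolding ij[symmetric] using s by simp
  show "s \<in> flat_symbols"
  proof (cases s)
    case (FSym I)
    then show ?thesis using fs by (auto simp: flat_symbols_def function_symbol_def)
  next
    case (GSym I)
    then show ?thesis using fs by (auto simp: flat_symbols_def function_symbol_def)
  next
    case (ASym n I i j)
    then have "I = []" using m s by (auto simp: contains_deriv_alpha_def)
    then show ?thesis using ASym by (auto simp: flat_symbols_def)
  next
    case (RSym I i j k l)
    then show ?thesis using m s by (auto simp: contains_R_def)
  qed
qed

definition alpha_symbols :: "'n symbol set" where
  "alpha_symbols = {ASym n [] i j | n i j. True}"

lemma ASym_alpha_symbols: "ASym n [] i j \<in> alpha_symbols"
  by (auto simp: alpha_symbols_def)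

lemma selected_alpha:
  assumes "set_mset m \<subseteq> alpha_symbols" "k = {#FSym [i], GSym [j]#}"
  shows "selected (m + k)"
proof -
  have "filter_mset function_symbol m = filter_mset (\<lambda>_. False) m"
    using assms(1) by (intro filter_mset_cong refl) (auto simp: alpha_symbols_def function_symbol_def)
  then have m: "filter_mset function_symbol m = {#}" by simp
  have "filter_mset function_symbol k = {#FSym [i], GSym [j]#}"
    by (simp add: assms(2) function_symbol_def)
  then have "filter_mset function_symbol (m + k) = {#FSym [i], GSym [j]#}"
    unfolding filter_union_mset m by simp
  then have "one_differentiable (m + k)" by (auto simp: one_differentiable_def)
  then show ?thesis
    using assms by (auto simp: contains_R_def contains_deriv_alpha_def alpha_symbols_def)
qed

lemma all_terms_dF_dG: "all_terms (\<lambda>m. \<exists>i j. m = {#FSym [i], GSym [j]#}) (dF_expr i * dG_expr j)"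
proof -
  have "dF_expr i * dG_expr j = fps_const (Poly_Mapping.single {#FSym [i], GSym [j]#} 1)"
    by (simp add: dF_expr_def dG_expr_def sym_def mult_single add_mset_commute)
  then show ?thesis by (auto simp: all_terms_def split: if_splits)
qed

lemma all_terms_bivector:
  assumes "\<And>i j. all_terms (\<lambda>m. set_mset m \<subseteq> alpha_symbols) (A i j)"
  shows "all_terms selected (bivector_apply A dF_expr dG_expr)"
  unfolding bivector_apply_def mult.assoc
proof (rule all_terms_sum, rule all_terms_sum, rule all_terms_mult[OF assms all_terms_dF_dG])
  fix m k :: "'a symbol multiset"
  assume m: "set_mset m \<subseteq> alpha_symbols" and "\<exists>i j. k = {#FSym [i], GSym [j]#}"
  then obtain i j where "k = {#FSym [i], GSym [j]#}" by blast
  then show "selected (m + k)" by (rule selected_alpha[OF m])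
qed

lemma all_terms_scalar_X:
  assumes "all_terms Q s"
  shows "all_terms Q (fps_const (econst z) * fps_X * s)"
  by (rule all_terms_mult[OF all_terms_const_X assms]) simp

lemma all_terms_restrict:
  assumes "fps_map (restrict_symbols T) s = s"
  shows "all_terms (\<lambda>m. set_mset m \<subseteq> T) s"
  unfolding all_terms_def in_keys_iff
proof (intro allI ballI)
  fix n m assume "m \<in> Poly_Mapping.keys (fps_nth s n)"
  moreover have "Poly_Mapping.lookup (fps_nth s n) m = Poly_Mapping.lookup (fps_nth (fps_map (restrict_symbols T) s) n) m"
    by (simp only: assms)
  ultimately show "set_mset m \<subseteq> T" by (auto simp: in_keys_iff lookup_restrict split: if_splits)
qed

lemma const_matrix_inverse:
  fixes \<iota> :: "complex \<Rightarrow> 'a::comm_ring_1" and A B :: "'n::finite \<Rightarrow> 'n \<Rightarrow> real"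
  assumes "ring_map \<iota>" "(\<Sum>j\<in>UNIV. A i j * B j k) = (if i = k then 1 else 0)"
  shows "(\<Sum>j\<in>UNIV. const_matrix \<iota> A i j * const_matrix \<iota> B j k) = (if i = k then 1 else 0)"
proof -
  interpret \<iota>: ring_map \<iota> by (rule assms)
  have "(\<Sum>j\<in>UNIV. const_matrix \<iota> A i j * const_matrix \<iota> B j k)
    = fps_const (\<iota> (complex_of_real (\<Sum>j\<in>UNIV. A i j * B j k)))"
    by (simp add: fps_eq_iff const_matrix_def \<iota>.sum \<iota>.map_mult fps_sum_nth)
  then show ?thesis by (simp add: assms(2) \<iota>.map_1 \<iota>.zero)
qed

lemma deformed_symplectic_const_matrix:
  fixes w :: "'n::finite \<Rightarrow> 'n \<Rightarrow> real"
  assumes \<iota>: "ring_map \<iota>" and inv: "invertible (\<chi> i j. w i j)" and antisym: "\<And>i j. w i j = - w j i"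
    and A: "\<And>i j. A i j = - A j i" "\<And>i j. fps_nth (A i j) 0 = 0"
  shows "deformed_symplectic (const_matrix \<iota> w) (const_matrix \<iota> (tensor_inverse w)) A"
proof
  interpret \<iota>: ring_map \<iota> by (rule \<iota>)
  show "(\<Sum>j\<in>UNIV. const_matrix \<iota> w i j * const_matrix \<iota> (tensor_inverse w) j k) = (if i = k then 1 else 0)"
    and "(\<Sum>j\<in>UNIV. const_matrix \<iota> (tensor_inverse w) i j * const_matrix \<iota> w j k) = (if i = k then 1 else 0)" for i k
    by (simp_all add: const_matrix_inverse[OF \<iota>] tensor_inverse_real[OF inv])
  show "const_matrix \<iota> w i j = - const_matrix \<iota> w j i" for i j
    unfolding const_matrix_def by (subst antisym) (simp add: \<iota>.minus)
qed (rule A)+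

lemma tensor_inverse_map:
  assumes \<phi>: "ring_map \<phi>"
    and AB: "\<And>i k. (\<Sum>j\<in>UNIV. A i j * B j k) = (if i = k then 1 else 0)"
    and BA: "\<And>i k. (\<Sum>j\<in>UNIV. B i j * A j k) = (if i = k then 1 else 0)"
  shows "tensor_inverse (\<lambda>i j. \<phi> (A i j)) = (\<lambda>i j. \<phi> (B i j))"
proof -
  interpret ring_map \<phi> by (rule \<phi>)
  have "\<phi> (\<Sum>j\<in>UNIV. A i j * B j k) = (if i = k then 1 else 0)" "\<phi> (\<Sum>j\<in>UNIV. B i j * A j k) = (if i = k then 1 else 0)" for i k
    by (simp_all add: AB BA map_1 zero)
  then show ?thesis by (intro tensor_inverse_eqI) (simp_all add: sum map_mult)
qed

context deformed_symplectic
begin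

lemma Obar_inverse:
  "(\<Sum>j\<in>UNIV. (\<omega> i j + \<alpha> i j) * Obar $ j $ k) = (if i = k then 1 else 0)"
  "(\<Sum>j\<in>UNIV. Obar $ i $ j * (\<omega> j k + \<alpha> j k)) = (if i = k then 1 else 0)"
  using arg_cong[OF Om_Obar, of "\<lambda>M. M $ i $ k"] arg_cong[OF Obar_Om, of "\<lambda>M. M $ i $ k"]
  by (simp_all add: matrix_mul_nth mat_def)

lemma Obar_map:
  assumes "ring_map \<phi>"
  shows "tensor_inverse (\<lambda>i j. fps_map \<phi> (\<omega> i j + \<alpha> i j)) = (\<lambda>i j. fps_map \<phi> (Obar $ i $ j))"
  by (rule tensor_inverse_map[OF ring_map_fps_map[OF assms] Obar_inverse])

end

lemma bivector_apply_map:
  assumes "ring_map \<phi>"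
  shows "\<phi> (bivector_apply A u v) = bivector_apply (\<lambda>i j. \<phi> (A i j)) (\<lambda>i. \<phi> (u i)) (\<lambda>j. \<phi> (v j))"
proof -
  interpret ring_map \<phi> by (rule assms)
  show ?thesis by (simp add: bivector_apply_def sum map_mult)
qed

locale symplectic_matrix =
  fixes w :: "'n::finite \<Rightarrow> 'n \<Rightarrow> real"
  assumes nondegenerate: "invertible (\<chi> i j. w i j)" and antisym: "w i j = - w j i"
begin

abbreviation "w_e \<equiv> const_matrix econst w"
abbreviation "wbar_e \<equiv> const_matrix econst (tensor_inverse w)"

lemma restrict_const_matrix: "fps_map (restrict_symbols T) (const_matrix econst A i j) = const_matrix econst A i j"
proof -
  interpret r: coefficient_map "restrict_symbols T" econst econst by (rule coefficient_map_restrict)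
  show ?thesis by (simp add: const_matrix_def fps_map_const[OF r.additive_axioms])
qed

context
  fixes A :: "'n \<Rightarrow> 'n \<Rightarrow> 'n expr fps"
  assumes A_antisym: "\<And>i j. A i j = - A j i" and A_0: "\<And>i j. fps_nth (A i j) 0 = 0"
    and A_alpha: "\<And>i j. fps_map (restrict_symbols alpha_symbols) (A i j) = A i j"
begin

lemma A_flat: "fps_map (restrict_symbols flat_symbols) (A i j) = A i j"
proof (intro fps_ext poly_mapping_eqI)
  fix n m
  have "Poly_Mapping.lookup (fps_nth (A i j) n) m = Poly_Mapping.lookup (fps_nth (fps_map (restrict_symbols alpha_symbols) (A i j)) n) m"
    by (simp add: A_alpha)
  moreover have "alpha_symbols \<subseteq> (flat_symbols :: 'n symbol set)"
    by (auto simp: alpha_symbols_def flat_symbols_def)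
  ultimately show "Poly_Mapping.lookup (fps_nth (fps_map (restrict_symbols flat_symbols) (A i j)) n) m
      = Poly_Mapping.lookup (fps_nth (A i j) n) m"
    by (cases "set_mset m \<subseteq> alpha_symbols") (simp_all add: lookup_restrict)
qed

lemma flat_deriv_A: "fps_map (flat_deriv k) (A i j) = 0"
proof (rule fps_ext)
  fix n
  interpret d: derivation "flat_deriv k" by (rule derivation_flat_deriv)
  interpret r: coefficient_map "restrict_symbols alpha_symbols" econst econst by (rule coefficient_map_restrict)
  have "flat_deriv k (restrict_symbols alpha_symbols P) = 0" for P
  proof (induction P rule: polynomial_induct)
    case (const z)
    show ?case by (simp add: flat_deriv_simps flip: econst_eq)
  next
    case (var s)
    show ?case by (auto simp: flat_deriv_simps alpha_symbols_def d.zero simp flip: sym_eq)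
  qed (simp_all add: r.add r.map_mult d.add d.leibniz)
  then show "fps_nth (fps_map (flat_deriv k) (A i j)) n = fps_nth 0 n"
    by (metis A_alpha fps_map_nth fps_zero_nth)
qed

interpretation flat: flat_fedosov w_e wbar_e A econst flat_deriv
proof -
  interpret d: derivation "flat_deriv k" for k by (rule derivation_flat_deriv)
  interpret s: deformed_symplectic w_e wbar_e A
    by (rule deformed_symplectic_const_matrix[OF ring_map_econst nondegenerate antisym A_antisym A_0])
  show "flat_fedosov w_e wbar_e A econst flat_deriv"
    by unfold_locales (simp_all add: ring_map.map_add[OF ring_map_econst] ring_map.map_mult[OF ring_map_econst]
      ring_map.map_1[OF ring_map_econst] d.add d.leibniz flat_deriv_simps flat_deriv_A const_matrix_def
      fps_map_const[OF d.additive_axioms])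
qed

abbreviation "OmInv \<equiv> tensor_inverse (\<lambda>i j. w_e i j + A i j)"

text \<open>In the quotient the formula is the star product of the flat case.\<close>

lemma restrict_star_formula:
  "fps_map (restrict_symbols flat_symbols) (star_formula w A) =
     fps_const (sym (FSym []) * sym (GSym [])) - fps_const (econst (\<i> / 2)) * fps_X * bivector_apply OmInv dF_expr dG_expr"
proof -
  interpret r: coefficient_map "restrict_symbols flat_symbols" econst econst by (rule coefficient_map_restrict)
  interpret e: ring_map econst by (rule ring_map_econst)
  have R: "RSym [] i j k l \<notin> flat_symbols" for i j k l :: 'n
    by (simp add: flat_symbols_def)
  have r: "fps_map (restrict_symbols flat_symbols) (r_formula w A j m) = flat.flat_r j m" for j m
    by (simp add: r_formula_eq r.r_solution_map[where d' = flat_deriv, OF restrict_flat_deriv] r.source_form_map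
      R A_flat restrict_const_matrix)
  have lift: "fps_map (restrict_symbols flat_symbols) (lift_formula w A (sym s) m) =
    lift_solution econst wbar_e flat.flat_r flat_deriv (sym s) m" if "s \<in> flat_symbols" for s m
    using that by (simp add: lift_formula_eq r.lift_solution_map[where d' = flat_deriv, OF restrict_flat_deriv]
      r restrict_const_matrix)
  have fs: "FSym [] \<in> flat_symbols" "GSym [] \<in> flat_symbols" by (auto simp: flat_symbols_def)
  have dd: "flat_deriv k (flat_deriv l (sym s)) = 0" for k l s
    by (auto simp: flat_deriv_simps Modules.additive.zero[OF derivation_additive[OF derivation_flat_deriv]])
  have dF: "(\<lambda>i. fps_const (flat_deriv i (sym (FSym [])))) = dF_expr"
    and dG: "(\<lambda>i. fps_const (flat_deriv i (sym (GSym [])))) = dG_expr"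
    by (simp_all add: fun_eq_iff flat_deriv_simps dF_expr_def dG_expr_def)
  show ?thesis
    by (simp add: star_formula_def r.circ_map restrict_const_matrix lift[OF fs(1)] lift[OF fs(2)]
      flat.flat_star[OF dd dd] dF dG flat.tensor_inverse_deformed e.minus fps_const_neg[symmetric] del: fps_const_neg)
qed

text \<open>The homomorphism that discards all symbols except those of \<open>\<alpha>\<close> fixes \<open>\<omega> + \<alpha>\<close>, hence also its
  inverse, which is unique.\<close>

lemma all_terms_OmInv: "all_terms (\<lambda>m. set_mset m \<subseteq> alpha_symbols) (OmInv i j)"
proof (rule all_terms_restrict)
  interpret r: coefficient_map "restrict_symbols alpha_symbols" econst econst by (rule coefficient_map_restrict)
  have "tensor_inverse (\<lambda>i j. fps_map (restrict_symbols alpha_symbols) (w_e i j + A i j))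
    = (\<lambda>i j. fps_map (restrict_symbols alpha_symbols) (flat.Obar $ i $ j))"
    by (rule flat.Obar_map) (rule r.ring_map_axioms)
  then show "fps_map (restrict_symbols alpha_symbols) (OmInv i j) = OmInv i j"
    by (simp add: r.fps.map_add restrict_const_matrix A_alpha flat.tensor_inverse_deformed fun_eq_iff)
qed

lemma all_terms_OmInv_bivector:
  "all_terms selected (fps_const (econst z) * fps_X * bivector_apply OmInv dF_expr dG_expr)"
  by (intro all_terms_scalar_X all_terms_bivector all_terms_OmInv)

lemma select_star_formula:
  "select_terms selected (star_formula w A) = - (fps_const (econst (\<i> / 2)) * fps_X * bivector_apply OmInv dF_expr dG_expr)"
proof -
  have not_selected: "\<not> selected {#FSym [], GSym [] :: 'n symbol#}"
    by (auto simp: one_differentiable_def function_symbol_def add_eq_conv_ex)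
  moreover have "sym (FSym []) * sym (GSym [] :: 'n symbol) = Poly_Mapping.single {#FSym [], GSym []#} 1"
    by (simp add: sym_def mult_single add_mset_commute)
  ultimately have "Poly_Mapping.lookup (sym (FSym []) * sym (GSym [] :: 'n symbol)) m = 0" if "selected m" for m
    using that by (auto simp: lookup_single when_def)
  then have 0: "select_terms selected (fps_const (sym (FSym []) * sym (GSym [] :: 'n symbol))) = 0"
    by (intro fps_ext poly_mapping_eqI) (simp add: lookup_select)
  have "select_terms selected (star_formula w A)
      = select_terms selected (fps_map (restrict_symbols flat_symbols) (star_formula w A))"
    by (rule select_restrict[symmetric]) (rule selected_flat)
  then show ?thesis
    by (simp only: restrict_star_formula select_diff 0 select_all[OF all_terms_OmInv_bivector]) simp
qed

end

end

section \<open>Fedosov star products in a chart\<close>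

lemma formula_value_eq:
  "formula_value \<omega> \<Gamma> \<alpha> f g c p s = fps_map (expr_value
     (symbol_value (\<omega> c) (\<Gamma> c) (\<alpha> c) (f \<circ> cinv c) (g \<circ> cinv c) (snd c p))) s"
  by (simp add: formula_value_def fps_map_def)

lemma alpha_expr_antisym: "alpha_expr i j = - alpha_expr j i"
  by (simp add: fps_eq_iff alpha_expr_def right_diff_distrib)

lemma alpha_expr_0: "fps_nth (alpha_expr i j) 0 = 0"
  by (simp add: alpha_expr_def)

lemma alpha_expr_alpha: "fps_map (restrict_symbols alpha_symbols) (alpha_expr i j) = alpha_expr i j"
proof -
  interpret r: coefficient_map "restrict_symbols alpha_symbols" econst econst by (rule coefficient_map_restrict)
  show ?thesis by (simp add: fps_eq_iff alpha_expr_def r.zero r.map_mult r.diff ASym_alpha_symbols)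
qed

lemma zero_expr_alpha: "fps_map (restrict_symbols T) 0 = 0"
proof -
  interpret r: coefficient_map "restrict_symbols T" econst econst by (rule coefficient_map_restrict)
  show ?thesis by (simp add: r.fps.zero)
qed

definition remainder :: "('n::finite \<Rightarrow> 'n \<Rightarrow> real) \<Rightarrow> 'n expr fps" where
  "remainder w = star_formula w alpha_expr - star_formula w (\<lambda>_ _. 0)
     - fps_const (econst (\<i> / 2)) * fps_X * suminf (\<lambda>q. bivector_apply
         (diamond_power (const_matrix econst w) (raise (const_matrix econst (tensor_inverse w)) alpha_expr) (Suc q))
         dF_expr dG_expr)"

context symplectic_matrix
begin

lemma deformed_e: "deformed_symplectic w_e wbar_e alpha_expr"
  by (rule deformed_symplectic_const_matrix[OF ring_map_econst nondegenerate antisym alpha_expr_antisym alpha_expr_0])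

lemma tensor_inverse_const_matrix:
  assumes "ring_map \<iota>"
  shows "tensor_inverse (const_matrix \<iota> w) = const_matrix \<iota> (tensor_inverse w)"
  by (intro tensor_inverse_eqI) (simp_all add: const_matrix_inverse[OF assms] tensor_inverse_real[OF nondegenerate])

lemma diamonds_e: "suminf (\<lambda>q. bivector_apply (diamond_power w_e (raise wbar_e alpha_expr) (Suc q)) dF_expr dG_expr)
    = bivector_apply wbar_e dF_expr dG_expr
      - bivector_apply (tensor_inverse (\<lambda>i j. w_e i j + alpha_expr i j)) dF_expr dG_expr"
  using deformed_symplectic.suminf_diamonds[OF deformed_e] deformed_symplectic.tensor_inverse_deformed[OF deformed_e]
  by simp

lemma select_alpha: "select_terms selected (star_formula w alpha_expr)
    = - (fps_const (econst (\<i> / 2)) * fps_X * bivector_apply (tensor_inverse (\<lambda>i j. w_e i j + alpha_expr i j)) dF_expr dG_expr)"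
  by (rule select_star_formula[OF alpha_expr_antisym alpha_expr_0 alpha_expr_alpha])

text \<open>The selected terms of the two formulas and of the diamond series are bivector terms, and they cancel
  by the geometric series for the inverse of \<open>\<omega> + \<alpha>\<close>.\<close>

lemma remainder_terms:
  assumes "m \<in> Poly_Mapping.keys (fps_nth (remainder w) n)"
  shows "contains_R m \<or> contains_deriv_alpha m \<or> \<not> one_differentiable m"
proof -
  let ?h = "fps_const (econst (\<i> / 2)) * fps_X"
  let ?O = "bivector_apply (tensor_inverse (\<lambda>i j. w_e i j + alpha_expr i j)) dF_expr dG_expr"
  let ?W = "bivector_apply wbar_e dF_expr dG_expr"
  have zero: "select_terms selected (star_formula w (\<lambda>_ _. 0)) = - (?h * ?W)"
    using select_star_formula[of "\<lambda>_ _. 0"]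
    by (simp add: zero_expr_alpha tensor_inverse_const_matrix[OF ring_map_econst])
  have O: "all_terms selected (?h * ?O)"
    by (rule all_terms_OmInv_bivector[OF alpha_expr_antisym alpha_expr_0 alpha_expr_alpha])
  have W: "all_terms selected (?h * ?W)"
    using all_terms_OmInv_bivector[of "\<lambda>_ _. 0" "\<i> / 2"]
    by (simp add: zero_expr_alpha tensor_inverse_const_matrix[OF ring_map_econst])
  have WO: "select_terms selected (?h * (?W - ?O)) = ?h * ?W - ?h * ?O"
    unfolding right_diff_distrib by (rule select_all[OF all_terms_diff[OF W O]])
  have "select_terms selected (remainder w) = - (?h * ?O) - - (?h * ?W) - (?h * ?W - ?h * ?O)"
    unfolding remainder_def diamonds_e select_diff select_alpha zero WO ..
  also have "\<dots> = 0" by simp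
  finally have "Poly_Mapping.lookup (fps_nth (select_terms selected (remainder w)) n) m = 0"
    by (simp only: fps_zero_nth lookup_zero)
  moreover have "Poly_Mapping.lookup (fps_nth (remainder w) n) m \<noteq> 0"
    using assms by (simp only: in_keys_iff not_False_eq_True)
  ultimately have "\<not> selected m"
    unfolding lookup_select by (metis (full_types))
  then show ?thesis by blast
qed

end

lemma symplectic_chart:
  assumes "symplectic_manifold X \<A> \<omega>" "symplectic_connection \<A> \<omega> \<Gamma>" "c \<in> \<A>"
    and \<alpha>: "\<And>k. closed_two_form \<A> (\<lambda>c x i j. fps_nth (\<alpha> c x i j) k)"
    and f: "smooth_function \<A> f" and g: "smooth_function \<A> g"
  shows "chart_data (cimg c) (\<omega> c) (\<Gamma> c) (\<alpha> c) (f \<circ> cinv c) (g \<circ> cinv c)"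
proof
  note defs = symplectic_manifold_def smooth_manifold_def closed_two_form_def two_form_def
    symplectic_connection_def connection_def
  show "open (cimg c)" using assms(1,3) unfolding defs by blast
  show "smooth_on (cimg c) (\<lambda>x. \<omega> c x i j)" for i j using assms(1,3) unfolding defs by blast
  show "smooth_on (cimg c) (\<lambda>x. \<Gamma> c x k i j)" for k i j using assms(2,3) unfolding defs by blast
  show "smooth_on (cimg c) (\<lambda>x. fps_nth (\<alpha> c x i j) n)" for i j n using \<alpha>[of n] assms(3) unfolding defs by blast
  show "smooth_on (cimg c) (f \<circ> cinv c)" "smooth_on (cimg c) (g \<circ> cinv c)"
    using f g assms(3) by (auto simp: smooth_function_def)
  fix x assume x: "x \<in> cimg c"
  show "\<Gamma> c x k i j = \<Gamma> c x k j i" for k i j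
    using assms(2,3) x unfolding symplectic_connection_def by blast
  show "pd k (\<lambda>x. \<omega> c x i j) x = (\<Sum>l\<in>UNIV. \<Gamma> c x l k i * \<omega> c x l j) + (\<Sum>l\<in>UNIV. \<Gamma> c x l k j * \<omega> c x i l)" for k i j
  proof -
    have "pd k (\<lambda>x. \<omega> c x i j) x - (\<Sum>l\<in>UNIV. \<Gamma> c x l k i * \<omega> c x l j) - (\<Sum>l\<in>UNIV. \<Gamma> c x l k j * \<omega> c x i l) = 0"
      using assms(2,3) x unfolding symplectic_connection_def by blast
    then show ?thesis by simp
  qed
  show "invertible (\<chi> i j. \<omega> c x i j)" using assms(1,3) x unfolding symplectic_manifold_def by blast
qed

lemma cinv_snd:
  assumes "symplectic_manifold X \<A> \<omega>" "c \<in> \<A>" "p \<in> fst c"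
  shows "cinv c (snd c p) = p"
proof -
  have h: "homeomorphic_map (subtopology X (fst c)) (top_of_set (cimg c)) (snd c)" and o: "openin X (fst c)"
    using assms(1,2) by (auto simp: symplectic_manifold_def smooth_manifold_def)
  from h have "inj_on (snd c) (topspace (subtopology X (fst c)))"
    by (rule homeomorphic_imp_injective_map)
  moreover have "topspace (subtopology X (fst c)) = fst c"
    using openin_subset[OF o] by auto
  ultimately show ?thesis using assms(3) by (simp add: cinv_def)
qed

text \<open>Restricted to a chart, the form \<open>r\<close> and the lifts that define a Fedosov star product solve the
  recursions there, so that the results for a chart apply to the value of the product at a point.\<close>

lemma fedosov_star_value:
  assumes \<omega>: "symplectic_manifold X \<A> \<omega>" and \<Gamma>: "symplectic_connection \<A> \<omega> \<Gamma>"
    and \<alpha>: "\<And>k. closed_two_form \<A> (\<lambda>c x i j. fps_nth (\<alpha> c x i j) k)"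
    and star: "fedosov_star \<A> \<omega> \<Gamma> \<Omega> star"
    and c: "c \<in> \<A>" and p: "p \<in> fst c" and f: "smooth_function \<A> f" and g: "smooth_function \<A> g"
  shows "\<And>A. covariant_form A \<Longrightarrow> (\<And>k l. fps_nth (A k l) 0 = 0) \<Longrightarrow>
      (\<And>x k l. x \<in> cimg c \<Longrightarrow> fps_map (chart_data.ev (\<omega> c) (\<Gamma> c) (\<alpha> c) (f \<circ> cinv c) (g \<circ> cinv c) x) (A k l)
        = \<Omega> c x k l - const_matrix (\<lambda>z. z) (\<omega> c x) k l) \<Longrightarrow>
      star f g p = formula_value \<omega> \<Gamma> \<alpha> f g c p
        (star_formula (\<omega> c (snd c p)) (\<lambda>k l. fps_map (specialise (\<omega> c (snd c p))) (A k l)))"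
      (is "\<And>A. covariant_form A \<Longrightarrow> PROP ?zero A \<Longrightarrow> PROP ?ev A \<Longrightarrow> ?value A")
    and "fps_nth (star f g p) 0 = f p * g p"
    and "fps_nth (star f g p) 1 = - \<i> / 2 * (\<Sum>i\<in>UNIV. \<Sum>j\<in>UNIV.
      complex_of_real (tensor_inverse (\<omega> c (snd c p)) i j) * pd i (f \<circ> cinv c) (snd c p) * pd j (g \<circ> cinv c) (snd c p))"
proof -
  interpret chart_data "cimg c" "\<omega> c" "\<Gamma> c" "\<alpha> c" "f \<circ> cinv c" "g \<circ> cinv c"
    by (rule symplectic_chart[OF \<omega> \<Gamma> c \<alpha> f g])
  obtain r a b where r: "fedosov_form \<A> \<omega> \<Gamma> \<Omega> r" and a: "fedosov_lift \<A> \<omega> \<Gamma> r f a" and b: "fedosov_lift \<A> \<omega> \<Gamma> r g b"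
    and v: "\<And>c p. c \<in> \<A> \<Longrightarrow> p \<in> fst c \<Longrightarrow> star f g p =
      circ (\<lambda>z. z) (const_matrix (\<lambda>z. z) (tensor_inverse (\<omega> c (snd c p)))) (a c (snd c p)) (b c (snd c p)) {#}"
    using star f g unfolding fedosov_star_def by meson
  have x: "snd c p \<in> cimg c" using p by (simp add: cimg_def)
  have r3: "deg_ge 3 (r c x j)" if "x \<in> cimg c" for x j
    using r c that by (auto simp: fedosov_form_def deg_ge_def)
  have r': "r c x = r_rhs (\<lambda>z. z) (wbar x) (source_form (\<lambda>z. z)
        (\<lambda>i j k l. complex_of_real (lowered_curvature (\<omega> c) (\<Gamma> c) x i j k l))
        (\<lambda>i j. \<Omega> c x i j - const_matrix (\<lambda>z. z) (\<omega> c x) i j))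
        (\<lambda>k l. weyl_cov (\<Gamma> c) k (\<lambda>x. r c x l) x) (r c x)" if "x \<in> cimg c" for x
    using r c that unfolding fedosov_form_def by blast
  have a': "a c x = lift_rhs (\<lambda>z. z) (wbar x) (r c x) ((f \<circ> cinv c) x) (\<lambda>k. weyl_cov (\<Gamma> c) k (a c) x) (a c x)"
    if "x \<in> cimg c" for x
    using a c that unfolding fedosov_lift_def comp_def by blast
  have b': "b c x = lift_rhs (\<lambda>z. z) (wbar x) (r c x) ((g \<circ> cinv c) x) (\<lambda>k. weyl_cov (\<Gamma> c) k (b c) x) (b c x)"
    if "x \<in> cimg c" for x
    using b c that unfolding fedosov_lift_def comp_def by blast
  show "?value A" if "covariant_form A" "PROP ?zero A" "PROP ?ev A" for A
    unfolding v[OF c p] formula_value_eq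
    by (rule star_value[OF that r3 r' a' b' x])
  show "fps_nth (star f g p) 0 = f p * g p"
    using star_low_orders(1)[where r = "r c" and a = "a c" and b = "b c", OF r3 a' b' x]
    by (simp add: v[OF c p] cinv_snd[OF \<omega> c p])
  show "fps_nth (star f g p) 1 = - \<i> / 2 * (\<Sum>i\<in>UNIV. \<Sum>j\<in>UNIV.
      complex_of_real (tensor_inverse (\<omega> c (snd c p)) i j) * pd i (f \<circ> cinv c) (snd c p) * pd j (g \<circ> cinv c) (snd c p))"
    using star_low_orders(2)[where r = "r c" and a = "a c" and b = "b c", OF r3 a' b' x]
    by (simp add: v[OF c p] winv_def)
qed

lemma fps_split_two:
  fixes s :: "'a::comm_ring_1 fps"
  shows "s = fps_const (fps_nth s 0) + fps_X * fps_const (fps_nth s 1)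
    + suminf (\<lambda>n. fps_X ^ (n + 2) * fps_const (fps_nth s (n + 2)))"
proof -
  have "suminf (\<lambda>n. fps_X ^ (n + 2) * fps_const (fps_nth s (n + 2)))
    = Abs_fps (\<lambda>h. if h < 2 then 0 else fps_nth s h)"
  proof (rule suminf_fps_eqI)
    fix N h :: nat assume "h < N"
    then have "h - 2 < N" by simp
    have "fps_nth (\<Sum>q<N. fps_X ^ (q + 2) * fps_const (fps_nth s (q + 2))) h
      = (\<Sum>q<N. if q = h - 2 then (if h < 2 then 0 else fps_nth s h) else 0)"
      unfolding fps_sum_nth
    proof (intro sum.cong refl)
      fix q
      have "q = h - 2 \<Longrightarrow> \<not> h < 2 \<Longrightarrow> q + 2 = h" by simp
      then show "fps_nth (fps_X ^ (q + 2) * fps_const (fps_nth s (q + 2))) h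
        = (if q = h - 2 then (if h < 2 then 0 else fps_nth s h) else 0)"
        by (cases "q = h - 2"; cases "h < 2") (auto simp: fps_X_power_mult_nth)
    qed
    then show "fps_nth (\<Sum>q<N. fps_X ^ (q + 2) * fps_const (fps_nth s (q + 2))) h
      = fps_nth (Abs_fps (\<lambda>h. if h < 2 then 0 else fps_nth s h)) h"
      using \<open>h - 2 < N\<close> by simp
  qed
  then have tail: "fps_nth (suminf (\<lambda>n. fps_X ^ (n + 2) * fps_const (fps_nth s (n + 2)))) h
      = (if h < 2 then 0 else fps_nth s h)" for h
    by (simp only: fps_nth_Abs_fps)
  show ?thesis
  proof (rule fps_ext)
    fix h :: nat
    consider "h = 0" | "h = 1" | "2 \<le> h" by linarith
    then show "fps_nth s h = fps_nth (fps_const (fps_nth s 0) + fps_X * fps_const (fps_nth s 1)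
        + suminf (\<lambda>n. fps_X ^ (n + 2) * fps_const (fps_nth s (n + 2)))) h"
      unfolding fps_add_nth tail by cases auto
  qed
qed

theorem corollary1:
  fixes X :: "'m topology"
    and \<A> :: "('m, 'n::finite) chart set"
    and \<omega> :: "('m, 'n) chart \<Rightarrow> real^'n \<Rightarrow> 'n \<Rightarrow> 'n \<Rightarrow> real"
    and \<Gamma> :: "('m, 'n) chart \<Rightarrow> real^'n \<Rightarrow> 'n \<Rightarrow> 'n \<Rightarrow> 'n \<Rightarrow> real"
    and \<alpha> \<Omega> :: "('m, 'n) chart \<Rightarrow> real^'n \<Rightarrow> 'n \<Rightarrow> 'n \<Rightarrow> complex fps"
    and star star' :: "('m \<Rightarrow> complex) \<Rightarrow> ('m \<Rightarrow> complex) \<Rightarrow> 'm \<Rightarrow> complex fps"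
    and C :: "nat \<Rightarrow> ('m \<Rightarrow> complex) \<Rightarrow> ('m \<Rightarrow> complex) \<Rightarrow> 'm \<Rightarrow> complex"
  assumes symplectic: "symplectic_manifold X \<A> \<omega>"
    and connection: "symplectic_connection \<A> \<omega> \<Gamma>"
    and alpha_closed: "\<And>k. closed_two_form \<A> (\<lambda>c x i j. fps_nth (\<alpha> c x i j) k)"
    and alpha_hbar: "\<And>c x i j. c \<in> \<A> \<Longrightarrow> x \<in> cimg c \<Longrightarrow> fps_nth (\<alpha> c x i j) 0 = 0"
    and Omega: "\<And>c x i j. \<Omega> c x i j = const_matrix (\<lambda>z. z) (\<omega> c x) i j + \<alpha> c x i j"
    and star: "fedosov_star \<A> \<omega> \<Gamma> (\<lambda>c x. const_matrix (\<lambda>z. z) (\<omega> c x)) star"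
    and star': "fedosov_star \<A> \<omega> \<Gamma> \<Omega> star'"
    and C: "\<And>n f g p. C n f g p = fps_nth (star f g p) n"
  shows "\<exists>\<rho> :: ('n \<Rightarrow> 'n \<Rightarrow> real) \<Rightarrow> 'n expr fps.
    \<forall>c\<in>\<A>. \<forall>p\<in>fst c.
      let x = snd c p;
          w = \<omega> c x;
          ihalf_e = fps_const (econst (\<i> / 2)) * fps_X;
          w_e = const_matrix econst w;
          alphabar_e = raise (const_matrix econst (tensor_inverse w)) alpha_expr;
          Omegabar_e = tensor_inverse (\<lambda>i j. w_e i j + alpha_expr i j);
          ihalf = fps_const (\<i> / 2) * fps_X;
          w_c = const_matrix (\<lambda>z. z) w;
          omegabar = const_matrix (\<lambda>z. z) (tensor_inverse w);
          alphabar = raise omegabar (\<alpha> c x);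
          Omegabar = tensor_inverse (\<Omega> c x)
      in
        select_terms (\<lambda>m. one_differentiable m \<and> \<not> contains_R m \<and> \<not> contains_deriv_alpha m)
            (star_formula w alpha_expr)
          = - (ihalf_e * bivector_apply Omegabar_e dF_expr dG_expr) \<and>
        star_formula w alpha_expr = star_formula w (\<lambda>_ _. 0)
          + ihalf_e * suminf (\<lambda>q. bivector_apply (diamond_power w_e alphabar_e (Suc q)) dF_expr dG_expr)
          + \<rho> w \<and>
        (\<forall>n. \<forall>m\<in>Poly_Mapping.keys (fps_nth (\<rho> w) n).
           contains_R m \<or> contains_deriv_alpha m \<or> \<not> one_differentiable m) \<and>
        (\<forall>f g. smooth_function \<A> f \<longrightarrow> smooth_function \<A> g \<longrightarrow>
          (let df = differential c f p;
               dg = differential c g p;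
               fg = fps_const (f p * g p);
               diamonds = suminf (\<lambda>q. bivector_apply (diamond_power w_c alphabar (Suc q)) df dg);
               higher = suminf (\<lambda>n. fps_X ^ (n + 2) * fps_const (C (n + 2) f g p));
               rho = formula_value \<omega> \<Gamma> \<alpha> f g c p (\<rho> w)
           in
             star' f g p = formula_value \<omega> \<Gamma> \<alpha> f g c p (star_formula w alpha_expr) \<and>
             star' f g p = star f g p + ihalf * diamonds + rho \<and>
             star' f g p = fg - ihalf * (bivector_apply omegabar df dg - diamonds) + higher + rho \<and>
             star' f g p = fg - ihalf * bivector_apply Omegabar df dg + higher + rho))"
proof (rule exI[of _ remainder], intro ballI, goal_cases)
  case (1 c p)
  then have c: "c \<in> \<A>" and p: "p \<in> fst c" by simp_all
  define x where "x = snd c p"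
  define w where "w = \<omega> c x"
  have x: "x \<in> cimg c" using p by (simp add: x_def cimg_def)
  have "invertible (\<chi> i j. \<omega> c x i j)" using symplectic c x unfolding symplectic_manifold_def by blast
  moreover have "\<omega> c x i j = - \<omega> c x j i" for i j
    using symplectic c x unfolding symplectic_manifold_def closed_two_form_def two_form_def by blast
  ultimately interpret w: symplectic_matrix w unfolding w_def by unfold_locales
  let ?star = "star_formula w alpha_expr" and ?base = "star_formula w (\<lambda>_ _. 0)"
  let ?h = "fps_const (econst (\<i> / 2)) * fps_X :: 'n expr fps"
  let ?diamonds = "suminf (\<lambda>q. bivector_apply (diamond_power w.w_e (raise w.wbar_e alpha_expr) (Suc q)) dF_expr dG_expr)"
  have split: "a = b + e + (a - b - e)" for a b e :: "'n expr fps" by simp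
  have expansion: "?star = ?base + ?h * ?diamonds + remainder w"
    unfolding remainder_def by (rule split)
  have \<alpha>_antisym: "\<alpha> c y i j = - \<alpha> c y j i" if "y \<in> cimg c" for y i j
  proof (rule fps_ext)
    fix k
    have "fps_nth (\<alpha> c y i j) k = - fps_nth (\<alpha> c y j i) k"
      using alpha_closed[of k] c that unfolding closed_two_form_def two_form_def by blast
    then show "fps_nth (\<alpha> c y i j) k = fps_nth (- \<alpha> c y j i) k" by (simp only: fps_neg_nth)
  qed
  let ?wc = "const_matrix (\<lambda>z. z) w" and ?wbar = "const_matrix (\<lambda>z. z) (tensor_inverse w)"
  interpret D: deformed_symplectic ?wc ?wbar "\<alpha> c x"
    by (rule deformed_symplectic_const_matrix[OF ring_map_complex_id w.nondegenerate w.antisym \<alpha>_antisym[OF x] alpha_hbar[OF c x]])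
  interpret E: deformed_symplectic w.w_e w.wbar_e alpha_expr by (rule w.deformed_e)
  have \<Omega>x: "\<Omega> c x = (\<lambda>i j. ?wc i j + \<alpha> c x i j)" by (intro ext) (simp add: Omega w_def)
  have star_values: "star' f g p = formula_value \<omega> \<Gamma> \<alpha> f g c p ?star \<and>
       star' f g p = star f g p + (fps_const (\<i> / 2) * fps_X) *
         suminf (\<lambda>q. bivector_apply (diamond_power ?wc (raise ?wbar (\<alpha> c x)) (Suc q)) (differential c f p) (differential c g p))
         + formula_value \<omega> \<Gamma> \<alpha> f g c p (remainder w) \<and>
       star f g p = fps_const (f p * g p) - (fps_const (\<i> / 2) * fps_X) * bivector_apply ?wbar (differential c f p) (differential c g p)
         + suminf (\<lambda>n. fps_X ^ (n + 2) * fps_const (C (n + 2) f g p)) \<and>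
       bivector_apply ?wbar (differential c f p) (differential c g p)
         - suminf (\<lambda>q. bivector_apply (diamond_power ?wc (raise ?wbar (\<alpha> c x)) (Suc q)) (differential c f p) (differential c g p))
         = bivector_apply (tensor_inverse (\<Omega> c x)) (differential c f p) (differential c g p)"
    if f: "smooth_function \<A> f" and g: "smooth_function \<A> g" for f g
  proof -
    let ?df = "differential c f p" and ?dg = "differential c g p"
    interpret chart_data "cimg c" "\<omega> c" "\<Gamma> c" "\<alpha> c" "f \<circ> cinv c" "g \<circ> cinv c"
      by (rule symplectic_chart[OF symplectic connection c alpha_closed f g])
    let ?v = "expr_value (symval x)"
    interpret v: coefficient_map ?v econst "\<lambda>z. z" by (rule coefficient_map_expr_value)
    have fv: "formula_value \<omega> \<Gamma> \<alpha> f g c p s = fps_map ?v s" for s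
      by (simp add: formula_value_eq x_def)
    have ev_alpha: "fps_map (ev y) (u_alpha k l) = \<Omega> c y k l - const_matrix (\<lambda>z. z) (\<omega> c y) k l"
      if "y \<in> cimg c" for y k l
    proof -
      interpret e: coefficient_map "ev y" poly_const "\<lambda>z. z" by (rule coefficient_map_ev)
      have "fps_nth (\<alpha> c y l k) h = - fps_nth (\<alpha> c y k l) h" for h
        by (subst \<alpha>_antisym[OF that]) simp
      then have "fps_map (ev y) (u_alpha k l) = \<alpha> c y k l"
        by (simp add: fps_eq_iff u_alpha_def e.zero e.map_mult e.diff alpha_hbar[OF c that])
      then show ?thesis by (simp add: Omega)
    qed
    note value' = fedosov_star_value[OF symplectic connection alpha_closed star' c p f g]
    note value0 = fedosov_star_value[OF symplectic connection alpha_closed star c p f g]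
    have 1: "star' f g p = fps_map ?v ?star"
      using value'(1)[OF covariant_form_u_alpha _ ev_alpha] by (simp add: u_alpha_def specialise_u_alpha fv w_def x_def
        specialise_u_alpha[unfolded u_alpha_def])
    have 2: "star f g p = fps_map ?v ?base"
    proof -
      have ev0: "fps_map (ev y) 0 = 0" for y
      proof -
        interpret e: coefficient_map "ev y" poly_const "\<lambda>z. z" by (rule coefficient_map_ev)
        show ?thesis by (rule e.fps.zero)
      qed
      have sp0: "fps_map (specialise u) 0 = 0" for u :: "'n \<Rightarrow> 'n \<Rightarrow> real"
      proof -
        interpret s: coefficient_map "specialise u" poly_const econst by (rule coefficient_map_specialise)
        show ?thesis by (rule s.fps.zero)
      qed
      have cov0: "covariant_form (\<lambda>(_::'n) _. 0)"
        by (simp add: covariant_form_def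
          Modules.additive.zero[OF additive_fps_map[OF derivation_additive[OF derivation_u_lie]]])
      show ?thesis
        using value0(1)[of "\<lambda>_ _. 0"] by (simp add: fv w_def x_def ev0 sp0 cov0)
    qed
    have alpha_v: "fps_map ?v (alpha_expr i j) = \<alpha> c x i j" for i j
    proof -
      have "fps_nth (\<alpha> c x j i) h = - fps_nth (\<alpha> c x i j) h" for h
        by (subst \<alpha>_antisym[OF x]) simp
      then show ?thesis
        by (simp add: fps_eq_iff alpha_expr_def v.zero v.map_mult v.diff alpha_hbar[OF c x])
    qed
    have const_v: "fps_map ?v (const_matrix econst B i j) = const_matrix (\<lambda>z. z) B i j" for B i j
      by (simp add: const_matrix_def fps_map_const[OF v.additive_axioms])
    have d_v: "fps_map ?v (dF_expr i) = ?df i" "fps_map ?v (dG_expr i) = ?dg i" for i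
      by (simp_all add: dF_expr_def dG_expr_def differential_def fps_map_const[OF v.additive_axioms] flip: x_def)
        (simp_all add: comp_def)
    have Obar_v: "(\<lambda>i j. fps_map ?v (E.Obar $ i $ j)) = (\<lambda>i j. D.Obar $ i $ j)"
      using E.Obar_map[OF v.ring_map_axioms] D.tensor_inverse_deformed
      by (simp add: v.fps.map_add const_v alpha_v)
    have "fps_map ?v (?h * ?diamonds) = (fps_const (\<i> / 2) * fps_X) *
        (bivector_apply ?wbar ?df ?dg - bivector_apply (\<lambda>i j. D.Obar $ i $ j) ?df ?dg)"
      by (simp add: E.suminf_diamonds v.fps.map_mult v.fps.diff bivector_apply_map[OF v.fps.ring_map_axioms]
        const_v d_v Obar_v fps_map_const[OF v.additive_axioms] fps_map_X[OF v.ring_map_axioms])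
    then have 3: "star' f g p = star f g p + (fps_const (\<i> / 2) * fps_X) *
         suminf (\<lambda>q. bivector_apply (diamond_power ?wc (raise ?wbar (\<alpha> c x)) (Suc q)) ?df ?dg)
         + fps_map ?v (remainder w)"
      unfolding 1 2 D.suminf_diamonds by (subst expansion) (simp add: v.fps.map_add)
    define b where "b = (\<Sum>i\<in>UNIV. \<Sum>j\<in>UNIV.
        complex_of_real (tensor_inverse w i j) * pd i (f \<circ> cinv c) x * pd j (g \<circ> cinv c) x)"
    have bivector: "bivector_apply ?wbar ?df ?dg = fps_const b"
      by (simp add: b_def bivector_apply_def const_matrix_def differential_def x_def fps_eq_iff fps_sum_nth)
    have first_order: "fps_nth (star f g p) 1 = - \<i> / 2 * b"
      unfolding value0(3) b_def w_def x_def ..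
    have 4: "fps_const (f p * g p) - (fps_const (\<i> / 2) * fps_X) * bivector_apply ?wbar ?df ?dg
        = fps_const (fps_nth (star f g p) 0) + fps_X * fps_const (fps_nth (star f g p) 1)"
      unfolding value0(2) first_order bivector by (simp add: fps_eq_iff)
    have 5: "star f g p = fps_const (f p * g p) - (fps_const (\<i> / 2) * fps_X) * bivector_apply ?wbar ?df ?dg
         + suminf (\<lambda>n. fps_X ^ (n + 2) * fps_const (C (n + 2) f g p))"
      unfolding 4 C by (rule fps_split_two)
    have 6: "bivector_apply ?wbar ?df ?dg
         - suminf (\<lambda>q. bivector_apply (diamond_power ?wc (raise ?wbar (\<alpha> c x)) (Suc q)) ?df ?dg)
         = bivector_apply (tensor_inverse (\<Omega> c x)) ?df ?dg"
      unfolding D.suminf_diamonds \<Omega>x D.tensor_inverse_deformed by simp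
    show ?thesis
      unfolding fv by (rule conjI[OF 1 conjI[OF 3 conjI[OF 5 6]]])
  qed
  have final: "star' f g p = formula_value \<omega> \<Gamma> \<alpha> f g c p ?star \<and> star' f g p = s + h * d + \<rho> \<and>
      star' f g p = fg - h * (b - d) + higher + \<rho> \<and> star' f g p = fg - h * b' + higher + \<rho>"
    if "star' f g p = formula_value \<omega> \<Gamma> \<alpha> f g c p ?star \<and> star' f g p = s + h * d + \<rho> \<and>
      s = fg - h * b + higher \<and> b - d = b'" for f g s h d \<rho> fg higher b b'
  proof -
    have third: "star' f g p = fg - h * (b - d) + higher + \<rho>"
    proof -
      have "star' f g p = s + h * d + \<rho>" "s = fg - h * b + higher" using that by blast+
      then have "star' f g p = (fg - h * b + higher) + h * d + \<rho>" by (simp only:)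
      also have "\<dots> = fg - h * (b - d) + higher + \<rho>" by (simp add: right_diff_distrib)
      finally show ?thesis .
    qed
    have "b - d = b'" using that by blast
    from third[unfolded this] third that show ?thesis by blast
  qed
  show ?case
    unfolding Let_def x_def[symmetric] w_def[symmetric]
  proof (rule conjI[OF w.select_alpha conjI[OF expansion conjI]])
    show "\<forall>n. \<forall>m\<in>Poly_Mapping.keys (fps_nth (remainder w) n).
        contains_R m \<or> contains_deriv_alpha m \<or> \<not> one_differentiable m"
      by (intro allI ballI) (rule w.remainder_terms)
  qed (intro allI impI, rule final[OF star_values])
qed

end
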